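(* Let $a,b,c\in\mathbb{Q}$ with $abc\neq 0$ and $4ac-b^2\neq 0$, and let \[\mathcal{E}_3:\ Y^2=X^3-3a^2c^6X-a^2c^8(2ac-b^2)\] over $\mathbb{Q}$. If $b^2\neq kac$ for each $k\in\{27/8,\,27/4\}$, then $\mathcal{E}_3(\mathbb{Q})$ has positive rank. If $b^2=kac$ for some $k\in\{27/8,\,27/4\}$, then $\mathcal{E}_3(\mathbb{Q})$ has rank $0$. *)

theory Defs
  imports Complex_Main "HOL-Algebra.FiniteProduct" "HOL-Library.Extended_Nat"
begin

datatype 'a ec_point = Infinity | Affine 'a 'a

text \<open>
  Short Weierstrass curves \<open>y\<^sup>2 = x\<^sup>3 + A x + B\<close>, with rational points over the field
  \<open>'a\<close> (of characteristic zero), written additively in comments and multiplicatively as an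
  HOL-Algebra structure.
\<close>

definition ec_nonsingular :: "'a::field_char_0 \<Rightarrow> 'a \<Rightarrow> bool" where
  "ec_nonsingular A B \<longleftrightarrow> 4 * A ^ 3 + 27 * B ^ 2 \<noteq> 0"

definition ec_points :: "'a::field_char_0 \<Rightarrow> 'a \<Rightarrow> 'a ec_point set" where
  "ec_points A B = insert Infinity {Affine x y | x y. y ^ 2 = x ^ 3 + A * x + B}"

text \<open>
  The chord-and-tangent law. In the last equation \<open>m\<close> is the slope of the chord, or of the
  tangent when \<open>x1 = x2\<close>: for points on the curve that then have \<open>y1 \<noteq> - y2\<close> one has
  \<open>y1 = y2 \<noteq> 0\<close>, so neither division is by zero. The law does not depend on \<open>B\<close>, and it is
  meaningful only on points of a common curve.
\<close>

fun ec_add :: "'a::field_char_0 \<Rightarrow> 'a ec_point \<Rightarrow> 'a ec_point \<Rightarrow> 'a ec_point" where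
  "ec_add A Infinity Q = Q"
| "ec_add A (Affine x1 y1) Infinity = Affine x1 y1"
| "ec_add A (Affine x1 y1) (Affine x2 y2) =
    (if x1 = x2 \<and> y1 = - y2 then Infinity
     else let m = (if x1 = x2 then (3 * x1 ^ 2 + A) / (2 * y1) else (y2 - y1) / (x2 - x1));
              x3 = m ^ 2 - x1 - x2
          in Affine x3 (m * (x1 - x3) - y1))"

definition ec_group :: "'a::field_char_0 \<Rightarrow> 'a \<Rightarrow> 'a ec_point monoid" where
  "ec_group A B = \<lparr>carrier = ec_points A B, mult = ec_add A, one = Infinity\<rparr>"

text \<open>
  The rank of an abelian group: the supremum of the sizes of its finite \<open>\<int>\<close>-linearly
  independent subsets. It is taken in \<^typ>\<open>enat\<close>, so that it has the value \<open>\<infinity>\<close> rather than a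
  junk value if these sizes are unbounded. For a finitely generated group, i.e.
  \<open>\<int>\<^sup>r \<oplus> torsion\<close>, it is \<open>r\<close>.
\<close>

definition int_independent :: "('a, 'm) monoid_scheme \<Rightarrow> 'a set \<Rightarrow> bool" where
  "int_independent G S \<longleftrightarrow> S \<subseteq> carrier G \<and>
    (\<forall>n :: 'a \<Rightarrow> int. (\<Otimes>\<^bsub>G\<^esub>x\<in>S. x [^]\<^bsub>G\<^esub> n x) = \<one>\<^bsub>G\<^esub> \<longrightarrow> (\<forall>x\<in>S. n x = 0))"

definition abelian_group_rank :: "('a, 'm) monoid_scheme \<Rightarrow> enat" where
  "abelian_group_rank G = Sup {enat (card S) | S. finite S \<and> int_independent G S}"

definition E3_A :: "rat \<Rightarrow> rat \<Rightarrow> rat \<Rightarrow> rat" where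
  "E3_A a b c = - 3 * a ^ 2 * c ^ 6"

definition E3_B :: "rat \<Rightarrow> rat \<Rightarrow> rat \<Rightarrow> rat" where
  "E3_B a b c = - (a ^ 2 * c ^ 8 * (2 * a * c - b ^ 2))"

definition E3 :: "rat \<Rightarrow> rat \<Rightarrow> rat \<Rightarrow> rat ec_point monoid" where
  "E3 a b c = ec_group (E3_A a b c) (E3_B a b c)"

lemma E3_nonsingular:
  assumes "a * b * c \<noteq> 0" and "4 * a * c - b ^ 2 \<noteq> 0"
  shows "ec_nonsingular (E3_A a b c) (E3_B a b c)"
proof -
  have "4 * E3_A a b c ^ 3 + 27 * E3_B a b c ^ 2
      = - 27 * a ^ 4 * c ^ 16 * b ^ 2 * (4 * a * c - b ^ 2)"
    unfolding E3_A_def E3_B_def by algebra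
  then show ?thesis
    using assms by (simp add: ec_nonsingular_def)
qed

end

theory Submission
  imports Defs "HOL-Computational_Algebra.Nth_Powers"
begin

text \<open>
  Up to the scaling \<open>(x, y) \<mapsto> (u\<^sup>2 x, u\<^sup>3 y)\<close> with \<open>u = a c\<^sup>2 / b\<close>, the curve depends only on
  \<open>t = b\<^sup>2 / (a c)\<close>: it is \<open>y\<^sup>2 = x\<^sup>3 - 3 t\<^sup>2 x + t\<^sup>3 (t - 2)\<close> with the rational point \<open>P = (-t, t\<^sup>2)\<close>.

  For positive rank it suffices to look at the prime 2. On a curve with 2-integral coefficients,
  doubling strictly lowers the 2-adic valuation of an abscissa that is not 2-integral, so a point
  with such an abscissa has infinite order. Depending on the valuation of \<open>t\<close>, this applies, after
  scaling by a power of 2, to \<open>n P\<close> or \<open>2 n P\<close> for some \<open>n \<in> {3, 4, 5}\<close>; the only exceptions are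
  \<open>t = 27/8\<close>, where \<open>6 P = 0\<close>, and \<open>t = 27/4\<close>, where \<open>5 P = 0\<close>.

  These two values give the curves \<open>y\<^sup>2 = x\<^sup>3 - 108 x + 297\<close> and \<open>y\<^sup>2 = x\<^sup>3 - 432 x + 8208\<close>, of
  conductors 20 and 11. By descent every rational point is twice a rational point up to a 2-torsion
  point, and halving does not increase a large height; hence the successive halves of a point lie in
  a finite set, one of them recurs, and the point is torsion. The descent uses a 2-isogeny for
  conductor 20. For conductor 11 it takes place in the ring of integers of the cubic field of
  discriminant \<open>-44\<close>, where Hermite's bound for ternary quadratic forms replaces the finiteness
  of the class group and the unit theorem.
\<close>

section \<open>The group law\<close>

text \<open>The prime 2 can serve every \<open>t\<close> because the abscissa of a double has
  denominator 4 y^2: the factor 4 can create a 2-adic pole, and further doublings only deepen it, so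
  no knowledge of the possible torsion orders is involved. The abscissae of 3P and 4P are
  polynomials in \<open>t\<close>; that of 5P has the denominator 4 t - 27, which singles out 27/4,
  while 27/8 is the zero of the ordinate of 3P.

  For rank 0, divisibility by 2 up to 2-torsion alone proves nothing (the additive group of
  rationals is divisible), so the heights are essential; they also spare the proof of finite
  generation. For conductor 11 no 2-torsion point is rational, so the descent value lies in a cubic
  field. Its norm is a square, and it has to be shown to be a unit times a square. Instead of
  factoring ideals, a short vector is sought in a lattice of elements whose squares the value
  divides; the quotient turns out to be a unit bounded at all infinite places, which leaves a finite
  list.\<close>

fun ec_neg :: "'a::field_char_0 ec_point \<Rightarrow> 'a ec_point" where
  "ec_neg Infinity = Infinity"
| "ec_neg (Affine x y) = Affine x (- y)"

text \<open>One relation for chords and tangents: the second equation is the difference of the two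
  curve equations divided by x2 - x1, and for equal points it becomes 2 y1 m = 3 x1^2 + A.\<close>

definition line_rel :: "'a::field_char_0 \<Rightarrow> 'a \<Rightarrow> 'a \<Rightarrow> 'a \<Rightarrow> 'a \<Rightarrow> 'a \<Rightarrow> bool" where
  "line_rel A m x1 y1 x2 y2 \<longleftrightarrow>
     y2 - y1 = m * (x2 - x1) \<and> (y1 + y2) * m = x1 ^ 2 + x1 * x2 + x2 ^ 2 + A"

text \<open>Solving for \<open>y2\<close>, \<open>A\<close> and \<open>B\<close> leaves x1, y1, x2,
  m as free parameters, so that facts about the group law become polynomial identities without side
  conditions.\<close>

lemma line_relD:
  assumes "line_rel A m x1 y1 x2 y2" and "y1 ^ 2 = x1 ^ 3 + A * x1 + B"
  shows "y2 = y1 + m * (x2 - x1)"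
    and "A = (y1 + y2) * m - (x1 ^ 2 + x1 * x2 + x2 ^ 2)"
    and "B = y1 ^ 2 - x1 ^ 3 - A * x1"
  using assms by (simp_all add: line_rel_def algebra_simps)

lemma Affine_in_ec_points [simp]:
  "Affine x y \<in> ec_points A B \<longleftrightarrow> y ^ 2 = x ^ 3 + A * x + B"
  by (auto simp: ec_points_def)

lemma Infinity_in_ec_points [simp]: "Infinity \<in> ec_points A B"
  by (simp add: ec_points_def)

lemma ec_add_Infinity_right [simp]: "ec_add A P Infinity = P"
  by (cases P) auto

lemma ec_neg_in_ec_points [simp]: "ec_neg P \<in> ec_points A B \<longleftrightarrow> P \<in> ec_points A B"
  by (cases P) auto

lemma ec_neg_neg [simp]: "ec_neg (ec_neg P) = P"
  by (cases P) auto

lemma ec_add_neg [simp]: "ec_add A P (ec_neg P) = Infinity"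
  by (cases P) auto

lemma ec_add_eq_Infinity_iff: "ec_add A P Q = Infinity \<longleftrightarrow> Q = ec_neg P"
  by (cases P; cases Q) (auto simp: Let_def)

lemma ex_line_rel:
  assumes P: "y1 ^ 2 = x1 ^ 3 + A * x1 + B" and Q: "y2 ^ 2 = x2 ^ 3 + A * x2 + B"
    and ne: "\<not> (x1 = x2 \<and> y1 = - y2)"
  obtains m where "line_rel A m x1 y1 x2 y2"
proof (cases "x1 = x2")
  case True
  have "(y1 - y2) * (y1 + y2) = 0"
    using P Q True by (simp add: algebra_simps power2_eq_square)
  then have "y1 = y2" "y1 \<noteq> 0"
    using ne True by (auto simp: eq_neg_iff_add_eq_0)
  then have "line_rel A ((3 * x1 ^ 2 + A) / (2 * y1)) x1 y1 x2 y2"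
    using True by (simp add: line_rel_def field_simps power2_eq_square)
  then show ?thesis by (rule that)
next
  case False
  have "(y1 + y2) * (y2 - y1) = (x1 ^ 2 + x1 * x2 + x2 ^ 2 + A) * (x2 - x1)"
    using P Q by algebra
  then have "line_rel A ((y2 - y1) / (x2 - x1)) x1 y1 x2 y2"
    using False by (simp add: line_rel_def field_simps)
  then show ?thesis by (rule that)
qed

lemma ec_add_line:
  fixes A :: "'a::field_char_0"
  assumes "line_rel A m x1 y1 x2 y2" and ne: "\<not> (x1 = x2 \<and> y1 = - y2)"
  shows "ec_add A (Affine x1 y1) (Affine x2 y2) =
    Affine (m ^ 2 - x1 - x2) (m * (x1 - (m ^ 2 - x1 - x2)) - y1)"
proof (cases "x1 = x2")
  case True
  then have "y1 = y2" "y1 \<noteq> 0"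
    using assms by (auto simp: line_rel_def)
  then have "m = (3 * x1 ^ 2 + A) / (2 * y1)"
    using assms True by (simp add: line_rel_def field_simps power2_eq_square)
  then show ?thesis
    using True \<open>y1 = y2\<close> \<open>y1 \<noteq> 0\<close> by (simp add: Let_def)
next
  case False
  then have "m = (y2 - y1) / (x2 - x1)"
    using assms by (simp add: line_rel_def)
  with False show ?thesis
    by (simp add: Let_def)
qed

lemma ec_add_closed:
  assumes "P \<in> ec_points A B" and "Q \<in> ec_points A B"
  shows "ec_add A P Q \<in> ec_points A B"
proof (cases "P = Infinity \<or> Q = Infinity \<or> Q = ec_neg P")
  case True
  then show ?thesis using assms by auto
next
  case False
  then obtain x1 y1 x2 y2 where PQ: "P = Affine x1 y1" "Q = Affine x2 y2"
    by (metis ec_point.exhaust)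
  have ne: "\<not> (x1 = x2 \<and> y1 = - y2)" using False PQ by auto
  have c: "y1 ^ 2 = x1 ^ 3 + A * x1 + B" "y2 ^ 2 = x2 ^ 3 + A * x2 + B"
    using assms PQ by auto
  obtain m where m: "line_rel A m x1 y1 x2 y2"
    using ex_line_rel [OF c ne] .
  have "(m * (x1 - (m ^ 2 - x1 - x2)) - y1) ^ 2
      = (m ^ 2 - x1 - x2) ^ 3 + A * (m ^ 2 - x1 - x2) + B"
    unfolding line_relD(3) [OF m c(1)] line_relD(2) [OF m c(1)] line_relD(1) [OF m c(1)] by algebra
  then show ?thesis
    using ec_add_line [OF m ne] PQ by simp
qed

lemma ec_add_commute:
  assumes "P \<in> ec_points A B" and "Q \<in> ec_points A B"
  shows "ec_add A P Q = ec_add A Q P"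
proof (cases "P = Infinity \<or> Q = Infinity \<or> Q = ec_neg P")
  case True
  then show ?thesis
    by (metis ec_add.simps(1) ec_add_Infinity_right ec_add_neg ec_neg_neg)
next
  case False
  then obtain x1 y1 x2 y2 where PQ: "P = Affine x1 y1" "Q = Affine x2 y2"
    by (metis ec_point.exhaust)
  have ne: "\<not> (x1 = x2 \<and> y1 = - y2)" "\<not> (x2 = x1 \<and> y2 = - y1)" using False PQ by auto
  have c: "y1 ^ 2 = x1 ^ 3 + A * x1 + B" "y2 ^ 2 = x2 ^ 3 + A * x2 + B"
    using assms PQ by auto
  obtain m where m: "line_rel A m x1 y1 x2 y2"
    using ex_line_rel [OF c ne(1)] .
  then have m': "line_rel A m x2 y2 x1 y1"
    unfolding line_rel_def by (simp add: algebra_simps)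
  have "m * (x1 - (m ^ 2 - x1 - x2)) - y1 = m * (x2 - (m ^ 2 - x2 - x1)) - y2"
    unfolding line_relD(1) [OF m c(1)] by algebra
  then show ?thesis
    using ec_add_line [OF m ne(1)] ec_add_line [OF m' ne(2)] PQ by (simp add: algebra_simps)
qed

lemma ec_neg_add:
  assumes "P \<in> ec_points A B" and "Q \<in> ec_points A B"
  shows "ec_neg (ec_add A P Q) = ec_add A (ec_neg P) (ec_neg Q)"
proof (cases "P = Infinity \<or> Q = Infinity \<or> Q = ec_neg P")
  case True
  then show ?thesis
    by (metis ec_add.simps(1) ec_add_Infinity_right ec_add_neg ec_neg.simps(1))
next
  case False
  then obtain x1 y1 x2 y2 where PQ: "P = Affine x1 y1" "Q = Affine x2 y2"
    by (metis ec_point.exhaust)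
  have ne: "\<not> (x1 = x2 \<and> y1 = - y2)" "\<not> (x1 = x2 \<and> - y1 = - (- y2))"
    using False PQ by auto
  have c: "y1 ^ 2 = x1 ^ 3 + A * x1 + B" "y2 ^ 2 = x2 ^ 3 + A * x2 + B"
    using assms PQ by auto
  obtain m where m: "line_rel A m x1 y1 x2 y2"
    using ex_line_rel [OF c ne(1)] .
  then have m': "line_rel A (- m) x1 (- y1) x2 (- y2)"
    unfolding line_rel_def by (simp add: algebra_simps)
  show ?thesis
    using ec_add_line [OF m ne(1)] ec_add_line [OF m' ne(2)] PQ by (simp add: algebra_simps)
qed

text \<open>
  Nonsingularity enters here: at a double root of the cubic the tangent is not defined, so a
  2-torsion point \<open>Q\<close> could satisfy \<open>P + Q = Q\<close>.
\<close>

lemma ec_add_cancel: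
  assumes ns: "ec_nonsingular A B" and P: "P \<in> ec_points A B" and Q: "Q \<in> ec_points A B"
  shows "ec_add A (ec_add A P Q) (ec_neg Q) = P"
proof (cases "P = Infinity \<or> Q = Infinity \<or> Q = ec_neg P")
  case True
  then show ?thesis by auto
next
  case False
  then obtain x1 y1 x2 y2 where PQ: "P = Affine x1 y1" "Q = Affine x2 y2"
    by (metis ec_point.exhaust)
  have ne: "\<not> (x1 = x2 \<and> y1 = - y2)" using False PQ by auto
  have c: "y1 ^ 2 = x1 ^ 3 + A * x1 + B" "y2 ^ 2 = x2 ^ 3 + A * x2 + B"
    using assms PQ by auto
  obtain m where m: "line_rel A m x1 y1 x2 y2"
    using ex_line_rel [OF c ne] .
  define x3 where "x3 = m ^ 2 - x1 - x2"
  define y3 where "y3 = m * (x1 - x3) - y1"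
  have S: "ec_add A P Q = Affine x3 y3"
    using ec_add_line [OF m ne] PQ by (simp add: x3_def y3_def)
  have y3': "y3 = m * (x2 - x3) - y2"
    unfolding line_relD(1) [OF m c(1)] y3_def by algebra
  show ?thesis
  proof (cases "x3 = x2 \<and> y3 = y2")
    case True
    have "y2 = 0" using y3' True by simp
    have x1: "x1 = m ^ 2 - 2 * x2" and y1: "y1 = - m * (x2 - x1)"
      using True x3_def line_relD(1) [OF m c(1)] \<open>y2 = 0\<close>
      by (simp_all add: algebra_simps eq_neg_iff_add_eq_0)
    have "3 * x2 ^ 2 + A = 0"
      unfolding line_relD(2) [OF m c(1)] \<open>y2 = 0\<close> y1 unfolding x1 by algebra
    then have "4 * A ^ 3 + 27 * B ^ 2 = 0"
      using c(2) \<open>y2 = 0\<close> by algebra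
    then show ?thesis
      using ns by (simp add: ec_nonsingular_def)
  next
    case False
    then have ne': "\<not> (x3 = x2 \<and> y3 = - (- y2))" by simp
    have "line_rel A (- m) x3 y3 x2 (- y2)"
      unfolding line_rel_def y3_def x3_def line_relD(2) [OF m c(1)] line_relD(1) [OF m c(1)]
      by algebra
    note line = ec_add_line [OF this ne']
    have e1: "(- m) ^ 2 - x3 - x2 = x1"
      by (simp add: x3_def)
    have e2: "- m * (x3 - x1) - y3 = y1"
      unfolding y3_def by (simp add: algebra_simps)
    show ?thesis using line [unfolded e1 e2] S PQ by simp
  qed
qed

text \<open>
  Eliminating \<open>A\<close> between the relations for the two lines shows that the line through \<open>P + Q\<close> and \<open>R\<close>
  has slope \<open>D - l\<close> with \<open>D = (x1 - x3) / (l - k)\<close>. By symmetry the line through \<open>P\<close> and \<open>Q + R\<close> has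
  slope \<open>D - k\<close>, which reduces associativity to a short computation covering tangents as well.
\<close>

lemma ec_add_assoc_aux:
  assumes m: "line_rel A l x1 y1 x2 y2" and k: "line_rel A k x2 y2 x3 y3" and "l \<noteq> k"
    and c: "y1 ^ 2 = x1 ^ 3 + A * x1 + B" "y2 ^ 2 = x2 ^ 3 + A * x2 + B"
      "y3 ^ 2 = x3 ^ 3 + A * x3 + B"
    and x12: "x12 = l ^ 2 - x1 - x2" and y12: "y12 = l * (x1 - x12) - y1"
    and D: "D * (l - k) = x1 - x3"
    and ne: "\<not> (x12 = x3 \<and> y12 = - y3)"
  shows "line_rel A (D - l) x12 y12 x3 y3"
proof -
  note y2 = line_relD(1) [OF m c(1)] and A = line_relD(2) [OF m c(1)]
    and B = line_relD(3) [OF m c(1)]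
  have c12: "y12 ^ 2 = x12 ^ 3 + A * x12 + B"
    unfolding y12 x12 B A y2 by algebra
  have x1: "x1 = x3 + D * (l - k)"
    using D by simp
  have y1: "y1 = y2 - l * (x2 - x1)"
    using y2 by simp
  have y3: "y3 = y2 + k * (x3 - x2)"
    using line_relD(1) [OF k c(2)] by simp
  have R: "(y2 + y3) * k - (x2 ^ 2 + x2 * x3 + x3 ^ 2) = (y1 + y2) * l - (x1 ^ 2 + x1 * x2 + x2 ^ 2)"
    using A line_relD(2) [OF k c(2)] by simp
  have "(l - k) * (y3 - y12 - (D - l) * (x3 - x12))
    = (y1 + y2) * l - (x1 ^ 2 + x1 * x2 + x2 ^ 2) - ((y2 + y3) * k - (x2 ^ 2 + x2 * x3 + x3 ^ 2))"
    unfolding y12 x12 y3 y1 x1 by algebra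
  then have "(l - k) * (y3 - y12 - (D - l) * (x3 - x12)) = 0"
    using R by simp
  then have 1: "y3 - y12 = (D - l) * (x3 - x12)"
    using \<open>l \<noteq> k\<close> by simp
  have "(y12 + y3) * (D - l) = x12 ^ 2 + x12 * x3 + x3 ^ 2 + A"
  proof (cases "x12 = x3")
    case False
    have "(x3 - x12) * ((y12 + y3) * (D - l) - (x12 ^ 2 + x12 * x3 + x3 ^ 2 + A))
      = (y12 + y3) * ((D - l) * (x3 - x12)) - (x3 ^ 3 + A * x3 + B) + (x12 ^ 3 + A * x12 + B)"
      by algebra
    also have "\<dots> = 0"
      unfolding 1 [symmetric] c12 [symmetric] c(3) [symmetric] by algebra
    finally show ?thesis using False by simp
  next
    case True
    have y123: "y12 = y3" using 1 True by simp
    have x2: "x2 = l ^ 2 - x1 - x3"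
      unfolding True [symmetric] x12 by simp
    have "2 * y2 = - (l + k) * (x3 - x2)"
      using y123 unfolding y12 True y3 y1 by algebra
    then have y2': "y2 = - (l + k) * (x3 - x2) / 2"
      by (simp add: field_simps)
    have "(y12 + y3) * (D - l) - (x12 ^ 2 + x12 * x3 + x3 ^ 2 + A) = 0"
      unfolding A y123 True y3 y1 y2' unfolding x2 x1 by (simp add: field_simps) algebra
    then show ?thesis by simp
  qed
  with 1 show ?thesis by (simp add: line_rel_def)
qed

lemma ec_add_assoc:
  assumes ns: "ec_nonsingular A B"
    and P: "P \<in> ec_points A B" and Q: "Q \<in> ec_points A B" and R: "R \<in> ec_points A B"
  shows "ec_add A (ec_add A P Q) R = ec_add A P (ec_add A Q R)"
proof -
  note closed = ec_add_closed [of _ A B] and comm = ec_add_commute [of _ A B]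
    and cancel = ec_add_cancel [OF ns]
  consider (inf) "P = Infinity \<or> Q = Infinity \<or> R = Infinity"
    | (PQ) "Q = ec_neg P" | (QR) "R = ec_neg Q" | (R) "R = ec_neg (ec_add A P Q)"
    | (P) "P = ec_neg (ec_add A Q R)" | (PR) "P = R"
    | (gen) "P \<noteq> Infinity" "Q \<noteq> Infinity" "R \<noteq> Infinity" "Q \<noteq> ec_neg P" "R \<noteq> ec_neg Q"
      "R \<noteq> ec_neg (ec_add A P Q)" "P \<noteq> ec_neg (ec_add A Q R)" "P \<noteq> R"
    by blast
  then show ?thesis
  proof cases
    case inf
    then show ?thesis by auto
  next
    case PQ
    have "ec_add A (ec_add A R Q) (ec_neg Q) = R"
      by (rule cancel [OF R Q])
    then show ?thesis
      using PQ P Q R by (simp add: comm closed)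
  next
    case QR
    then show ?thesis
      using cancel [OF P Q] comm [OF Q, of R] by simp
  next
    case R
    have "ec_add A Q R = ec_neg (ec_add A (ec_add A P Q) (ec_neg Q))"
      using R P Q closed by (simp add: ec_neg_add [of _ A B] comm)
    also have "\<dots> = ec_neg P"
      using cancel [OF P Q] by simp
    finally show ?thesis
      using R by simp
  next
    case P
    have "ec_add A P Q = ec_neg (ec_add A (ec_add A R Q) (ec_neg Q))"
      using P R Q closed by (simp add: ec_neg_add [of _ A B] comm)
    also have "\<dots> = ec_neg R"
      using cancel [OF R Q] by simp
    finally have "ec_add A (ec_add A P Q) R = Infinity"
      using R by (simp add: comm)
    moreover have "ec_add A P (ec_add A Q R) = Infinity"
      using P Q R closed by (subst comm) auto
    ultimately show ?thesis by simp
  next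
    case PR
    then show ?thesis
      using P Q R closed by (simp add: comm)
  next
    case gen
    then obtain x1 y1 x2 y2 x3 y3
      where e: "P = Affine x1 y1" "Q = Affine x2 y2" "R = Affine x3 y3"
      by (metis ec_point.exhaust)
    have c: "y1 ^ 2 = x1 ^ 3 + A * x1 + B" "y2 ^ 2 = x2 ^ 3 + A * x2 + B"
      "y3 ^ 2 = x3 ^ 3 + A * x3 + B"
      using P Q R e by auto
    have ne1: "\<not> (x1 = x2 \<and> y1 = - y2)" and ne2: "\<not> (x2 = x3 \<and> y2 = - y3)"
      using gen e by auto
    obtain l where l: "line_rel A l x1 y1 x2 y2" using ex_line_rel [OF c(1,2) ne1] .
    obtain k where k: "line_rel A k x2 y2 x3 y3" using ex_line_rel [OF c(2,3) ne2] .
    define x12 where "x12 = l ^ 2 - x1 - x2"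
    define y12 where "y12 = l * (x1 - x12) - y1"
    define x23 where "x23 = k ^ 2 - x3 - x2"
    define y23 where "y23 = k * (x3 - x23) - y3"
    have k': "line_rel A k x3 y3 x2 y2" and l': "line_rel A l x2 y2 x1 y1"
      using k l unfolding line_rel_def by (simp_all add: algebra_simps)
    have S12: "ec_add A P Q = Affine x12 y12"
      using ec_add_line [OF l ne1] e by (simp add: x12_def y12_def)
    have ne2': "\<not> (x3 = x2 \<and> y3 = - y2)" using ne2 by auto
    have S23: "ec_add A Q R = Affine x23 y23"
      using ec_add_line [OF k' ne2'] comm [OF Q R] e by (simp add: x23_def y23_def)
    have ne12: "\<not> (x12 = x3 \<and> y12 = - y3)"
      using gen(6) S12 e by auto
    have ne23: "\<not> (x23 = x1 \<and> y23 = - y1)"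
      using gen(7) S23 e by auto
    \<comment> \<open>Equal slopes would put the three points on one line. Then either P = R, or R
      is the third intersection point of the line through P and Q, that is -(P + Q); both are
      excluded here.\<close>
    have "l \<noteq> k"
    proof
      assume "l = k"
      note rl = l [unfolded line_rel_def] and rk = k [unfolded line_rel_def, folded \<open>l = k\<close>]
      have "y3 - y1 = (y3 - y2) + (y2 - y1)"
        by simp
      also have "\<dots> = l * (x3 - x1)"
        unfolding conjunct1 [OF rl] conjunct1 [OF rk] by (simp add: algebra_simps)
      finally have y31: "y3 - y1 = l * (x3 - x1)" .
      have "(y2 + y3) * l - (y1 + y2) * l = x2 ^ 2 + x2 * x3 + x3 ^ 2 - (x1 ^ 2 + x1 * x2 + x2 ^ 2)"
        using rl rk by simp
      then have "(y3 - y1) * l = (x3 - x1) * (x1 + x2 + x3)"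
        by algebra
      then have "(x3 - x1) * (l ^ 2 - x1 - x2 - x3) = 0"
        unfolding y31 by algebra
      then consider "x3 = x1" | "x3 = x12"
        unfolding x12_def by auto
      then show False
      proof cases
        case 1
        then show False using y31 gen(8) e by simp
      next
        case 2
        then show False using y31 ne12 unfolding y12_def by (simp add: algebra_simps)
      qed
    qed
    define D where "D = (x1 - x3) / (l - k)"
    have D: "D * (l - k) = x1 - x3" and D': "D * (k - l) = x3 - x1"
      using \<open>l \<noteq> k\<close> by (simp_all add: D_def field_simps)
    have m1: "line_rel A (D - l) x12 y12 x3 y3"
      by (rule ec_add_assoc_aux [OF l k \<open>l \<noteq> k\<close> c x12_def y12_def D ne12])
    have m2: "line_rel A (D - k) x23 y23 x1 y1"
      by (rule ec_add_assoc_aux [OF k' l' \<open>l \<noteq> k\<close> [symmetric] c(3,2,1) x23_def y23_def D' ne23])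
    define X where "X = (D - l) ^ 2 - x12 - x3"
    have X': "X = (D - k) ^ 2 - x23 - x1"
      unfolding X_def x12_def x23_def using D by algebra
    have y3: "y3 = y1 + l * (x2 - x1) + k * (x3 - x2)"
      using line_relD(1) [OF l c(1)] line_relD(1) [OF k c(2)] by simp
    have x1: "x1 = x3 + D * (l - k)"
      using D by simp
    have "(D - l) * (x12 - X) - y12 = (D - k) * (x23 - X) - y23"
      unfolding X_def y12_def y23_def y3 x12_def x23_def unfolding x1 by algebra
    moreover have "ec_add A (ec_add A P Q) R = Affine X ((D - l) * (x12 - X) - y12)"
      unfolding S12 e(3) ec_add_line [OF m1 ne12] X_def ..
    moreover have "ec_add A (ec_add A Q R) P = Affine X ((D - k) * (x23 - X) - y23)"
      unfolding S23 e(1) ec_add_line [OF m2 ne23] X' ..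
    ultimately have "ec_add A (ec_add A P Q) R = ec_add A (ec_add A Q R) P"
      by simp
    then show ?thesis
      using comm [OF P closed [OF Q R]] by simp
  qed
qed

lemma ec_group_simps [simp]:
  "carrier (ec_group A B) = ec_points A B" "monoid.one (ec_group A B) = Infinity"
  "monoid.mult (ec_group A B) = ec_add A"
  by (simp_all add: ec_group_def)

lemma comm_group_ec_group:
  assumes "ec_nonsingular A B"
  shows "comm_group (ec_group A B)"
proof (rule comm_groupI)
  fix P assume "P \<in> carrier (ec_group A B)"
  then show "\<exists>Q \<in> carrier (ec_group A B). Q \<otimes>\<^bsub>ec_group A B\<^esub> P = \<one>\<^bsub>ec_group A B\<^esub>"
    by (intro bexI [of _ "ec_neg P"]) (auto simp: ec_add_eq_Infinity_iff)
qed (auto simp: ec_add_closed intro: ec_add_assoc [OF assms] ec_add_commute)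

section \<open>Torsion, rank and scaling\<close>

definition torsion :: "('a, 'm) monoid_scheme \<Rightarrow> 'a \<Rightarrow> bool" where
  "torsion G P \<longleftrightarrow> (\<exists>n::nat. n > 0 \<and> P [^]\<^bsub>G\<^esub> n = \<one>\<^bsub>G\<^esub>)"

lemma (in group) finite_powers_if_torsion:
  assumes P: "P \<in> carrier G" and "torsion G P"
  shows "finite (range (\<lambda>k::nat. P [^] k))"
proof -
  obtain n :: nat where n: "n > 0" "P [^] n = \<one>"
    using assms by (auto simp: torsion_def)
  have "P [^] k = P [^] (k mod n)" for k
  proof -
    have "P [^] k = P [^] (n * (k div n) + k mod n)" by simp
    also have "\<dots> = (P [^] n) [^] (k div n) \<otimes> P [^] (k mod n)"
      using P by (simp only: nat_pow_mult [symmetric] nat_pow_pow)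
    finally show ?thesis using n P by simp
  qed
  moreover have "k mod n \<in> {..<n}" for k
    using n(1) by simp
  ultimately have "range (\<lambda>k::nat. P [^] k) \<subseteq> (\<lambda>k::nat. P [^] k) ` {..<n}"
    by (intro image_subsetI) (rule image_eqI)
  then show ?thesis
    using finite_subset by blast
qed

lemma (in group) torsion_pow:
  assumes "P \<in> carrier G" and "torsion G P"
  shows "torsion G (P [^] (k::nat))"
proof -
  obtain n :: nat where n: "n > 0" "P [^] n = \<one>"
    using assms by (auto simp: torsion_def)
  have "(P [^] k) [^] n = (P [^] n) [^] k"
    using assms by (simp add: nat_pow_pow mult.commute)
  then show ?thesis
    using n by (auto simp: torsion_def)
qed

lemma (in group) torsion_if_pow_torsion:
  assumes "P \<in> carrier G" and "torsion G (P [^] (k::nat))" and "k > 0"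
  shows "torsion G P"
proof -
  obtain n :: nat where n: "n > 0" "(P [^] k) [^] n = \<one>"
    using assms by (auto simp: torsion_def)
  then have "P [^] (k * n) = \<one>"
    using assms by (simp add: nat_pow_pow)
  then show ?thesis
    using n assms by (auto simp: torsion_def intro!: exI [of _ "k * n"])
qed

lemma (in comm_group) rank_pos_if_not_torsion:
  assumes P: "P \<in> carrier G" and nt: "\<not> torsion G P"
  shows "abelian_group_rank G > 0"
proof -
  have pow: "m = 0" if "P [^] (m::int) = \<one>" for m
  proof (rule ccontr)
    assume "m \<noteq> 0"
    have "P [^] nat \<bar>m\<bar> = \<one>"
    proof (cases "m \<ge> 0")
      case True
      then have "P [^] m = P [^] nat \<bar>m\<bar>"
        by (metis abs_of_nonneg int_pow_int nat_0_le)
      then show ?thesis using that by simp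
    next
      case False
      then have "P [^] m = inv (P [^] nat \<bar>m\<bar>)"
        using int_pow_neg_int [OF P, of "nat \<bar>m\<bar>"] by simp
      then show ?thesis using that P by (metis inv_inv inv_one nat_pow_closed)
    qed
    then show False
      using nt \<open>m \<noteq> 0\<close> unfolding torsion_def by (metis zero_less_abs_iff zero_less_nat_eq)
  qed
  have "int_independent G {P}"
    unfolding int_independent_def
    using P pow by (auto simp: Pi_def)
  then have "enat (card {P}) \<le> abelian_group_rank G"
    unfolding abelian_group_rank_def by (intro Sup_upper) blast
  moreover have "0 < enat (card {P})"
    by (simp add: zero_enat_def)
  ultimately show ?thesis
    by (rule less_le_trans [rotated])
qed

lemma (in comm_group) rank_zero_if_all_torsion:
  assumes tors: "\<And>P. P \<in> carrier G \<Longrightarrow> torsion G P"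
  shows "abelian_group_rank G = 0"
proof -
  have "S = {}" if S: "finite S" "int_independent G S" for S
  proof (rule ccontr)
    assume "S \<noteq> {}"
    then obtain P where "P \<in> S" by auto
    have car: "S \<subseteq> carrier G" using S by (auto simp: int_independent_def)
    obtain n :: nat where n: "n > 0" "P [^] n = \<one>"
      using tors car \<open>P \<in> S\<close> by (auto simp: torsion_def)
    define e where "e = (\<lambda>x. if x = P then int n else 0)"
    have "(\<Otimes>x\<in>S. x [^] e x) = \<one>"
      using n by (intro finprod_one_eqI) (auto simp: e_def int_pow_int)
    then have "e P = 0"
      using S \<open>P \<in> S\<close> by (auto simp: int_independent_def)
    then show False using n by (simp add: e_def)
  qed
  then have "{enat (card S) | S. finite S \<and> int_independent G S} \<subseteq> {0}"
    by (auto simp: zero_enat_def)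
  then have "Sup {enat (card S) | S. finite S \<and> int_independent G S} \<le> Sup {0}"
    by (rule Sup_subset_mono)
  then show ?thesis
    unfolding abelian_group_rank_def by simp
qed

text \<open>Heights may grow up to the fixed bound \<open>K\<close>, since only finiteness of the
  orbit matters. Passing to squares removes \<open>T\<close>, so the squares form a chain of exact
  square roots, and a recurrence c (i + k) = c i gives R^(2^k) = R for R = (c i)^2.\<close>

lemma (in comm_group) torsion_if_halving:
  fixes h :: "'a \<Rightarrow> nat"
  assumes fin: "\<And>M. finite {P \<in> carrier G. h P \<le> M}"
    and half: "\<And>P. P \<in> carrier G \<Longrightarrow> \<exists>Q \<in> carrier G. \<exists>T \<in> carrier G.
      T \<otimes> T = \<one> \<and> P = Q \<otimes> Q \<otimes> T \<and> h Q \<le> max K (h P)"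
    and P: "P \<in> carrier G"
  shows "torsion G P"
proof -
  obtain f where f: "\<And>P. P \<in> carrier G \<Longrightarrow> f P \<in> carrier G \<and>
      (\<exists>T \<in> carrier G. T \<otimes> T = \<one> \<and> P = f P \<otimes> f P \<otimes> T) \<and> h (f P) \<le> max K (h P)"
    using half by metis
  define c where "c = (\<lambda>i. (f ^^ i) P)"
  have car: "c i \<in> carrier G" for i
    by (induction i) (auto simp: c_def P f)
  have bound: "h (c i) \<le> max K (h P)" for i
  proof (induction i)
    case (Suc i)
    have "h (c (Suc i)) \<le> max K (h (c i))"
      using f [OF car [of i]] by (simp add: c_def)
    with Suc show ?case by simp
  qed (simp add: c_def)
  have step: "(c (Suc i) [^] (2::nat)) [^] (2::nat) = c i [^] (2::nat)" for i
  proof -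
    obtain T where T: "T \<in> carrier G" "T \<otimes> T = \<one>" "c i = c (Suc i) \<otimes> c (Suc i) \<otimes> T"
      using f [OF car [of i]] by (auto simp: c_def)
    have "c i [^] (2::nat) = (c (Suc i) [^] (2::nat) \<otimes> T) [^] (2::nat)"
      using T car by (simp add: numeral_2_eq_2)
    also have "\<dots> = (c (Suc i) [^] (2::nat)) [^] (2::nat) \<otimes> T [^] (2::nat)"
      using T car by (simp add: nat_pow_distrib)
    also have "T [^] (2::nat) = \<one>"
      using T by (simp add: numeral_2_eq_2)
    finally show ?thesis using car by simp
  qed
  have steps: "(c (i + k) [^] (2::nat)) [^] ((2::nat) ^ k) = c i [^] (2::nat)" for i k
  proof (induction k)
    case (Suc k)
    have "(c (i + Suc k) [^] (2::nat)) [^] ((2::nat) ^ Suc k)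
      = ((c (Suc (i + k)) [^] (2::nat)) [^] (2::nat)) [^] ((2::nat) ^ k)"
      using car by (simp add: nat_pow_pow mult.assoc)
    then show ?case using step Suc by simp
  qed (use car in simp)
  have "finite (range c)"
    by (rule finite_subset [OF _ fin [of "max K (h P)"]]) (use car bound in auto)
  then have "\<not> inj c"
    using finite_imageD infinite_UNIV_nat by blast
  then obtain i j where "i < j" "c i = c j"
    unfolding inj_def by (metis linorder_neq_iff)
  define k where "k = j - i"
  have k: "k > 0" "c (i + k) = c i" using \<open>i < j\<close> \<open>c i = c j\<close> by (auto simp: k_def)
  have "(1::nat) < 2 ^ k" using k by (intro one_less_power) auto
  then obtain n where n: "(2::nat) ^ k = Suc n" "n > 0"
    by (intro that [of "2 ^ k - 1"]) auto
  let ?R = "c i [^] (2::nat)"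
  have R: "?R \<in> carrier G" using car by simp
  have "?R [^] n \<otimes> ?R = \<one> \<otimes> ?R"
    using steps [of i k] k n R by simp
  then have "?R [^] n = \<one>"
    using R by (metis right_cancel nat_pow_closed one_closed)
  then have "torsion G ?R"
    using n by (auto simp: torsion_def)
  then have "torsion G (c i)"
    using car torsion_if_pow_torsion by simp
  moreover have "c 0 [^] (2::nat) = (c i [^] (2::nat)) [^] ((2::nat) ^ i)"
    using steps [of 0 i] by simp
  ultimately have "torsion G (c 0 [^] (2::nat))"
    using torsion_pow car by simp
  then show ?thesis
    using torsion_if_pow_torsion [of "c 0" 2] P by (simp add: c_def)
qed

section \<open>Isomorphisms between scaled models\<close>

fun ec_scale :: "'a::field_char_0 \<Rightarrow> 'a ec_point \<Rightarrow> 'a ec_point" where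
  "ec_scale u Infinity = Infinity"
| "ec_scale u (Affine x y) = Affine (u ^ 2 * x) (u ^ 3 * y)"

lemma ec_scale_eq_Infinity_iff [simp]: "ec_scale u P = Infinity \<longleftrightarrow> P = Infinity"
  by (cases P) auto

lemma ec_scale_in_ec_points:
  assumes "u \<noteq> 0"
  shows "ec_scale u P \<in> ec_points (A * u ^ 4) (B * u ^ 6) \<longleftrightarrow> P \<in> ec_points A B"
proof (cases P)
  case (Affine x y)
  have *: "(u ^ 3 * y) ^ 2 - ((u ^ 2 * x) ^ 3 + A * u ^ 4 * (u ^ 2 * x) + B * u ^ 6)
      = u ^ 6 * (y ^ 2 - (x ^ 3 + A * x + B))"
    by algebra
  show ?thesis
    unfolding Affine ec_scale.simps Affine_in_ec_points
      eq_iff_diff_eq_0 [of "(u ^ 3 * y) ^ 2"] eq_iff_diff_eq_0 [of "y ^ 2"] *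
    using assms by simp
qed simp

lemma ec_add_scale:
  assumes u: "u \<noteq> 0" and "P \<in> ec_points A B" and "Q \<in> ec_points A B"
  shows "ec_add (A * u ^ 4) (ec_scale u P) (ec_scale u Q) = ec_scale u (ec_add A P Q)"
proof (cases "P = Infinity \<or> Q = Infinity \<or> Q = ec_neg P")
  case True
  have "ec_scale u (ec_neg P) = ec_neg (ec_scale u P)"
    by (cases P) auto
  with True show ?thesis by auto
next
  case False
  then obtain x1 y1 x2 y2 where PQ: "P = Affine x1 y1" "Q = Affine x2 y2"
    by (metis ec_point.exhaust)
  have ne: "\<not> (x1 = x2 \<and> y1 = - y2)" using False PQ by auto
  have ne': "\<not> (u ^ 2 * x1 = u ^ 2 * x2 \<and> u ^ 3 * y1 = - (u ^ 3 * y2))"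
    using ne u by (simp flip: mult_minus_right)
  have c: "y1 ^ 2 = x1 ^ 3 + A * x1 + B" "y2 ^ 2 = x2 ^ 3 + A * x2 + B"
    using assms PQ by auto
  obtain m where m: "line_rel A m x1 y1 x2 y2"
    using ex_line_rel [OF c ne] .
  have m': "line_rel (A * u ^ 4) (u * m) (u ^ 2 * x1) (u ^ 3 * y1) (u ^ 2 * x2) (u ^ 3 * y2)"
    unfolding line_rel_def line_relD(2) [OF m c(1)] line_relD(1) [OF m c(1)] by algebra
  have x: "(u * m) ^ 2 - u ^ 2 * x1 - u ^ 2 * x2 = u ^ 2 * (m ^ 2 - x1 - x2)"
    by algebra
  have y: "u * m * (u ^ 2 * x1 - u ^ 2 * (m ^ 2 - x1 - x2)) - u ^ 3 * y1
    = u ^ 3 * (m * (x1 - (m ^ 2 - x1 - x2)) - y1)"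
    by algebra
  show ?thesis
    unfolding PQ ec_scale.simps ec_add_line [OF m ne] ec_add_line [OF m' ne'] x y ..
qed

lemma ec_nonsingular_scale:
  assumes "ec_nonsingular A B" and "u \<noteq> 0"
  shows "ec_nonsingular (A * u ^ 4) (B * u ^ 6)"
proof -
  have "4 * (A * u ^ 4) ^ 3 + 27 * (B * u ^ 6) ^ 2 = u ^ 12 * (4 * A ^ 3 + 27 * B ^ 2)"
    by algebra
  with assms show ?thesis by (simp add: ec_nonsingular_def)
qed

lemma ec_pow_scale:
  assumes ns: "ec_nonsingular A B" and u: "u \<noteq> 0" and P: "P \<in> ec_points A B"
  shows "ec_scale u P [^]\<^bsub>ec_group (A * u ^ 4) (B * u ^ 6)\<^esub> (n::nat)
    = ec_scale u (P [^]\<^bsub>ec_group A B\<^esub> n)"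
proof -
  interpret comm_group "ec_group A B" by (rule comm_group_ec_group [OF ns])
  have car: "P [^]\<^bsub>ec_group A B\<^esub> n \<in> ec_points A B" for n :: nat
    using nat_pow_closed [of P n] P by simp
  show ?thesis
    by (induction n) (use car P u in \<open>simp_all add: nat_pow_def ec_add_scale [of _ _ A B]\<close>)
qed

lemma torsion_ec_scale_iff:
  assumes "ec_nonsingular A B" and "u \<noteq> 0" and "P \<in> ec_points A B"
  shows "torsion (ec_group (A * u ^ 4) (B * u ^ 6)) (ec_scale u P) \<longleftrightarrow> torsion (ec_group A B) P"
  by (simp add: torsion_def ec_pow_scale [OF assms])

lemma ec_scale_surj:
  assumes u: "u \<noteq> 0" and Q: "Q \<in> ec_points (A * u ^ 4) (B * u ^ 6)"
  obtains P where "P \<in> ec_points A B" "Q = ec_scale u P"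
proof (cases Q)
  case Infinity
  then show ?thesis using that [of Infinity] by simp
next
  case (Affine x y)
  then have "Q = ec_scale u (Affine (x / u ^ 2) (y / u ^ 3))"
    using u by simp
  then show ?thesis
    using that Q ec_scale_in_ec_points [OF u] by metis
qed

section \<open>The duplication formula\<close>

lemma ec_add_self:
  assumes "y \<noteq> 0"
  shows "ec_add A (Affine x y) (Affine x y) =
    (let m = (3 * x ^ 2 + A) / (2 * y) in Affine (m ^ 2 - 2 * x) (m * (3 * x - m ^ 2) - y))"
  using assms by (simp add: Let_def algebra_simps)

lemma ec_double_x:
  assumes c: "y ^ 2 = x ^ 3 + A * x + B" and y: "y \<noteq> 0"
  shows "\<exists>y'. ec_add A (Affine x y) (Affine x y) =
    Affine ((x ^ 4 - 2 * A * x ^ 2 - 8 * B * x + A ^ 2) / (4 * (x ^ 3 + A * x + B))) y'"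
proof -
  have "B = y ^ 2 - x ^ 3 - A * x" using c by simp
  then have num: "x ^ 4 - 2 * A * x ^ 2 - 8 * B * x + A ^ 2 = (3 * x ^ 2 + A) ^ 2 - 8 * x * y ^ 2"
    by algebra
  have "((3 * x ^ 2 + A) / (2 * y)) ^ 2 - 2 * x
    = (x ^ 4 - 2 * A * x ^ 2 - 8 * B * x + A ^ 2) / (4 * (x ^ 3 + A * x + B))"
    unfolding c [symmetric] num using y by (simp add: power_divide power_mult_distrib diff_divide_distrib)
  then show ?thesis
    unfolding ec_add_self [OF y] Let_def by (simp only: ec_point.inject) blast
qed

section \<open>Points of infinite order\<close>

definition odd_den :: "rat set" where
  "odd_den = {of_int a / of_int b | a b. odd b}"

definition odd_unit :: "rat set" where
  "odd_unit = {of_int a / of_int b | a b. odd a \<and> odd b}"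

lemma odd_den_of_int [simp]: "of_int a \<in> odd_den"
proof -
  have "(of_int a :: rat) = of_int a / of_int 1 \<and> odd (1::int)" by simp
  then show ?thesis unfolding odd_den_def by blast
qed

lemma odd_den_numerals [simp]: "0 \<in> odd_den" "1 \<in> odd_den" "numeral n \<in> odd_den"
  using odd_den_of_int [of 0] odd_den_of_int [of 1] odd_den_of_int [of "numeral n"] by simp_all


lemma odd_den_add:
  assumes "x \<in> odd_den" and "y \<in> odd_den"
  shows "x + y \<in> odd_den"
proof -
  obtain a b c d where "x = of_int a / of_int b" "odd b" "y = of_int c / of_int d" "odd d"
    using assms by (auto simp: odd_den_def)
  then have *: "b \<noteq> 0" "d \<noteq> 0" "odd (b * d)" by auto
  have "x + y = of_int (a * d + c * b) / of_int (b * d)"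
    using * \<open>x = _\<close> \<open>y = _\<close> by (simp add: add_frac_eq)
  with * show ?thesis unfolding odd_den_def by blast
qed

lemma odd_den_mult:
  assumes "x \<in> odd_den" and "y \<in> odd_den"
  shows "x * y \<in> odd_den"
proof -
  obtain a b c d where "x = of_int a / of_int b" "odd b" "y = of_int c / of_int d" "odd d"
    using assms by (auto simp: odd_den_def)
  then have "x * y = of_int (a * c) / of_int (b * d)" "odd (b * d)"
    by auto
  then show ?thesis unfolding odd_den_def by blast
qed

lemma odd_den_minus: "x \<in> odd_den \<Longrightarrow> - x \<in> odd_den"
  using odd_den_mult [of "of_int (- 1)" x] odd_den_of_int [of "- 1"] by simp

lemma odd_den_diff: "x \<in> odd_den \<Longrightarrow> y \<in> odd_den \<Longrightarrow> x - y \<in> odd_den"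
  using odd_den_add [of x "- y"] by (simp add: odd_den_minus)

lemma odd_den_power: "x \<in> odd_den \<Longrightarrow> x ^ n \<in> odd_den"
  by (induction n) (auto intro: odd_den_mult)

lemmas odd_den_intros = odd_den_add odd_den_diff odd_den_mult odd_den_minus odd_den_power
  odd_den_numerals

lemma odd_unit_odd_den: "x \<in> odd_unit \<Longrightarrow> x \<in> odd_den"
  by (auto simp: odd_den_def odd_unit_def)

lemma odd_unit_nonzero: "x \<in> odd_unit \<Longrightarrow> x \<noteq> 0"
  by (auto simp: odd_unit_def)

lemma odd_unit_of_int:
  assumes "odd a"
  shows "of_int a \<in> odd_unit"
proof -
  have "(of_int a :: rat) = of_int a / of_int 1 \<and> odd a \<and> odd (1::int)" using assms by simp
  then show ?thesis unfolding odd_unit_def by blast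
qed

lemma odd_unit_mult:
  assumes "x \<in> odd_unit" and "y \<in> odd_unit"
  shows "x * y \<in> odd_unit"
proof -
  obtain a b c d where "x = of_int a / of_int b" "odd a" "odd b"
      "y = of_int c / of_int d" "odd c" "odd d"
    using assms by (auto simp: odd_unit_def)
  then have "x * y = of_int (a * c) / of_int (b * d)" "odd (a * c)" "odd (b * d)"
    by auto
  then show ?thesis unfolding odd_unit_def by blast
qed

lemma odd_unit_divide:
  assumes "x \<in> odd_unit" and "y \<in> odd_unit"
  shows "x / y \<in> odd_unit"
proof -
  obtain a b c d where "x = of_int a / of_int b" "odd a" "odd b"
      "y = of_int c / of_int d" "odd c" "odd d"
    using assms by (auto simp: odd_unit_def)
  then have "x / y = of_int (a * d) / of_int (b * c)" "odd (a * d)" "odd (b * c)"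
    by auto
  then show ?thesis unfolding odd_unit_def by blast
qed

lemma odd_unit_power: "x \<in> odd_unit \<Longrightarrow> x ^ n \<in> odd_unit"
  by (induction n) (use odd_unit_of_int [of 1] in \<open>auto intro: odd_unit_mult\<close>)

lemma odd_unit_add_even:
  assumes "x \<in> odd_unit" and "y \<in> odd_den"
  shows "x + 2 * y \<in> odd_unit"
proof -
  obtain a b c d where *: "x = of_int a / of_int b" "odd a" "odd b" "y = of_int c / of_int d" "odd d"
    using assms by (auto simp: odd_den_def odd_unit_def)
  then have "b \<noteq> 0" "d \<noteq> 0" by auto
  with * have "x + 2 * y = of_int (a * d + 2 * c * b) / of_int (b * d)"
    by (simp add: add_frac_eq)
  moreover have "odd (a * d + 2 * c * b)" "odd (b * d)" using * by auto
  ultimately show ?thesis unfolding odd_unit_def by blast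
qed

lemma double_not_odd_unit: "x \<in> odd_den \<Longrightarrow> 2 * x \<notin> odd_unit"
proof
  assume x: "x \<in> odd_den" and "2 * x \<in> odd_unit"
  then have "2 * x + 2 * - x \<in> odd_unit"
    by (intro odd_unit_add_even odd_den_minus)
  then show False using odd_unit_nonzero by force
qed

lemma int_odd_part:
  assumes "(a::int) \<noteq> 0"
  obtains b k where "odd b" "a = b * 2 ^ k"
  using assms
proof (induction "nat \<bar>a\<bar>" arbitrary: a thesis rule: less_induct)
  case less
  show ?case
  proof (cases "odd a")
    case True
    then show ?thesis using less.prems(1) [of a 0] by simp
  next
    case False
    then obtain c where c: "a = 2 * c" by auto
    then have "nat \<bar>c\<bar> < nat \<bar>a\<bar>" "c \<noteq> 0" using less.prems(2) by auto
    then obtain b k where "odd b" "c = b * 2 ^ k" using less.hyps by metis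
    then show ?thesis using less.prems(1) [of b "Suc k"] c by simp
  qed
qed

lemma odd_den_unit_power:
  assumes "x \<in> odd_den" and "x \<noteq> 0"
  obtains u k where "u \<in> odd_unit" "x = u * 2 ^ k"
proof -
  obtain a b where ab: "x = of_int a / of_int b" "odd b"
    using assms by (auto simp: odd_den_def)
  then have "a \<noteq> 0" using assms by auto
  then obtain c k where "odd c" "a = c * 2 ^ k" by (rule int_odd_part)
  then have "of_int c / of_int b \<in> odd_unit" "x = of_int c / of_int b * 2 ^ k"
    using ab by (auto simp: odd_unit_def)
  then show ?thesis by (rule that)
qed

lemma not_odd_den_unit_power:
  assumes "x \<notin> odd_den"
  obtains u k where "u \<in> odd_unit" "k > 0" "x = u / 2 ^ k"
proof -
  obtain a b where ab: "x = of_int a / of_int b" "b > 0" "coprime a b"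
    using quotient_of_div quotient_of_denom_pos quotient_of_coprime by (metis prod.collapse)
  have "even b"
    using assms ab by (auto simp: odd_den_def)
  then have "odd a"
    using ab(3) by (meson coprime_common_divisor odd_one)
  obtain c k where c: "odd c" "b = c * 2 ^ k"
    using int_odd_part ab(2) by (metis less_irrefl)
  then have "k > 0" using \<open>even b\<close> by (metis gr0I mult.right_neutral power_0)
  moreover have "of_int a / of_int c \<in> odd_unit" "x = of_int a / of_int c / 2 ^ k"
    using ab c \<open>odd a\<close> by (auto simp: odd_unit_def)
  ultimately show ?thesis using that by blast
qed

lemma odd_unit_level_unique:
  assumes "u \<in> odd_unit" and "v \<in> odd_unit" and "u / 2 ^ k = v / 2 ^ l"
  shows "k = l"
proof -
  have False if "k < l" "u \<in> odd_unit" "v \<in> odd_unit" "u / 2 ^ k = v / 2 ^ l"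
    for k l :: nat and u v
  proof -
    obtain d where d: "l = k + Suc d" using \<open>k < l\<close> less_imp_Suc_add by auto
    then have "v = 2 * (u * 2 ^ d)" using that by (simp add: power_add field_simps)
    moreover have "u * 2 ^ d \<in> odd_den"
      by (intro odd_den_intros odd_unit_odd_den that)
    ultimately show False using double_not_odd_unit that by blast
  qed
  then show ?thesis using assms by (metis linorder_neqE_nat)
qed

text \<open>The leading terms dominate 2-adically: the numerator of the duplication formula is a
  unit over 2^(4k), the cubic a unit over 2^(3k), and the factor 4 in the denominator gives the 2 in
  \<open>k + 2\<close>. Writing 2^k = 2 q exhibits the lower terms as even.\<close>

lemma ec_double_level:
  fixes A B x y :: rat
  assumes AB: "A \<in> odd_den" "B \<in> odd_den" and c: "y ^ 2 = x ^ 3 + A * x + B"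
    and x: "x = u / 2 ^ k" "u \<in> odd_unit" "k > 0"
  shows "\<exists>v \<in> odd_unit. \<exists>y'. ec_add A (Affine x y) (Affine x y) = Affine (v / 2 ^ (k + 2)) y'"
proof -
  obtain j where k: "k = Suc j" using x by (cases k) auto
  define q :: rat where "q = 2 ^ j"
  have q: "q \<in> odd_den" "q \<noteq> 0" "2 ^ k = 2 * q"
    by (auto simp: q_def k intro: odd_den_intros)
  define D where "D = u ^ 3 + 2 * (2 * A * u * q ^ 2 + 4 * B * q ^ 3)"
  define N where "N = u ^ 4 + 2 * (8 * A ^ 2 * q ^ 4 - 4 * A * u ^ 2 * q ^ 2 - 32 * B * u * q ^ 3)"
  have D: "D \<in> odd_unit" and N: "N \<in> odd_unit"
    unfolding D_def N_def
    by (intro odd_unit_add_even odd_unit_power odd_den_intros AB q x odd_unit_odd_den [OF x(2)])+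
  have xq: "x = u / (2 * q)" using x q by simp
  have D': "x ^ 3 + A * x + B = D / (2 * q) ^ 3"
    using q unfolding D_def xq by (simp add: field_simps power2_eq_square power3_eq_cube)
  have N': "x ^ 4 - 2 * A * x ^ 2 - 8 * B * x + A ^ 2 = N / (2 * q) ^ 4"
    using q unfolding N_def xq by (simp add: field_simps power2_eq_square power3_eq_cube power4_eq_xxxx)
  have "y \<noteq> 0"
    using c D' odd_unit_nonzero [OF D] q by auto
  then obtain y' where "ec_add A (Affine x y) (Affine x y)
      = Affine (N / (2 * q) ^ 4 / (4 * (D / (2 * q) ^ 3))) y'"
    using ec_double_x [OF c] unfolding D' N' by auto
  also have "N / (2 * q) ^ 4 / (4 * (D / (2 * q) ^ 3)) = N / D / 2 ^ (k + 2)"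
    using q odd_unit_nonzero [OF D]
    by (simp add: power_add q field_simps power2_eq_square power3_eq_cube power4_eq_xxxx)
  finally show ?thesis
    using odd_unit_divide [OF N D] by blast
qed

lemma not_torsion_if_even_den:
  fixes A B x y :: rat
  assumes ns: "ec_nonsingular A B" and AB: "A \<in> odd_den" "B \<in> odd_den"
    and P: "Affine x y \<in> ec_points A B" and x: "x = u / 2 ^ k" "u \<in> odd_unit" "k > 0"
  shows "\<not> torsion (ec_group A B) (Affine x y)"
proof
  interpret comm_group "ec_group A B" by (rule comm_group_ec_group [OF ns])
  assume tors: "torsion (ec_group A B) (Affine x y)"
  let ?P = "\<lambda>n. Affine x y [^]\<^bsub>ec_group A B\<^esub> ((2::nat) ^ n)"
  have car: "?P n \<in> ec_points A B" for n
    using nat_pow_closed [of "Affine x y"] P by simp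
  have lev: "\<exists>v \<in> odd_unit. \<exists>y'. ?P n = Affine (v / 2 ^ (k + 2 * n)) y'" for n
  proof (induction n)
    case 0
    then show ?case using x P by auto
  next
    case (Suc n)
    then obtain v y' where v: "v \<in> odd_unit" "?P n = Affine (v / 2 ^ (k + 2 * n)) y'"
      by auto
    have "?P (Suc n) = ec_add A (?P n) (?P n)"
      using nat_pow_mult [of "Affine x y" "2 ^ n" "2 ^ n"] P by (simp add: mult_2)
    moreover have "\<exists>w \<in> odd_unit. \<exists>y''. ec_add A (?P n) (?P n) = Affine (w / 2 ^ (k + 2 * n + 2)) y''"
      unfolding v(2) using car [of n] v x by (intro ec_double_level [OF AB]) auto
    ultimately show ?case by simp
  qed
  have "inj ?P"
  proof (rule injI)
    fix m n assume eq: "?P m = ?P n"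
    obtain v y' where v: "v \<in> odd_unit" "?P m = Affine (v / 2 ^ (k + 2 * m)) y'"
      using lev by blast
    obtain w y'' where w: "w \<in> odd_unit" "?P n = Affine (w / 2 ^ (k + 2 * n)) y''"
      using lev by blast
    have "k + 2 * m = k + 2 * n"
      by (rule odd_unit_level_unique [OF v(1) w(1)]) (use eq v(2) w(2) in simp)
    then show "m = n" by simp
  qed
  moreover have "finite (range ?P)"
    by (rule finite_subset [OF _ finite_powers_if_torsion [OF _ tors]]) (use P in auto)
  ultimately show False
    using finite_imageD infinite_UNIV_nat by blast
qed

text \<open>As \<open>A\<close> is even, the numerator of the duplication formula is a unit, while
  the denominator 4 y^2 is divisible by 4; hence the abscissa of the double has a 2-adic
  pole.\<close>

lemma not_torsion_if_odd_x:
  fixes A B x y :: rat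
  assumes ns: "ec_nonsingular A B" and A: "A = 2 * A'" "A' \<in> odd_den" and B: "B \<in> odd_den"
    and P: "Affine x y \<in> ec_points A B" and x: "x \<in> odd_unit" and y: "y \<noteq> 0"
  shows "\<not> torsion (ec_group A B) (Affine x y)"
proof
  interpret comm_group "ec_group A B" by (rule comm_group_ec_group [OF ns])
  assume tors: "torsion (ec_group A B) (Affine x y)"
  have c: "y ^ 2 = x ^ 3 + A * x + B" using P by simp
  have A': "A \<in> odd_den" using A by (auto intro: odd_den_intros)
  have "y ^ 2 \<in> odd_den"
    unfolding c by (intro odd_den_intros A' B odd_unit_odd_den [OF x])
  then obtain w j where w: "w \<in> odd_unit" "y ^ 2 = w * 2 ^ j"
    using odd_den_unit_power y by (metis power_not_zero)
  define N where "N = x ^ 4 + 2 * (2 * A' ^ 2 - 2 * A' * x ^ 2 - 4 * B * x)"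
  have N: "N \<in> odd_unit"
    unfolding N_def
    by (intro odd_unit_add_even odd_unit_power odd_den_intros A B x odd_unit_odd_den [OF x])
  have "x ^ 4 - 2 * A * x ^ 2 - 8 * B * x + A ^ 2 = N"
    unfolding N_def A by algebra
  then obtain y' where "ec_add A (Affine x y) (Affine x y) = Affine (N / (4 * (w * 2 ^ j))) y'"
    using ec_double_x [OF c y] unfolding c [symmetric] w by auto
  moreover have "N / (4 * (w * 2 ^ j)) = N / w / 2 ^ (j + 2)"
    by (simp add: power_add mult_ac)
  ultimately have d: "Affine x y [^]\<^bsub>ec_group A B\<^esub> (2::nat) = Affine (N / w / 2 ^ (j + 2)) y'"
    using P by (simp add: numeral_2_eq_2)
  have "\<not> torsion (ec_group A B) (Affine (N / w / 2 ^ (j + 2)) y')"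
    using nat_pow_closed [of "Affine x y" 2] P N w
    by (intro not_torsion_if_even_den [OF ns A' B _ refl]) (auto simp: d intro: odd_unit_divide)
  then show False
    using torsion_pow [of "Affine x y" 2] tors P d by simp
qed

text \<open>Allows the 2-adic criteria to be applied to a multiple of \<open>P\<close> on a model
  rescaled so as to have 2-integral coefficients.\<close>

lemma not_torsion_if_scaled_multiple:
  fixes A B :: rat
  assumes ns: "ec_nonsingular A B" and P: "P \<in> ec_points A B" and s: "s \<noteq> 0"
    and n: "P [^]\<^bsub>ec_group A B\<^esub> (n::nat) = Affine x y"
    and nt: "Affine (s ^ 2 * x) (s ^ 3 * y) \<in> ec_points (A * s ^ 4) (B * s ^ 6) \<Longrightarrow>
      \<not> torsion (ec_group (A * s ^ 4) (B * s ^ 6)) (Affine (s ^ 2 * x) (s ^ 3 * y))"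
  shows "\<not> torsion (ec_group A B) P"
proof
  interpret comm_group "ec_group A B" by (rule comm_group_ec_group [OF ns])
  assume "torsion (ec_group A B) P"
  then have "torsion (ec_group A B) (Affine x y)"
    using torsion_pow [of P n] P n by simp
  moreover have car: "Affine x y \<in> ec_points A B"
    using nat_pow_closed [of P n] P n by simp
  ultimately have "torsion (ec_group (A * s ^ 4) (B * s ^ 6)) (ec_scale s (Affine x y))"
    using torsion_ec_scale_iff [OF ns s car] by simp
  moreover have "ec_scale s (Affine x y) \<in> ec_points (A * s ^ 4) (B * s ^ 6)"
    using ec_scale_in_ec_points [OF s] car by blast
  ultimately show False using nt by simp
qed

lemma line_rel_chord:
  fixes A :: "'a::field_char_0"
  assumes "y1 ^ 2 = x1 ^ 3 + A * x1 + B" and "y2 ^ 2 = x2 ^ 3 + A * x2 + B"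
    and "x1 \<noteq> x2" and m: "y2 - y1 = m * (x2 - x1)"
  shows "line_rel A m x1 y1 x2 y2"
proof -
  have "(y1 + y2) * (y2 - y1) = (x1 ^ 2 + x1 * x2 + x2 ^ 2 + A) * (x2 - x1)"
    using assms(1,2) by algebra
  then have "(x2 - x1) * ((y1 + y2) * m - (x1 ^ 2 + x1 * x2 + x2 ^ 2 + A)) = 0"
    unfolding m by (simp add: algebra_simps)
  with m \<open>x1 \<noteq> x2\<close> show ?thesis by (simp add: line_rel_def)
qed

lemma not_torsion_family:
  fixes t :: rat
  defines "A \<equiv> - 3 * t ^ 2" and "B \<equiv> t ^ 3 * (t - 2)"
  assumes t: "t \<noteq> 0" "t \<noteq> 4" "t \<noteq> 27 / 8" "t \<noteq> 27 / 4"
  shows "\<not> torsion (ec_group A B) (Affine (- t) (t ^ 2))"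
proof -
  let ?P = "Affine (- t) (t ^ 2)" and ?G = "ec_group A B"
  have "4 * A ^ 3 + 27 * B ^ 2 = 27 * t ^ 7 * (t - 4)"
    unfolding A_def B_def by algebra
  then have ns: "ec_nonsingular A B"
    using t by (simp add: ec_nonsingular_def)
  interpret comm_group ?G by (rule comm_group_ec_group [OF ns])
  have P: "?P \<in> ec_points A B"
    unfolding Affine_in_ec_points A_def B_def by algebra
  have "line_rel A 0 (- t) (t ^ 2) (- t) (t ^ 2)"
    unfolding line_rel_def A_def by algebra
  from ec_add_line [OF this]
  have "ec_add A ?P ?P = Affine (2 * t) (- (t ^ 2))"
    using t by simp
  then have P2: "?P [^]\<^bsub>?G\<^esub> (2::nat) = Affine (2 * t) (- (t ^ 2))"
    using P by (simp add: numeral_2_eq_2)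
  have "line_rel A (- 2 * t / 3) (2 * t) (- (t ^ 2)) (- t) (t ^ 2)"
    unfolding line_rel_def A_def by (simp add: power2_eq_square)
  from ec_add_line [OF this]
  have "ec_add A (Affine (2 * t) (- (t ^ 2))) ?P = Affine (4 * t ^ 2 / 9 - t) (8 * t ^ 3 / 27 - t ^ 2)"
    using t by (simp add: power2_eq_square power3_eq_cube algebra_simps)
  moreover have "?P [^]\<^bsub>?G\<^esub> (3::nat) = ec_add A (?P [^]\<^bsub>?G\<^esub> (2::nat)) ?P"
    using nat_pow_Suc [of ?P 2] by (simp add: numeral_3_eq_3 numeral_2_eq_2)
  ultimately have P3: "?P [^]\<^bsub>?G\<^esub> (3::nat) = Affine (4 * t ^ 2 / 9 - t) (8 * t ^ 3 / 27 - t ^ 2)"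
    using P2 by simp
  have "line_rel A (- 9 / 2) (2 * t) (- (t ^ 2)) (2 * t) (- (t ^ 2))"
    unfolding line_rel_def A_def by (simp add: power2_eq_square)
  from ec_add_line [OF this]
  have "ec_add A (Affine (2 * t) (- (t ^ 2))) (Affine (2 * t) (- (t ^ 2)))
    = Affine (81 / 4 - 4 * t) (t ^ 2 - 27 * t + 729 / 8)"
    using t by (simp add: power2_eq_square algebra_simps)
  moreover have "?P [^]\<^bsub>?G\<^esub> (4::nat) = ec_add A (?P [^]\<^bsub>?G\<^esub> (2::nat)) (?P [^]\<^bsub>?G\<^esub> (2::nat))"
    using nat_pow_mult [of ?P 2 2] P by simp
  ultimately have P4: "?P [^]\<^bsub>?G\<^esub> (4::nat) = Affine (81 / 4 - 4 * t) (t ^ 2 - 27 * t + 729 / 8)"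
    using P2 by simp
  \<comment> \<open>Slope of the chord through 2P and 3P; its pole t = 27/4 is where the two points
    have the same abscissa.\<close>
  define m where "m = 8 * t ^ 2 / (3 * (4 * t - 27))"
  define X where "X = m ^ 2 - 2 * t - (4 * t ^ 2 / 9 - t)"
  define Y where "Y = m * (2 * t - X) - (- (t ^ 2))"
  have t27: "4 * t - 27 \<noteq> 0"
    using t by simp
  have x23: "2 * t \<noteq> 4 * t ^ 2 / 9 - t"
  proof
    assume "2 * t = 4 * t ^ 2 / 9 - t"
    then have "t * (4 * t - 27) = 0"
      by (simp add: power2_eq_square algebra_simps)
    then show False using t t27 by simp
  qed
  have "8 * t ^ 3 / 27 - t ^ 2 - - (t ^ 2) = m * (4 * t ^ 2 / 9 - t - 2 * t)"
    unfolding m_def using t27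
    by (simp add: divide_simps) (simp add: algebra_simps power2_eq_square power3_eq_cube)
  then have m: "line_rel A m (2 * t) (- (t ^ 2)) (4 * t ^ 2 / 9 - t) (8 * t ^ 3 / 27 - t ^ 2)"
    using nat_pow_closed [of ?P 2] nat_pow_closed [of ?P 3] P P2 P3 x23
    by (intro line_rel_chord [of _ _ _ B]) auto
  have "ec_add A (Affine (2 * t) (- (t ^ 2))) (Affine (4 * t ^ 2 / 9 - t) (8 * t ^ 3 / 27 - t ^ 2))
    = Affine X Y"
    unfolding X_def Y_def by (rule ec_add_line [OF m]) (use x23 in blast)
  moreover have "?P [^]\<^bsub>?G\<^esub> (5::nat) = ec_add A (?P [^]\<^bsub>?G\<^esub> (2::nat)) (?P [^]\<^bsub>?G\<^esub> (3::nat))"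
    using nat_pow_mult [of ?P 2 3] P by simp
  ultimately have P5: "?P [^]\<^bsub>?G\<^esub> (5::nat) = Affine X Y"
    using P2 P3 by simp
  note nt = not_torsion_if_scaled_multiple [OF ns P]
  consider (int) "t \<in> odd_den" | (pole) w k where "w \<in> odd_unit" "k > 0" "t = w / 2 ^ k"
    using not_odd_den_unit_power by metis
  then show ?thesis
  proof cases
    case int
    \<comment> \<open>For 2-integral \<open>t\<close> the abscissa (81 - 16 t) / 4 of 4P is already
      a unit over 4.\<close>
    have u: "81 + 2 * (- 8 * t) \<in> odd_unit"
      using odd_unit_of_int [of 81]
      by (intro odd_unit_add_even odd_den_intros int) (simp_all add: odd_den_minus)
    have x: "1 ^ 2 * (81 / 4 - 4 * t) = (81 + 2 * (- 8 * t)) / 2 ^ 2"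
      by simp
    have AB: "A * 1 ^ 4 \<in> odd_den" "B * 1 ^ 6 \<in> odd_den"
      unfolding A_def B_def using int by (auto intro!: odd_den_intros)
    show ?thesis
      by (intro nt [OF _ P4, of 1]
          not_torsion_if_even_den [OF ec_nonsingular_scale [OF ns] AB _ x u]) auto
  next
    case (pole w k)
    note w = odd_unit_odd_den [OF pole(1)]
    have "k = 1 \<or> k = 2 \<or> k = (k - 3) + 3"
      using \<open>k > 0\<close> by arith
    then consider (1) "k = 1" | (2) "k = 2" | (3) j where "k = j + 3"
      by blast
    then show ?thesis
    proof cases
      case 1
      \<comment> \<open>Scaling by 2 turns the abscissa of 4P into the unit 81 - 8 w, so the pole
        appears at 8P.\<close>
      have tw: "t = w / 2" and wt: "w = 2 * t" using pole 1 by simp_all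
      have A': "A * 2 ^ 4 = 2 * (- 6 * w ^ 2)" "- 6 * w ^ 2 \<in> odd_den"
        by (simp add: A_def tw power2_eq_square) (intro odd_den_intros w)
      have Beq: "B * 2 ^ 6 = 4 * w ^ 3 * (w - 4)"
        unfolding B_def wt by algebra
      have B': "B * 2 ^ 6 \<in> odd_den"
        unfolding Beq by (intro odd_den_intros w)
      have "2 ^ 2 * (81 / 4 - 4 * t) = 81 + 2 * (- 4 * w)"
        unfolding tw by simp
      also have "\<dots> \<in> odd_unit"
        using odd_unit_of_int [of 81]
        by (intro odd_unit_add_even odd_den_intros w) (simp_all add: odd_den_minus)
      finally have x: "2 ^ 2 * (81 / 4 - 4 * t) \<in> odd_unit" .
      have "729 + 2 * (w ^ 2 - 54 * w) \<in> odd_unit"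
        using odd_unit_of_int [of 729]
        by (intro odd_unit_add_even odd_den_intros w) simp_all
      moreover have "729 + 2 * (w ^ 2 - 54 * w) = 8 * (t ^ 2 - 27 * t + 729 / 8)"
        unfolding tw by (simp add: power2_eq_square algebra_simps)
      ultimately have "t ^ 2 - 27 * t + 729 / 8 \<noteq> 0"
        using odd_unit_nonzero by fastforce
      then show ?thesis
        by (intro nt [OF _ P4, of 2] not_torsion_if_odd_x [OF ec_nonsingular_scale [OF ns] A' B' _ x]) auto
    next
      case 2
      have tw: "t = w / 4" and wt: "w = 4 * t" using pole 2 by simp_all
      have A': "A * 4 ^ 4 = 2 * (- 24 * w ^ 2)" "- 24 * w ^ 2 \<in> odd_den"
        by (simp add: A_def tw power2_eq_square) (intro odd_den_intros w)
      have A'': "A * 4 ^ 4 \<in> odd_den"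
        unfolding A'(1) by (intro odd_den_intros w)
      have Beq: "B * 4 ^ 6 = 16 * w ^ 3 * (w - 8)"
        unfolding B_def wt by algebra
      have B': "B * 4 ^ 6 \<in> odd_den"
        unfolding Beq by (intro odd_den_intros w)
      obtain a b where ab: "w = of_int a / of_int b" "odd a" "odd b"
        using pole by (auto simp: odd_unit_def)
      \<comment> \<open>The denominator 4 t - 27 of 5P is w - 27, a difference of two units and
        hence even. With its half e = v 2^j, the scaled abscissa of 5P has a pole of order 2 j if j
        > 0; if j = 0 it is a unit, and the pole appears at 10P.\<close>
      define e where "e = (w - 27) / 2"
      have "even (a - 27 * b)" using ab by simp
      then obtain c where "a - 27 * b = 2 * c" by (rule dvdE)
      then have "rat_of_int a - 27 * of_int b = 2 * of_int c"
        by (metis of_int_diff of_int_mult of_int_numeral)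
      moreover have "b \<noteq> 0" using ab by auto
      ultimately have "e = of_int c / of_int b"
        using ab by (auto simp: e_def field_simps)
      then have "e \<in> odd_den" using ab by (auto simp: odd_den_def)
      moreover have e0: "e \<noteq> 0" using t27 tw by (simp add: e_def)
      ultimately obtain v j where v: "v \<in> odd_unit" "e = v * 2 ^ j"
        by (rule odd_den_unit_power)
      have w27: "w - 27 = 2 * e" by (simp add: e_def)
      have m': "m = w ^ 2 / (12 * e)"
        unfolding m_def using w27 e0 by (simp add: tw field_simps power2_eq_square)
      have X': "4 ^ 2 * X = w ^ 4 / (9 * e ^ 2) - 4 * w ^ 2 / 9 - 4 * w"
        unfolding X_def m' tw using e0 by (simp add: field_simps power2_eq_square power4_eq_xxxx)
      have "w ^ 4 / (9 * v ^ 2) + 2 * ((- 2 * w ^ 2 / 9 - 2 * w) * (2 ^ j) ^ 2) \<in> odd_unit"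
      proof (intro odd_unit_add_even odd_unit_divide odd_unit_mult odd_unit_power pole v)
        have "1 / 9 \<in> odd_den"
          using odd_unit_divide [of 1 9] odd_unit_of_int [of 1] odd_unit_of_int [of 9]
          by (auto intro: odd_unit_odd_den)
        then have "(- 2 * (w ^ 2 * (1 / 9)) - 2 * w) * (2 ^ j) ^ 2 \<in> odd_den"
          by (intro odd_den_intros w) (auto simp: odd_den_minus)
        then show "(- 2 * w ^ 2 / 9 - 2 * w) * (2 ^ j) ^ 2 \<in> odd_den" by simp
      qed (use odd_unit_of_int [of 9] in simp)
      moreover have X'': "4 ^ 2 * X = (w ^ 4 / (9 * v ^ 2) + 2 * ((- 2 * w ^ 2 / 9 - 2 * w) * (2 ^ j) ^ 2)) / 2 ^ (2 * j)"
        unfolding X' v using odd_unit_nonzero [OF v(1)]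
        by (simp add: field_simps power_mult_distrib power_mult power2_eq_square)
      ultimately obtain z where z: "z \<in> odd_unit" "4 ^ 2 * X = z / 2 ^ (2 * j)"
        by blast
      show ?thesis
      proof (cases "j = 0")
        case True
        have "Y \<noteq> 0"
        proof
          assume "Y = 0"
          have "8 * t ^ 2 * (2 * t - X) / (3 * (4 * t - 27)) + t ^ 2 = 0"
            using \<open>Y = 0\<close> unfolding Y_def m_def by simp
          then have "t ^ 2 * (8 * (2 * t - X) + 3 * (4 * t - 27)) = 0"
            using t27 by (simp add: field_simps)
          then have "8 * (2 * t - X) + 3 * (4 * t - 27) = 0"
            by (metis mult_eq_0_iff power_not_zero t(1))
          then have "8 * X = 28 * t - 81"
            by simp
          then have "4 ^ 2 * X = 2 * (7 * w - 81)"
            unfolding tw by simp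
          moreover have "2 * (7 * w - 81) \<notin> odd_unit"
            using w by (intro double_not_odd_unit odd_den_intros)
          ultimately show False using z True by simp
        qed
        then show ?thesis
          using z True
          by (intro nt [OF _ P5, of 4] not_torsion_if_odd_x [OF ec_nonsingular_scale [OF ns] A' B']) auto
      next
        case False
        then show ?thesis
          by (intro nt [OF _ P5, of 4]
              not_torsion_if_even_den [OF ec_nonsingular_scale [OF ns] A'' B' _ z(2,1)]) auto
      qed
    next
      case (3 j)
      define q :: rat where "q = 2 ^ j"
      have q: "q \<in> odd_den" "q \<noteq> 0"
        by (auto simp: q_def intro: odd_den_intros)
      have tw: "t = w / (8 * q)" using pole 3 by (simp add: power_add q_def)
      have wt: "w = 8 * q * t" using q by (simp add: tw)
      have A': "A * (4 * q) ^ 4 = 2 * (- 6 * w ^ 2 * q ^ 2)" "- 6 * w ^ 2 * q ^ 2 \<in> odd_den"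
        subgoal unfolding A_def wt by algebra
        subgoal by (intro odd_den_intros w q)
        done
      have Beq: "B * (4 * q) ^ 6 = w ^ 3 * (w * q ^ 2 - 16 * q ^ 3)"
        unfolding B_def wt by algebra
      have B': "B * (4 * q) ^ 6 \<in> odd_den"
        unfolding Beq by (intro odd_den_intros w q)
      \<comment> \<open>For a pole of \<open>t\<close> of order at least 3, the quadratic term
        dominates the abscissa of 3P, and the scaling 4 q makes it a unit. The ordinate of 3P
        vanishes only for t = 27/8.\<close>
      have "(4 * q) ^ 2 * (4 * t ^ 2 / 9 - t) = w ^ 2 / 9 + 2 * (- w * q)"
        unfolding tw using q by (simp add: power2_eq_square field_simps)
      also have "\<dots> \<in> odd_unit"
        using odd_unit_of_int [of 9] pole q w
        by (intro odd_unit_add_even odd_unit_divide odd_unit_power odd_den_intros) auto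
      finally have x: "(4 * q) ^ 2 * (4 * t ^ 2 / 9 - t) \<in> odd_unit" .
      have "8 * t ^ 3 / 27 - t ^ 2 = t ^ 2 * (8 * t - 27) / 27"
        by (simp add: power2_eq_square power3_eq_cube algebra_simps)
      also have "\<dots> \<noteq> 0" using t by simp
      finally show ?thesis
        using q by (intro nt [OF _ P3, of "4 * q"]
            not_torsion_if_odd_x [OF ec_nonsingular_scale [OF ns] A' B' _ x]) auto
    qed
  qed
qed

section \<open>Heights\<close>

lemma E3_eq_scaled:
  assumes "a * b * c \<noteq> 0" and t: "t = b ^ 2 / (a * c)" and u: "u = a * c ^ 2 / b"
  shows "E3 a b c = ec_group (- 3 * t ^ 2 * u ^ 4) (t ^ 3 * (t - 2) * u ^ 6)"
proof -
  have nz: "a \<noteq> 0" "b \<noteq> 0" "c \<noteq> 0" using assms(1) by auto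
  have "E3_A a b c = - 3 * t ^ 2 * u ^ 4"
    unfolding E3_A_def t u using nz by (simp add: field_simps eval_nat_numeral)
  moreover have "t - 2 = (b ^ 2 - 2 * a * c) / (a * c)"
    using nz t by (simp add: field_simps)
  then have "E3_B a b c = t ^ 3 * (t - 2) * u ^ 6"
    unfolding E3_B_def t u using nz by (simp add: field_simps eval_nat_numeral)
  ultimately show ?thesis by (simp add: E3_def)
qed

lemma E3_rank_pos:
  assumes abc: "a * b * c \<noteq> 0" and "4 * a * c - b ^ 2 \<noteq> 0"
    and k: "b ^ 2 \<noteq> 27 / 8 * a * c" "b ^ 2 \<noteq> 27 / 4 * a * c"
  shows "abelian_group_rank (E3 a b c) > 0"
proof -
  have nz: "a \<noteq> 0" "b \<noteq> 0" "c \<noteq> 0" using abc by auto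
  define t where "t = b ^ 2 / (a * c)"
  define u where "u = a * c ^ 2 / b"
  have u: "u \<noteq> 0" using nz by (simp add: u_def)
  have t: "t \<noteq> 0" "t \<noteq> 4" "t \<noteq> 27 / 8" "t \<noteq> 27 / 4"
    using nz assms by (auto simp: t_def field_simps)
  let ?A = "- 3 * t ^ 2" and ?B = "t ^ 3 * (t - 2)" and ?P = "Affine (- t) (t ^ 2)"
  have "4 * ?A ^ 3 + 27 * ?B ^ 2 = 27 * t ^ 7 * (t - 4)"
    by algebra
  then have ns: "ec_nonsingular ?A ?B"
    using t by (simp add: ec_nonsingular_def)
  have P: "?P \<in> ec_points ?A ?B"
    unfolding Affine_in_ec_points by algebra
  interpret comm_group "E3 a b c"
    unfolding E3_eq_scaled [OF abc t_def u_def]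
    by (intro comm_group_ec_group ec_nonsingular_scale ns u)
  show ?thesis
  proof (rule rank_pos_if_not_torsion)
    show "ec_scale u ?P \<in> carrier (E3 a b c)"
      using P ec_scale_in_ec_points [OF u, of ?P ?A ?B]
      unfolding E3_eq_scaled [OF abc t_def u_def] by simp
    show "\<not> torsion (E3 a b c) (ec_scale u ?P)"
      unfolding E3_eq_scaled [OF abc t_def u_def] torsion_ec_scale_iff [OF ns u P]
      by (rule not_torsion_family [OF t])
  qed
qed

lemma ec_rank_zero_scaled:
  assumes ns: "ec_nonsingular A B" and u: "u \<noteq> 0"
    and tors: "\<And>P. P \<in> ec_points A B \<Longrightarrow> torsion (ec_group A B) P"
  shows "abelian_group_rank (ec_group (A * u ^ 4) (B * u ^ 6)) = 0"
proof -
  interpret comm_group "ec_group (A * u ^ 4) (B * u ^ 6)"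
    by (intro comm_group_ec_group ec_nonsingular_scale ns u)
  show ?thesis
  proof (rule rank_zero_if_all_torsion)
    fix Q assume "Q \<in> carrier (ec_group (A * u ^ 4) (B * u ^ 6))"
    then obtain P where P: "P \<in> ec_points A B" "Q = ec_scale u P"
      using ec_scale_surj [OF u, of Q A B] by auto
    then show "torsion (ec_group (A * u ^ 4) (B * u ^ 6)) Q"
      using torsion_ec_scale_iff [OF ns u P(1)] tors by simp
  qed
qed

section \<open>Heights of rationals and of points\<close>

definition rat_height :: "rat \<Rightarrow> nat" where
  "rat_height x = nat (max \<bar>fst (quotient_of x)\<bar> (snd (quotient_of x)))"

lemma quotient_ofE:
  fixes x :: rat
  obtains p q where "x = of_int p / of_int q" "q > 0" "coprime p q"
    "int (rat_height x) = max \<bar>p\<bar> q"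
proof -
  obtain p q where pq: "quotient_of x = (p, q)" by (cases "quotient_of x")
  have "q > 0" using pq by (rule quotient_of_denom_pos)
  then show ?thesis
    using pq quotient_of_div [OF pq] quotient_of_coprime [OF pq]
    by (intro that) (auto simp: rat_height_def)
qed

lemma rat_height_divide_le:
  assumes "n \<noteq> 0"
  shows "int (rat_height (of_int m / of_int n)) \<le> max \<bar>m\<bar> \<bar>n\<bar>"
proof -
  obtain p q where pq: "(of_int m / of_int n :: rat) = of_int p / of_int q" "q > 0" "coprime p q"
    "int (rat_height (of_int m / of_int n)) = max \<bar>p\<bar> q"
    by (rule quotient_ofE)
  have "(of_int (m * q) :: rat) = of_int (p * n)"
    using pq(1,2) assms by (simp add: field_simps)
  then have eq: "m * q = p * n" by (simp only: of_int_eq_iff)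
  have "q dvd p * n" using eq by (metis dvd_triv_right)
  then have "q dvd n"
    using pq(3) by (simp add: coprime_commute coprime_dvd_mult_right_iff)
  then obtain d where d: "n = q * d" by (rule dvdE)
  then have "m = p * d" using eq pq(2) by simp
  moreover have "\<bar>d\<bar> \<ge> 1" using d assms by auto
  ultimately have "\<bar>p\<bar> \<le> \<bar>m\<bar>" "q \<le> \<bar>n\<bar>"
    using d pq(2) by (auto simp: abs_mult mult_le_cancel_left1)
  then show ?thesis unfolding pq(4) by (rule max.mono)
qed

lemma finite_rat_height_le: "finite {x. rat_height x \<le> M}"
proof (rule finite_subset)
  let ?I = "{- int M..int M}"
  show "finite ((\<lambda>(p, q). of_int p / of_int q :: rat) ` (?I \<times> ?I))" by simp
  show "{x. rat_height x \<le> M} \<subseteq> (\<lambda>(p, q). of_int p / of_int q) ` (?I \<times> ?I)"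
  proof safe
    fix x :: rat assume "rat_height x \<le> M"
    obtain p q where pq: "x = of_int p / of_int q" "q > 0" "int (rat_height x) = max \<bar>p\<bar> q"
      by (metis quotient_ofE)
    have "(p, q) \<in> ?I \<times> ?I"
      using pq \<open>rat_height x \<le> M\<close> by auto
    then show "x \<in> (\<lambda>(p, q). of_int p / of_int q) ` (?I \<times> ?I)"
      using pq(1) by force
  qed
qed

fun ec_height :: "rat ec_point \<Rightarrow> nat" where
  "ec_height Infinity = 0"
| "ec_height (Affine x y) = rat_height x"

lemma finite_ec_height_le: "finite {P \<in> ec_points A B. ec_height P \<le> M}"
proof (rule finite_subset)
  let ?S = "\<lambda>x. {y. y ^ 2 = x ^ 3 + A * x + B}"
  have fin: "finite {y::rat. y ^ 2 = d}" for d
  proof (cases "\<exists>y0. y0 ^ 2 = d")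
    case True
    then obtain y0 where "y0 ^ 2 = d" by auto
    then have "{y. y ^ 2 = d} \<subseteq> {y0, - y0}" by (auto simp: power2_eq_iff)
    then show ?thesis using finite_subset by blast
  qed auto
  show "finite (insert Infinity ((\<lambda>(x, y). Affine x y) ` (SIGMA x:{x. rat_height x \<le> M}. ?S x)))"
    using fin finite_rat_height_le by simp
  show "{P \<in> ec_points A B. ec_height P \<le> M} \<subseteq>
    insert Infinity ((\<lambda>(x, y). Affine x y) ` (SIGMA x:{x. rat_height x \<le> M}. ?S x))"
    by (auto simp: ec_points_def)
qed

text \<open>
  The resultant identities expressing \<open>q\<^sup>7\<close> and \<open>p\<^sup>7\<close> through the numerator and denominator of the
  duplication formula bound both the cancellation in that fraction and its size from below.
\<close>

lemma duplication_resultant: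
  fixes A B p q :: int
  defines "F \<equiv> p ^ 4 - 2 * A * p ^ 2 * q ^ 2 - 8 * B * p * q ^ 3 + A ^ 2 * q ^ 4"
    and "G \<equiv> 4 * p ^ 3 * q + 4 * A * p * q ^ 3 + 4 * B * q ^ 4"
    and "D \<equiv> 4 * (4 * A ^ 3 + 27 * B ^ 2)"
  shows "(12 * p ^ 2 * q + 16 * A * q ^ 3) * F
      - (3 * p ^ 3 - 5 * A * p * q ^ 2 - 27 * B * q ^ 3) * G = D * q ^ 7"
    and "(D * p ^ 3 - 4 * A ^ 2 * B * p ^ 2 * q + 4 * A * (3 * A ^ 3 + 22 * B ^ 2) * p * q ^ 2
        + 12 * B * (A ^ 3 + 8 * B ^ 2) * q ^ 3) * F
      + (A ^ 2 * B * p ^ 3 + A * (5 * A ^ 3 + 32 * B ^ 2) * p ^ 2 * q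
        + 2 * B * (13 * A ^ 3 + 96 * B ^ 2) * p * q ^ 2 - 3 * A ^ 2 * (A ^ 3 + 8 * B ^ 2) * q ^ 3) * G
      = D * p ^ 7"
  unfolding F_def G_def D_def by algebra+

lemma abs_cubic_form_le:
  fixes p q :: int
  assumes "\<bar>p\<bar> \<le> H" and "\<bar>q\<bar> \<le> H"
  shows "\<bar>a * p ^ 3 + b * p ^ 2 * q + c * p * q ^ 2 + d * q ^ 3\<bar> \<le> (\<bar>a\<bar> + \<bar>b\<bar> + \<bar>c\<bar> + \<bar>d\<bar>) * H ^ 3"
proof -
  have H: "H \<ge> 0" using assms by linarith
  have m: "\<bar>p ^ i * q ^ j\<bar> \<le> H ^ 3" if "i + j = 3" for i j
  proof -
    have "\<bar>p ^ i * q ^ j\<bar> \<le> H ^ i * H ^ j"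
      unfolding abs_mult power_abs using assms H by (intro mult_mono power_mono) auto
    then show ?thesis using that by (simp flip: power_add)
  qed
  have "\<bar>a * p ^ 3 + b * p ^ 2 * q + c * p * q ^ 2 + d * q ^ 3\<bar>
    \<le> \<bar>a\<bar> * \<bar>p ^ 3 * q ^ 0\<bar> + \<bar>b\<bar> * \<bar>p ^ 2 * q ^ 1\<bar> + \<bar>c\<bar> * \<bar>p ^ 1 * q ^ 2\<bar> + \<bar>d\<bar> * \<bar>p ^ 0 * q ^ 3\<bar>"
    unfolding abs_mult [symmetric] by (simp add: mult.assoc)
  also have "\<dots> \<le> \<bar>a\<bar> * H ^ 3 + \<bar>b\<bar> * H ^ 3 + \<bar>c\<bar> * H ^ 3 + \<bar>d\<bar> * H ^ 3"
    by (intro add_mono mult_left_mono m) auto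
  finally show ?thesis by (simp add: algebra_simps)
qed

text \<open>Multiplicative form of h(2P) >= 4 h(P) - O(1). Let x = p / q and H = max |p| q. The
  factor \<open>g\<close> cancelled in F / G divides D', since p and q are coprime, so |F| and |G|
  are at most |D'| h for the height \<open>h\<close> of the quotient. The cofactors in the resultant
  identities are O(H^3), whence |D'| H^7 <= C H^3 |D'| h.\<close>

lemma rat_height_duplication:
  fixes A B :: int
  assumes D: "4 * A ^ 3 + 27 * B ^ 2 \<noteq> 0"
  obtains C :: nat where "\<And>x::rat. x ^ 3 + of_int A * x + of_int B \<noteq> 0 \<Longrightarrow>
    rat_height x ^ 4 \<le> C * rat_height ((x ^ 4 - 2 * of_int A * x ^ 2 - 8 * of_int B * x + of_int A ^ 2)
      / (4 * (x ^ 3 + of_int A * x + of_int B)))"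
proof -
  define D' where "D' = 4 * (4 * A ^ 3 + 27 * B ^ 2)"
  define c1 where "c1 = 12 + 16 * \<bar>A\<bar>"
  define c2 where "c2 = 3 + 5 * \<bar>A\<bar> + 27 * \<bar>B\<bar>"
  define c3 where "c3 = \<bar>D'\<bar> + \<bar>4 * A ^ 2 * B\<bar> + \<bar>4 * A * (3 * A ^ 3 + 22 * B ^ 2)\<bar> + \<bar>12 * B * (A ^ 3 + 8 * B ^ 2)\<bar>"
  define c4 where "c4 = \<bar>A ^ 2 * B\<bar> + \<bar>A * (5 * A ^ 3 + 32 * B ^ 2)\<bar> + \<bar>2 * B * (13 * A ^ 3 + 96 * B ^ 2)\<bar> + \<bar>3 * A ^ 2 * (A ^ 3 + 8 * B ^ 2)\<bar>"
  define C where "C = c1 + c2 + c3 + c4"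
  have c: "c1 \<ge> 0" "c2 \<ge> 0" "c3 \<ge> 0" "c4 \<ge> 0"
    by (auto simp: c1_def c2_def c3_def c4_def)
  show ?thesis
  proof (rule that [of "nat C"])
    fix x :: rat assume nz: "x ^ 3 + of_int A * x + of_int B \<noteq> 0"
    obtain p q where pq: "x = of_int p / of_int q" "q > 0" "coprime p q" "int (rat_height x) = max \<bar>p\<bar> q"
      by (rule quotient_ofE)
    define H where "H = max \<bar>p\<bar> q"
    define F where "F = p ^ 4 - 2 * A * p ^ 2 * q ^ 2 - 8 * B * p * q ^ 3 + A ^ 2 * q ^ 4"
    define G where "G = 4 * p ^ 3 * q + 4 * A * p * q ^ 3 + 4 * B * q ^ 4"
    define X where "X = (x ^ 4 - 2 * of_int A * x ^ 2 - 8 * of_int B * x + of_int A ^ 2)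
      / (4 * (x ^ 3 + of_int A * x + of_int B))"
    have xF: "x ^ 4 - 2 * of_int A * x ^ 2 - 8 * of_int B * x + of_int A ^ 2 = of_int F / of_int q ^ 4"
      unfolding F_def pq(1) using pq(2) by (simp add: field_simps eval_nat_numeral)
    have xG: "4 * (x ^ 3 + of_int A * x + of_int B) = of_int G / of_int q ^ 4"
      unfolding G_def pq(1) using pq(2) by (simp add: field_simps eval_nat_numeral)
    have G0: "G \<noteq> 0" using nz xG by auto
    have X: "X = of_int F / of_int G"
      unfolding X_def xF xG using pq(2) by simp
    obtain r s where rs: "X = of_int r / of_int s" "s > 0" "coprime r s" "int (rat_height X) = max \<bar>r\<bar> s"
      by (rule quotient_ofE)
    define h where "h = max \<bar>r\<bar> s"
    have "(of_int (F * s) :: rat) = of_int (r * G)"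
      using X rs(1,2) G0 by (simp add: field_simps)
    then have FG: "F * s = r * G" by (simp only: of_int_eq_iff)
    have "s dvd r * G" using FG by (metis dvd_triv_right)
    then have "s dvd G"
      using rs(3) by (simp add: coprime_commute coprime_dvd_mult_right_iff)
    then obtain g where g: "G = s * g" by (rule dvdE)
    then have Fg: "F = r * g" using FG rs(2) by simp
    have g0: "g \<noteq> 0" using g G0 by auto
    note res = duplication_resultant [where A = A and B = B and p = p and q = q, folded F_def G_def D'_def]
    have gF: "g dvd F" and gG: "g dvd G"
      using g Fg by simp_all
    have "g dvd D' * q ^ 7"
      unfolding res(1) [symmetric] by (intro dvd_diff dvd_mult gF gG)
    moreover have "g dvd D' * p ^ 7"
      unfolding res(2) [symmetric] by (intro dvd_add dvd_mult gF gG)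
    ultimately have "g dvd \<bar>D'\<bar> * gcd (q ^ 7) (p ^ 7)"
      unfolding gcd_mult_distrib_int by (rule gcd_greatest)
    moreover have "coprime (q ^ 7) (p ^ 7)" using pq(3) by (simp add: coprime_commute)
    ultimately have "g dvd D'" by simp
    then have gD: "\<bar>g\<bar> \<le> \<bar>D'\<bar>" using D by (simp add: D'_def dvd_imp_le_int)
    have H: "\<bar>p\<bar> \<le> H" "\<bar>q\<bar> \<le> H" "H \<ge> 1"
      using pq(2) by (auto simp: H_def)
    have h: "\<bar>F\<bar> \<le> \<bar>g\<bar> * h" "\<bar>G\<bar> \<le> \<bar>g\<bar> * h" "h \<ge> 0"
      using rs(2) unfolding Fg g h_def abs_mult by (auto simp: mult.commute [of _ "\<bar>g\<bar>"] intro!: mult_left_mono)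
    have gh: "\<bar>g\<bar> * h \<le> \<bar>D'\<bar> * h" using gD h by (intro mult_right_mono)
    have b: "\<bar>u * F + v * G\<bar> \<le> (m + n) * H ^ 3 * (\<bar>D'\<bar> * h)"
      if "\<bar>u\<bar> \<le> m * H ^ 3" "\<bar>v\<bar> \<le> n * H ^ 3" "m \<ge> 0" "n \<ge> 0" for u v m n
    proof -
      have "\<bar>u * F + v * G\<bar> \<le> \<bar>u\<bar> * \<bar>F\<bar> + \<bar>v\<bar> * \<bar>G\<bar>"
        by (simp flip: abs_mult)
      also have "\<dots> \<le> m * H ^ 3 * (\<bar>D'\<bar> * h) + n * H ^ 3 * (\<bar>D'\<bar> * h)"
        using that h gh H by (intro add_mono mult_mono) auto
      finally show ?thesis by (simp add: algebra_simps)
    qed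
    have "\<bar>0 * p ^ 3 + 12 * p ^ 2 * q + 0 * p * q ^ 2 + 16 * A * q ^ 3\<bar> \<le> (\<bar>0\<bar> + \<bar>12\<bar> + \<bar>0\<bar> + \<bar>16 * A\<bar>) * H ^ 3"
      by (rule abs_cubic_form_le [OF H(1,2)])
    then have u1: "\<bar>12 * p ^ 2 * q + 16 * A * q ^ 3\<bar> \<le> c1 * H ^ 3"
      by (simp add: c1_def abs_mult)
    have "\<bar>- 3 * p ^ 3 + 0 * p ^ 2 * q + 5 * A * p * q ^ 2 + 27 * B * q ^ 3\<bar> \<le> (\<bar>- 3\<bar> + \<bar>0\<bar> + \<bar>5 * A\<bar> + \<bar>27 * B\<bar>) * H ^ 3"
      by (rule abs_cubic_form_le [OF H(1,2)])
    then have v1: "\<bar>- (3 * p ^ 3 - 5 * A * p * q ^ 2 - 27 * B * q ^ 3)\<bar> \<le> c2 * H ^ 3"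
      by (simp add: c2_def abs_mult)
    have q7: "\<bar>D'\<bar> * \<bar>q ^ 7\<bar> \<le> C * H ^ 3 * (\<bar>D'\<bar> * h)"
    proof -
      have "\<bar>D'\<bar> * \<bar>q ^ 7\<bar> \<le> (c1 + c2) * H ^ 3 * (\<bar>D'\<bar> * h)"
        using b [OF u1 v1 c(1,2)] unfolding abs_mult [symmetric] res(1) [symmetric]
        by (simp only: mult_minus_left add_uminus_conv_diff)
      also have "\<dots> \<le> C * H ^ 3 * (\<bar>D'\<bar> * h)"
        using c H h by (intro mult_right_mono) (auto simp: C_def)
      finally show ?thesis .
    qed
    have u2: "\<bar>D' * p ^ 3 - 4 * A ^ 2 * B * p ^ 2 * q + 4 * A * (3 * A ^ 3 + 22 * B ^ 2) * p * q ^ 2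
        + 12 * B * (A ^ 3 + 8 * B ^ 2) * q ^ 3\<bar> \<le> c3 * H ^ 3"
      using abs_cubic_form_le [OF H(1,2), of D' "- (4 * A ^ 2 * B)"
          "4 * A * (3 * A ^ 3 + 22 * B ^ 2)" "12 * B * (A ^ 3 + 8 * B ^ 2)"]
      unfolding c3_def abs_minus by simp
    have v2: "\<bar>A ^ 2 * B * p ^ 3 + A * (5 * A ^ 3 + 32 * B ^ 2) * p ^ 2 * q
        + 2 * B * (13 * A ^ 3 + 96 * B ^ 2) * p * q ^ 2 - 3 * A ^ 2 * (A ^ 3 + 8 * B ^ 2) * q ^ 3\<bar> \<le> c4 * H ^ 3"
      using abs_cubic_form_le [OF H(1,2), of "A ^ 2 * B" "A * (5 * A ^ 3 + 32 * B ^ 2)"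
          "2 * B * (13 * A ^ 3 + 96 * B ^ 2)" "- (3 * A ^ 2 * (A ^ 3 + 8 * B ^ 2))"]
      unfolding c4_def abs_minus by simp
    have p7: "\<bar>D'\<bar> * \<bar>p ^ 7\<bar> \<le> C * H ^ 3 * (\<bar>D'\<bar> * h)"
    proof -
      have "\<bar>D'\<bar> * \<bar>p ^ 7\<bar> \<le> (c3 + c4) * H ^ 3 * (\<bar>D'\<bar> * h)"
        using b [OF u2 v2 c(3,4)] unfolding abs_mult [symmetric] res(2) [symmetric] .
      also have "\<dots> \<le> C * H ^ 3 * (\<bar>D'\<bar> * h)"
        using c H h by (intro mult_right_mono) (auto simp: C_def)
      finally show ?thesis .
    qed
    have "H ^ 7 = \<bar>p ^ 7\<bar> \<or> H ^ 7 = \<bar>q ^ 7\<bar>"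
      using pq(2) by (auto simp: H_def max_def power_abs)
    then have "\<bar>D'\<bar> * H ^ 7 \<le> C * H ^ 3 * (\<bar>D'\<bar> * h)"
      using p7 q7 by auto
    also have "\<bar>D'\<bar> * H ^ 7 = (\<bar>D'\<bar> * H ^ 3) * H ^ 4"
      by (simp add: eval_nat_numeral)
    also have "C * H ^ 3 * (\<bar>D'\<bar> * h) = (\<bar>D'\<bar> * H ^ 3) * (C * h)"
      by simp
    finally have "H ^ 4 \<le> C * h"
      by (rule mult_left_le_imp_le) (use H D in \<open>simp add: D'_def\<close>)
    then have "int (rat_height x) ^ 4 \<le> C * int (rat_height X)"
      using pq(4) rs(4) by (simp add: H_def h_def)
    moreover have "C = int (nat C)" using c by (simp add: C_def)
    ultimately have "int (rat_height x ^ 4) \<le> int (nat C * rat_height X)"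
      by simp
    then show "rat_height x ^ 4 \<le> nat C * rat_height ((x ^ 4 - 2 * of_int A * x ^ 2 - 8 * of_int B * x + of_int A ^ 2)
      / (4 * (x ^ 3 + of_int A * x + of_int B)))"
      unfolding X_def by (simp only: of_nat_le_iff)
  qed
qed

text \<open>The factor \<open>c\<close> absorbs the translation by \<open>T\<close>. Since H(Q)^4 <=
  C c H(P), the height of Q cannot exceed both C c and H(P).\<close>

lemma ec_all_torsion_if_halving:
  fixes A B :: int
  defines "A' \<equiv> (of_int A :: rat)" and "B' \<equiv> (of_int B :: rat)"
  assumes ns: "ec_nonsingular A' B'"
    and half: "\<And>P. P \<in> ec_points A' B' \<Longrightarrow> P \<noteq> Infinity \<Longrightarrow>
      \<exists>Q \<in> ec_points A' B'. \<exists>T \<in> ec_points A' B'. ec_add A' T T = Infinity \<and>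
        P = ec_add A' (ec_add A' Q Q) T \<and> ec_height (ec_add A' Q Q) \<le> c * ec_height P"
    and P: "P \<in> ec_points A' B'"
  shows "torsion (ec_group A' B') P"
proof -
  interpret comm_group "ec_group A' B'" by (rule comm_group_ec_group [OF ns])
  have "of_int (4 * A ^ 3 + 27 * B ^ 2) \<noteq> (0::rat)"
    using ns by (simp add: ec_nonsingular_def A'_def B'_def)
  then have "4 * A ^ 3 + 27 * B ^ 2 \<noteq> 0"
    by (metis of_int_0)
  then obtain C where C: "\<And>x::rat. x ^ 3 + A' * x + B' \<noteq> 0 \<Longrightarrow> rat_height x ^ 4 \<le>
      C * rat_height ((x ^ 4 - 2 * A' * x ^ 2 - 8 * B' * x + A' ^ 2) / (4 * (x ^ 3 + A' * x + B')))"
    unfolding A'_def B'_def using rat_height_duplication by blast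
  have "\<exists>Q \<in> ec_points A' B'. \<exists>T \<in> ec_points A' B'. ec_add A' T T = Infinity \<and>
      P = ec_add A' (ec_add A' Q Q) T \<and> ec_height Q \<le> max (C * c) (ec_height P)"
    if P: "P \<in> ec_points A' B'" for P
  proof (cases "P = Infinity")
    case True
    then show ?thesis
      by (intro bexI [of _ Infinity]) auto
  next
    case False
    then obtain Q T where Q: "Q \<in> ec_points A' B'" and T: "T \<in> ec_points A' B'"
      and TT: "ec_add A' T T = Infinity" and PQ: "P = ec_add A' (ec_add A' Q Q) T"
      and h: "ec_height (ec_add A' Q Q) \<le> c * ec_height P"
      using half [OF P] by blast
    show ?thesis
    proof (cases "ec_add A' Q Q = Infinity")
      case True
      \<comment> \<open>The duplication bound says nothing about \<open>Q\<close> if 2Q is the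
        neutral element; \<open>Q\<close> is then replaced by the neutral element itself.\<close>
      then have "P = ec_add A' (ec_add A' Infinity Infinity) T"
        using PQ by simp
      then show ?thesis
        using T TT by (intro bexI [of _ Infinity] bexI [of _ T] conjI) auto
    next
      case False
      then obtain x y where xy: "Q = Affine x y"
        by (cases Q) auto
      have y: "y \<noteq> 0" using False xy by auto
      have cv: "y ^ 2 = x ^ 3 + A' * x + B'" using Q xy by simp
      have "x ^ 3 + A' * x + B' \<noteq> 0"
        unfolding cv [symmetric] using y by simp
      then have "ec_height Q ^ 4 \<le> C * ec_height (ec_add A' Q Q)"
        using C ec_double_x [OF cv y] xy by auto
      also have "\<dots> \<le> C * c * ec_height P"
        using h by (simp add: mult.assoc)
      finally have h4: "ec_height Q ^ 4 \<le> C * c * ec_height P" .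
      have "ec_height Q \<le> max (C * c) (ec_height P)"
      proof (rule ccontr)
        assume "\<not> ec_height Q \<le> max (C * c) (ec_height P)"
        then have *: "ec_height Q > C * c" "ec_height Q > ec_height P" by auto
        have "C * c * ec_height P < ec_height Q * ec_height Q"
          using * by (intro mult_strict_mono') auto
        also have "\<dots> = ec_height Q ^ 2"
          by (rule power2_eq_square [symmetric])
        also have "\<dots> \<le> ec_height Q ^ 4"
          using * by (intro power_increasing) auto
        finally show False using h4 by simp
      qed
      then show ?thesis
        using Q T TT PQ by blast
    qed
  qed
  then show ?thesis
    using P by (intro torsion_if_halving [where h = ec_height and K = "C * c"]) (auto simp: finite_ec_height_le)
qed

section \<open>Hermite's bound for ternary quadratic forms\<close>

text \<open>With the factors 2 on the mixed terms, the Gram matrix has the rows (a, f, e), (f, b,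
  d), (e, d, c), and \<open>ternary_det\<close> is its determinant.\<close>

definition ternary :: "real \<Rightarrow> real \<Rightarrow> real \<Rightarrow> real \<Rightarrow> real \<Rightarrow> real \<Rightarrow> int \<Rightarrow> int \<Rightarrow> int \<Rightarrow> real" where
  "ternary a b c d e f x y z = a * of_int x ^ 2 + b * of_int y ^ 2 + c * of_int z ^ 2
    + 2 * d * of_int y * of_int z + 2 * e * of_int x * of_int z + 2 * f * of_int x * of_int y"

definition ternary_det :: "real \<Rightarrow> real \<Rightarrow> real \<Rightarrow> real \<Rightarrow> real \<Rightarrow> real \<Rightarrow> real" where
  "ternary_det a b c d e f = a * b * c + 2 * d * e * f - a * d ^ 2 - b * e ^ 2 - c * f ^ 2"

lemma finite_int_affine_square_le:
  fixes p t K :: real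
  assumes "p \<noteq> 0"
  shows "finite {y::int. (p * of_int y + t) ^ 2 \<le> K}"
proof (rule finite_subset)
  define N where "N = \<lceil>(sqrt \<bar>K\<bar> + \<bar>t\<bar>) / \<bar>p\<bar>\<rceil>"
  show "finite {- N..N}" by simp
  show "{y::int. (p * of_int y + t) ^ 2 \<le> K} \<subseteq> {- N..N}"
  proof
    fix y :: int assume "y \<in> {y. (p * of_int y + t) ^ 2 \<le> K}"
    then have "(p * of_int y + t) ^ 2 \<le> \<bar>K\<bar>" by auto
    then have "\<bar>p * of_int y + t\<bar> \<le> sqrt \<bar>K\<bar>"
      by (metis real_sqrt_abs real_sqrt_le_iff)
    then have "\<bar>p * of_int y\<bar> \<le> sqrt \<bar>K\<bar> + \<bar>t\<bar>" by linarith
    then have "\<bar>of_int y\<bar> \<le> (sqrt \<bar>K\<bar> + \<bar>t\<bar>) / \<bar>p\<bar>"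
      using assms by (simp add: abs_mult field_simps)
    then have "of_int \<bar>y\<bar> \<le> (of_int N :: real)"
      unfolding N_def using le_of_int_ceiling order_trans by fastforce
    then show "y \<in> {- N..N}" by (simp add: abs_le_iff)
  qed
qed

text \<open>The hypotheses are Sylvester's criterion for positive definiteness. Completing the
  square twice (\<open>key\<close>) bounds z, then y for each z, then x for each y and z.\<close>

lemma finite_ternary_le:
  assumes a: "a > 0" and p: "a * b - f ^ 2 > 0" and D: "ternary_det a b c d e f > 0"
  shows "finite {(x, y, z). ternary a b c d e f x y z \<le> M}"
proof -
  define P where "P = a * b - f ^ 2"
  define q where "q = a * d - e * f"
  define E where "E = a * ternary_det a b c d e f"
  define N where "N = a * P * M"
  have pos: "P > 0" "E > 0" using assms by (auto simp: P_def E_def)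
  have key: "a * P * ternary a b c d e f x y z
    = P * (a * of_int x + (f * of_int y + e * of_int z)) ^ 2
      + (P * of_int y + q * of_int z) ^ 2 + E * of_int z ^ 2" for x y z
    unfolding P_def q_def E_def ternary_def ternary_det_def by algebra
  let ?Z = "{z::int. (1 * of_int z + 0) ^ 2 \<le> N / E}"
  let ?Y = "\<lambda>z. {y::int. (P * of_int y + q * of_int z) ^ 2 \<le> N}"
  let ?X = "\<lambda>y z. {x::int. (a * of_int x + (f * of_int y + e * of_int z)) ^ 2 \<le> N / P}"
  have "finite ((\<lambda>(z, y, x). (x, y, z)) ` (SIGMA z:?Z. SIGMA y:?Y z. ?X y z))"
    by (intro finite_imageI finite_SigmaI finite_int_affine_square_le) (use a pos in auto)
  moreover have "{(x, y, z). ternary a b c d e f x y z \<le> M}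
      \<subseteq> (\<lambda>(z, y, x). (x, y, z)) ` (SIGMA z:?Z. SIGMA y:?Y z. ?X y z)"
  proof safe
    fix x y z assume "ternary a b c d e f x y z \<le> M"
    then have "a * P * ternary a b c d e f x y z \<le> N"
      unfolding N_def using a pos by simp
    then have le: "P * (a * of_int x + (f * of_int y + e * of_int z)) ^ 2
      + (P * of_int y + q * of_int z) ^ 2 + E * of_int z ^ 2 \<le> N"
      by (simp add: key)
    have nn: "P * (a * of_int x + (f * of_int y + e * of_int z)) ^ 2 \<ge> 0"
      "(P * of_int y + q * of_int z) ^ 2 \<ge> 0" "E * (of_int z) ^ 2 \<ge> (0::real)"
      using pos by auto
    have "E * of_int z ^ 2 \<le> N" "(P * of_int y + q * of_int z) ^ 2 \<le> N"
      "P * (a * of_int x + (f * of_int y + e * of_int z)) ^ 2 \<le> N"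
      using le nn by linarith+
    then have "z \<in> ?Z" "y \<in> ?Y z" "x \<in> ?X y z"
      using pos by (auto simp: field_simps)
    then show "(x, y, z) \<in> (\<lambda>(z, y, x). (x, y, z)) ` (SIGMA z:?Z. SIGMA y:?Y z. ?X y z)"
      by force
  qed
  ultimately show ?thesis by (rule rev_finite_subset)
qed

lemma ex_min_if_finite_below:
  fixes S :: "real set"
  assumes "S \<noteq> {}" and fin: "\<And>M. finite {s \<in> S. s \<le> M}"
  obtains m where "m \<in> S" "\<And>s. s \<in> S \<Longrightarrow> m \<le> s"
proof -
  obtain s0 where "s0 \<in> S" using assms by auto
  let ?T = "{s \<in> S. s \<le> s0}"
  have "Min ?T \<in> ?T" using fin \<open>s0 \<in> S\<close> by (intro Min_in) auto
  moreover have "Min ?T \<le> s" if "s \<in> S" for s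
    using fin [of s0] that \<open>Min ?T \<in> ?T\<close> by (cases "s \<le> s0") auto
  ultimately show ?thesis using that by blast
qed

lemma ex_int_shift:
  fixes p q :: real
  assumes "p > 0"
  obtains k :: int where "\<bar>q + of_int k * p\<bar> \<le> p / 2"
proof -
  define k where "k = - \<lfloor>q / p + 1 / 2\<rfloor>"
  have "- of_int k \<le> q / p + 1 / 2" "q / p + 1 / 2 < - of_int k + 1"
    unfolding k_def of_int_minus minus_minus by linarith+
  then have "- (1 / 2) \<le> q / p + of_int k" "q / p + of_int k \<le> 1 / 2"
    by linarith+
  then have "- (1 / 2) * p \<le> (q / p + of_int k) * p" "(q / p + of_int k) * p \<le> 1 / 2 * p"
    using assms by (intro mult_right_mono; simp)+
  moreover have "(q / p + of_int k) * p = q + of_int k * p"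
    using assms by (simp add: algebra_simps)
  ultimately have "\<bar>q + of_int k * p\<bar> \<le> p / 2"
    by linarith
  then show ?thesis by (rule that)
qed

text \<open>
  The coefficients of the forms that represent, at nonzero vectors, only values which the given
  form takes at nonzero vectors, and that have the same determinant. Working with this set
  instead of unimodular matrices makes it closed under the elementary operations by inspection.
\<close>

definition reachable ::
  "real \<times> real \<times> real \<times> real \<times> real \<times> real \<Rightarrow> (real \<times> real \<times> real \<times> real \<times> real \<times> real) set" where
  "reachable F0 = {(a, b, c, d, e, f). a > 0 \<and> a * b - f ^ 2 > 0 \<and>
    (case F0 of (a0, b0, c0, d0, e0, f0) \<Rightarrow> ternary_det a b c d e f = ternary_det a0 b0 c0 d0 e0 f0 \<and>
    (\<forall>x y z. (x, y, z) \<noteq> (0, 0, 0) \<longrightarrow> (\<exists>x' y' z'. (x', y', z') \<noteq> (0, 0, 0) \<and>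
      ternary a b c d e f x y z = ternary a0 b0 c0 d0 e0 f0 x' y' z')))}"

lemma reachable_step:
  assumes r: "(a, b, c, d, e, f) \<in> reachable F0"
    and "a' > 0" and "a' * b' - f' ^ 2 > 0"
    and "ternary_det a' b' c' d' e' f' = ternary_det a b c d e f"
    and v: "\<And>x y z. (x, y, z) \<noteq> (0, 0, 0) \<Longrightarrow> \<exists>x' y' z'. (x', y', z') \<noteq> (0, 0, 0) \<and>
      ternary a' b' c' d' e' f' x y z = ternary a b c d e f x' y' z'"
  shows "(a', b', c', d', e', f') \<in> reachable F0"
proof -
  obtain a0 b0 c0 d0 e0 f0 where F0: "F0 = (a0, b0, c0, d0, e0, f0)"
    by (metis prod.collapse)
  have "ternary_det a b c d e f = ternary_det a0 b0 c0 d0 e0 f0"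
    and w: "\<And>x y z. (x, y, z) \<noteq> (0, 0, 0) \<Longrightarrow> \<exists>x' y' z'. (x', y', z') \<noteq> (0, 0, 0) \<and>
      ternary a b c d e f x y z = ternary a0 b0 c0 d0 e0 f0 x' y' z'"
    using r unfolding reachable_def F0 mem_Collect_eq prod.case by blast+
  moreover have "\<exists>x' y' z'. (x', y', z') \<noteq> (0, 0, 0) \<and>
      ternary a' b' c' d' e' f' x y z = ternary a0 b0 c0 d0 e0 f0 x' y' z'"
    if "(x, y, z) \<noteq> (0, 0, 0)" for x y z
    using v [OF that] w by metis
  ultimately show ?thesis
    using assms(2-4) unfolding reachable_def F0 mem_Collect_eq prod.case by simp
qed

lemma reachable_shift12:
  assumes "(a, b, c, d, e, f) \<in> reachable F0"
  shows "(a, b + 2 * of_int k * f + of_int k ^ 2 * a, c, d + of_int k * e, e, f + of_int k * a) \<in> reachable F0"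
proof (rule reachable_step [OF assms])
  show "a > 0" using assms by (auto simp: reachable_def)
  have "a * b - f ^ 2 > 0" using assms by (auto simp: reachable_def)
  then show "a * (b + 2 * of_int k * f + of_int k ^ 2 * a) - (f + of_int k * a) ^ 2 > 0"
    by (simp add: algebra_simps power2_eq_square)
  show "ternary_det a (b + 2 * of_int k * f + of_int k ^ 2 * a) c (d + of_int k * e) e (f + of_int k * a)
    = ternary_det a b c d e f"
    unfolding ternary_det_def by algebra
  fix x y z :: int assume nz: "(x, y, z) \<noteq> (0, 0, 0)"
  have "ternary a (b + 2 * of_int k * f + of_int k ^ 2 * a) c (d + of_int k * e) e (f + of_int k * a) x y z
    = ternary a b c d e f (x + k * y) y z"
    unfolding ternary_def of_int_add of_int_mult by algebra
  moreover have "(x + k * y, y, z) \<noteq> (0, 0, 0)" using nz by auto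
  ultimately show "\<exists>x' y' z'. (x', y', z') \<noteq> (0, 0, 0) \<and>
    ternary a (b + 2 * of_int k * f + of_int k ^ 2 * a) c (d + of_int k * e) e (f + of_int k * a) x y z
    = ternary a b c d e f x' y' z'" by blast
qed

lemma reachable_shift23:
  assumes "(a, b, c, d, e, f) \<in> reachable F0"
  shows "(a, b, c + 2 * of_int k * d + of_int k ^ 2 * b, d + of_int k * b, e + of_int k * f, f) \<in> reachable F0"
proof (rule reachable_step [OF assms])
  show "a > 0" "a * b - f ^ 2 > 0" using assms by (auto simp: reachable_def)
  show "ternary_det a b (c + 2 * of_int k * d + of_int k ^ 2 * b) (d + of_int k * b) (e + of_int k * f) f
    = ternary_det a b c d e f"
    unfolding ternary_det_def by algebra
  fix x y z :: int assume nz: "(x, y, z) \<noteq> (0, 0, 0)"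
  have "ternary a b (c + 2 * of_int k * d + of_int k ^ 2 * b) (d + of_int k * b) (e + of_int k * f) f x y z
    = ternary a b c d e f x (y + k * z) z"
    unfolding ternary_def of_int_add of_int_mult by algebra
  moreover have "(x, y + k * z, z) \<noteq> (0, 0, 0)" using nz by auto
  ultimately show "\<exists>x' y' z'. (x', y', z') \<noteq> (0, 0, 0) \<and>
    ternary a b (c + 2 * of_int k * d + of_int k ^ 2 * b) (d + of_int k * b) (e + of_int k * f) f x y z
    = ternary a b c d e f x' y' z'" by blast
qed

text \<open>Jacobi's identity for the 2 x 2 minors that contain the first row and column: they form
  a binary form of determinant a D, to which the bound for binary forms can be applied.\<close>

lemma ternary_minors:
  "(a * b - f ^ 2) * (a * c - e ^ 2) - (a * d - e * f) ^ 2 = a * ternary_det a b c d e f"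
  unfolding ternary_det_def by algebra

lemma reachable_swap23:
  assumes r: "(a, b, c, d, e, f) \<in> reachable F0" and D: "ternary_det a b c d e f > 0"
  shows "(a, c, b, d, f, e) \<in> reachable F0"
proof (rule reachable_step [OF r])
  show a: "a > 0" using r by (auto simp: reachable_def)
  have p: "a * b - f ^ 2 > 0" using r by (auto simp: reachable_def)
  have "(a * b - f ^ 2) * (a * c - e ^ 2) > 0"
    using ternary_minors [of a b f c e d] mult_pos_pos [OF a D] zero_le_power2 [of "a * d - e * f"]
    by linarith
  then show "a * c - e ^ 2 > 0"
    using p by (simp add: zero_less_mult_iff)
  show "ternary_det a c b d f e = ternary_det a b c d e f"
    unfolding ternary_det_def by algebra
  fix x y z :: int assume nz: "(x, y, z) \<noteq> (0, 0, 0)"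
  have "ternary a c b d f e x y z = ternary a b c d e f x z y"
    unfolding ternary_def by algebra
  moreover have "(x, z, y) \<noteq> (0, 0, 0)" using nz by auto
  ultimately show "\<exists>x' y' z'. (x', y', z') \<noteq> (0, 0, 0) \<and>
    ternary a c b d f e x y z = ternary a b c d e f x' y' z'" by blast
qed

lemma reachable_swap12:
  assumes r: "(a, b, c, d, e, f) \<in> reachable F0"
  shows "(b, a, c, e, d, f) \<in> reachable F0"
proof (rule reachable_step [OF r])
  have a: "a > 0" and p: "a * b - f ^ 2 > 0" using r by (auto simp: reachable_def)
  then have "a * b > 0" using zero_le_power2 [of f] by linarith
  then show "b > 0" using a by (simp add: zero_less_mult_iff)
  show "b * a - f ^ 2 > 0" using p by (simp add: mult.commute)
  show "ternary_det b a c e d f = ternary_det a b c d e f"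
    unfolding ternary_det_def by algebra
  fix x y z :: int assume nz: "(x, y, z) \<noteq> (0, 0, 0)"
  have "ternary b a c e d f x y z = ternary a b c d e f y x z"
    unfolding ternary_def by algebra
  moreover have "(y, x, z) \<noteq> (0, 0, 0)" using nz by auto
  ultimately show "\<exists>x' y' z'. (x', y', z') \<noteq> (0, 0, 0) \<and>
    ternary b a c e d f x y z = ternary a b c d e f x' y' z'" by blast
qed

text \<open>Among the reachable forms \<open>a\<close> is taken least, then the minor p = a b - f^2
  least for this \<open>a\<close>. Comparing with the form with the first two variables swapped
  gives a <= b, hence 3 a^2 <= 4 p. After a shift making the mixed minor at most p / 2, swapping the
  last two variables gives p <= a c' - e'^2, hence 3 p^2 <= 4 a D by \<open>ternary_minors\<close>.
  Eliminating \<open>p\<close> yields 27 a^3 <= 64 D.\<close>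

lemma hermite_ternary:
  assumes a0: "a0 > 0" and p0: "a0 * b0 - f0 ^ 2 > 0" and D0: "ternary_det a0 b0 c0 d0 e0 f0 > 0"
  obtains x y z where "(x, y, z) \<noteq> (0, 0, 0)"
    "27 * ternary a0 b0 c0 d0 e0 f0 x y z ^ 3 \<le> 64 * ternary_det a0 b0 c0 d0 e0 f0"
proof -
  let ?F0 = "(a0, b0, c0, d0, e0, f0)" and ?D = "ternary_det a0 b0 c0 d0 e0 f0"
  define V where "V = {ternary a0 b0 c0 d0 e0 f0 x y z | x y z. (x, y, z) \<noteq> (0, 0, 0)}"
  have finV: "finite {v \<in> V. v \<le> M}" for M
  proof (rule finite_subset)
    show "finite ((\<lambda>(x, y, z). ternary a0 b0 c0 d0 e0 f0 x y z) `
        {(x, y, z). ternary a0 b0 c0 d0 e0 f0 x y z \<le> M})"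
      by (intro finite_imageI finite_ternary_le assms)
    show "{v \<in> V. v \<le> M} \<subseteq> (\<lambda>(x, y, z). ternary a0 b0 c0 d0 e0 f0 x y z) `
        {(x, y, z). ternary a0 b0 c0 d0 e0 f0 x y z \<le> M}"
      by (force simp: V_def)
  qed
  have self: "?F0 \<in> reachable ?F0"
    using assms by (auto simp: reachable_def)
  have props: "a > 0 \<and> a * b - f ^ 2 > 0 \<and> ternary_det a b c d e f = ?D \<and> a \<in> V \<and> b \<in> V
      \<and> a + b + 2 * f \<in> V"
    if "(a, b, c, d, e, f) \<in> reachable ?F0" for a b c d e f
  proof -
    note r = that
    have v: "ternary a b c d e f x y z \<in> V" if "(x, y, z) \<noteq> (0, 0, 0)" for x y z
      using r that unfolding reachable_def V_def mem_Collect_eq prod.case by blast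
    show ?thesis
      using that v [of 1 0 0] v [of 0 1 0] v [of 1 1 0]
      by (auto simp: reachable_def ternary_def)
  qed
  define S1 where "S1 = {a. \<exists>b c d e f. (a, b, c, d, e, f) \<in> reachable ?F0}"
  have "S1 \<noteq> {}" using self unfolding S1_def by blast
  moreover have "finite {s \<in> S1. s \<le> M}" for M
    by (rule finite_subset [OF _ finV [of M]]) (use props in \<open>auto simp: S1_def\<close>)
  ultimately obtain a where a: "a \<in> S1" and amin: "\<And>s. s \<in> S1 \<Longrightarrow> a \<le> s"
    using ex_min_if_finite_below [of S1] by blast
  have apos: "a > 0" using a props by (auto simp: S1_def)
  \<comment> \<open>Requiring |f| <= a / 2 loses no minor, because a shift changes \<open>f\<close>
    by a multiple of \<open>a\<close> and preserves a b - f^2; it is needed to bound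
    \<open>b\<close> when the minor is bounded.\<close>
  define S2 where "S2 = {a * b - f ^ 2 | b c d e f. (a, b, c, d, e, f) \<in> reachable ?F0 \<and> \<bar>f\<bar> \<le> a / 2}"
  have S2: "a * b - f ^ 2 \<in> S2" if r: "(a, b, c, d, e, f) \<in> reachable ?F0" for b c d e f
  proof -
    obtain k where k: "\<bar>f + of_int k * a\<bar> \<le> a / 2" using ex_int_shift [OF apos] .
    have "a * b - f ^ 2 = a * (b + 2 * of_int k * f + of_int k ^ 2 * a) - (f + of_int k * a) ^ 2"
      by algebra
    then show ?thesis
      unfolding S2_def using reachable_shift12 [OF r, of k] k by blast
  qed
  have "S2 \<noteq> {}" using a S2 unfolding S1_def by blast
  moreover have "finite {s \<in> S2. s \<le> M}" for M
  proof (rule finite_subset)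
    define K where "K = (M + a ^ 2 / 4) / a"
    \<comment> \<open>The values b and a + b + 2 f at (0, 1, 0) and (1, 1, 0) determine
      \<open>f\<close>, so finitely many values of the form leave finitely many minors.\<close>
    let ?B = "{v \<in> V. v \<le> K}" and ?W = "{v \<in> V. v \<le> 2 * a + K}"
    show "finite ((\<lambda>(b, w). a * b - ((w - a - b) / 2) ^ 2) ` (?B \<times> ?W))"
      using finV by simp
    show "{s \<in> S2. s \<le> M} \<subseteq> (\<lambda>(b, w). a * b - ((w - a - b) / 2) ^ 2) ` (?B \<times> ?W)"
    proof
      fix s assume "s \<in> {s \<in> S2. s \<le> M}"
      then obtain b c d e f where s: "s = a * b - f ^ 2" "s \<le> M" "\<bar>f\<bar> \<le> a / 2"
        and r: "(a, b, c, d, e, f) \<in> reachable ?F0" by (auto simp: S2_def)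
      have "f ^ 2 \<le> (a / 2) ^ 2" using s(3) by (metis abs_ge_zero power2_abs power_mono)
      then have "a * b \<le> M + a ^ 2 / 4" using s by (simp add: power_divide)
      then have bK: "b \<le> K" unfolding K_def using apos by (simp add: field_simps)
      moreover have "a + b + 2 * f \<le> 2 * a + K" using bK s(3) by linarith
      ultimately have "(b, a + b + 2 * f) \<in> ?B \<times> ?W" using props [OF r] by auto
      moreover have "s = (\<lambda>(b, w). a * b - ((w - a - b) / 2) ^ 2) (b, a + b + 2 * f)"
        using s by simp
      ultimately show "s \<in> (\<lambda>(b, w). a * b - ((w - a - b) / 2) ^ 2) ` (?B \<times> ?W)"
        by (rule image_eqI [rotated])
    qed
  qed
  ultimately obtain p where p: "p \<in> S2" and pmin: "\<And>s. s \<in> S2 \<Longrightarrow> p \<le> s"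
    using ex_min_if_finite_below [of S2] by blast
  obtain b c d e f where r: "(a, b, c, d, e, f) \<in> reachable ?F0"
    and pf: "p = a * b - f ^ 2" "\<bar>f\<bar> \<le> a / 2"
    using p by (auto simp: S2_def)
  note pr = props [OF r]
  have ppos: "p > 0" using pr pf by simp
  have "b \<in> S1" using reachable_swap12 [OF r] unfolding S1_def by blast
  then have "a \<le> b" by (rule amin)
  then have "a * a \<le> a * b" using apos by simp
  moreover have "f ^ 2 \<le> (a / 2) ^ 2" using pf(2) by (metis abs_ge_zero power2_abs power_mono)
  ultimately have ap: "3 * a ^ 2 \<le> 4 * p"
    using pf(1) by (simp add: power2_eq_square)
  define q where "q = a * d - e * f"
  obtain k where k: "\<bar>q + of_int k * p\<bar> \<le> p / 2" using ex_int_shift [OF ppos] .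
  define c' where "c' = c + 2 * of_int k * d + of_int k ^ 2 * b"
  define d' where "d' = d + of_int k * b"
  define e' where "e' = e + of_int k * f"
  have r': "(a, b, c', d', e', f) \<in> reachable ?F0"
    unfolding c'_def d'_def e'_def by (rule reachable_shift23 [OF r])
  have D': "ternary_det a b c' d' e' f = ?D" using props [OF r'] by simp
  then have "a * c' - e' ^ 2 \<in> S2"
    using reachable_swap23 [OF r'] D0 S2 by auto
  then have pr': "p \<le> a * c' - e' ^ 2" by (rule pmin)
  have q': "a * d' - e' * f = q + of_int k * p"
    unfolding d'_def e'_def q_def pf(1) by algebra
  have "p * p \<le> p * (a * c' - e' ^ 2)" using pr' ppos by simp
  also have "\<dots> = a * ?D + (q + of_int k * p) ^ 2"
    using ternary_minors [of a b f c' e' d'] unfolding D' q' pf(1) [symmetric] by simp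
  also have "(q + of_int k * p) ^ 2 \<le> (p / 2) ^ 2"
    using k by (metis abs_ge_zero power2_abs power_mono)
  finally have pD: "3 * p ^ 2 \<le> 4 * (a * ?D)"
    by (simp add: power2_eq_square)
  have "(3 * a ^ 2) ^ 2 \<le> (4 * p) ^ 2"
    using ap by (intro power_mono) auto
  then have "a * (27 * a ^ 3) \<le> a * (64 * ?D)"
    using pD by (simp add: power_mult_distrib eval_nat_numeral)
  then have "27 * a ^ 3 \<le> 64 * ?D"
    using apos by (rule mult_left_le_imp_le)
  moreover have "a \<in> V" using pr by simp
  ultimately show ?thesis
    using that by (auto simp: V_def)
qed

section \<open>The curve of conductor 20\<close>

lemma coprime_mult_square_int:
  fixes a b c :: int
  assumes "coprime a b" and "a * b = c ^ 2"
  obtains d where "\<bar>a\<bar> = d ^ 2"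
proof (cases "a = 0 \<or> b = 0")
  case True
  then have "a = 0 \<or> \<bar>a\<bar> = 1 ^ 2"
    using assms(1) by auto
  then show ?thesis using that [of 0] that [of 1] by auto
next
  case False
  have "nat \<bar>a\<bar> * nat \<bar>b\<bar> = nat \<bar>c\<bar> ^ 2"
    using nat_power_eq [of "\<bar>c\<bar>" 2] unfolding nat_abs_mult_distrib [symmetric] assms(2) by simp
  then have pow: "is_nth_power 2 (nat \<bar>a\<bar> * nat \<bar>b\<bar>)"
    unfolding is_nth_power_def by (rule exI)
  have cop: "coprime (nat \<bar>a\<bar>) (nat \<bar>b\<bar>)"
    using assms(1) by simp
  have "nat \<bar>a\<bar> > 0" "nat \<bar>b\<bar> > 0" using False by simp_all
  then have "is_nth_power 2 (nat \<bar>a\<bar>)"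
    by (rule is_nth_power_mult_coprime_natD(1) [OF cop pow])
  then obtain m where "nat \<bar>a\<bar> = m ^ 2"
    by (auto elim: is_nth_powerE)
  then have "\<bar>a\<bar> = int m ^ 2" by (metis abs_ge_zero nat_0_le of_nat_power)
  then show ?thesis by (rule that)
qed

lemma coprime_mult_add_int:
  fixes a b c :: int
  assumes "coprime a b"
  shows "coprime a (a * c + b)"
  using assms gcd_add_mult [of a c b] by (simp add: coprime_iff_gcd_eq_1 mult.commute)

lemma rat_square_imp_int_square:
  assumes "of_int n = (s::rat) ^ 2"
  obtains m :: int where "n = m ^ 2"
proof -
  obtain p q where pq: "s = of_int p / of_int q" "q > 0" "coprime p q"
    by (metis quotient_ofE)
  have "(of_int (n * q ^ 2) :: rat) = of_int (p ^ 2)"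
    using assms pq by (simp add: field_simps)
  then have eq: "n * q ^ 2 = p ^ 2" by (simp only: of_int_eq_iff)
  have "coprime (q ^ 2) (p ^ 2)" using pq(3) by (simp add: coprime_commute)
  moreover have "q ^ 2 dvd p ^ 2" using eq by (metis dvd_triv_right)
  ultimately have "is_unit (q ^ 2)" by (metis coprime_absorb_left)
  then have "q = 1" using pq(2) by (simp add: power2_eq_1_iff)
  then show ?thesis using that eq by simp
qed

lemma rat_square_divideI:
  assumes "\<bar>p\<bar> = (a::int) ^ 2" and "\<bar>q\<bar> = b ^ 2"
  shows "\<exists>w::rat. \<bar>of_int p / of_int q\<bar> = w ^ 2"
proof -
  have "\<bar>of_int p / of_int q :: rat\<bar> = of_int \<bar>p\<bar> / of_int \<bar>q\<bar>"
    by simp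
  also have "\<dots> = (of_int a / of_int b) ^ 2"
    unfolding assms by (simp add: power_divide)
  finally show ?thesis by blast
qed

text \<open>The constant term of X^2 + X - 1 is a unit, so the numerator, the denominator and the
  quadratic form are pairwise coprime with square product.\<close>

lemma curve20_x_square:
  fixes X Y :: rat
  assumes c: "Y ^ 2 = X * (X ^ 2 + X - 1)"
  obtains w where "\<bar>X\<bar> = w ^ 2"
proof -
  obtain p q where pq: "X = of_int p / of_int q" "q > 0" "coprime p q"
    by (metis quotient_ofE)
  let ?r = "p ^ 2 + p * q - q ^ 2"
  have "of_int (p * q * ?r) = (Y * of_int q ^ 2) ^ 2"
    unfolding power_mult_distrib c pq(1) using pq(2) by (simp add: field_simps eval_nat_numeral)
  then obtain m where m: "p * q * ?r = m ^ 2"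
    by (rule rat_square_imp_int_square)
  have "coprime p ?r"
  proof -
    have "coprime p (p * (p + q) + - (q ^ 2))"
      by (rule coprime_mult_add_int) (use pq(3) in simp)
    then show ?thesis by (simp add: algebra_simps power2_eq_square)
  qed
  then have "coprime p (q * ?r)" using pq(3) by simp
  moreover have "p * (q * ?r) = m ^ 2" using m by simp
  ultimately obtain a where "\<bar>p\<bar> = a ^ 2" by (rule coprime_mult_square_int)
  moreover have "coprime q ?r"
  proof -
    have "coprime q (q * (p - q) + p ^ 2)"
      by (rule coprime_mult_add_int) (use pq(3) in \<open>simp add: coprime_commute\<close>)
    then show ?thesis by (simp add: algebra_simps power2_eq_square)
  qed
  then have "coprime q (p * ?r)" using pq(3) by (simp add: coprime_commute)
  moreover have "q * (p * ?r) = m ^ 2" using m by (simp only: mult_ac)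
  ultimately obtain b where "\<bar>q\<bar> = b ^ 2" using coprime_mult_square_int by metis
  then show ?thesis
    using rat_square_divideI [OF \<open>\<bar>p\<bar> = a ^ 2\<close>] that pq(1) by blast
qed

text \<open>Positivity of the quadratic factor excludes negative \<open>z\<close>. The numerator can
  share only the prime 5 with the quadratic form; if it does, 5 / z, the abscissa after translation
  by the 2-torsion point (0, 0), takes the place of \<open>z\<close>.\<close>

lemma curve20_dual_x_square:
  fixes z s :: rat
  assumes c: "s ^ 2 = z * (z ^ 2 - 2 * z + 5)" and z: "z \<noteq> 0"
  shows "\<exists>k. z = k ^ 2 \<or> 5 / z = k ^ 2"
proof -
  obtain p q where pq: "z = of_int p / of_int q" "q > 0" "coprime p q"
    by (metis quotient_ofE)
  have "z ^ 2 - 2 * z + 5 = (z - 1) ^ 2 + 4" by algebra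
  then have pos': "z ^ 2 - 2 * z + 5 > 0"
    using zero_le_power2 [of "z - 1"] by linarith
  then have "z > 0"
    using c z zero_le_power2 [of s] by (auto simp: zero_le_mult_iff)
  then have p: "p > 0" using pq(1,2) by (simp add: zero_less_divide_iff)
  let ?r = "p ^ 2 - 2 * p * q + 5 * q ^ 2"
  have "of_int (p * q * ?r) = (s * of_int q ^ 2) ^ 2"
    unfolding power_mult_distrib c pq(1) using pq(2) by (simp add: field_simps eval_nat_numeral)
  then obtain m where m: "p * q * ?r = m ^ 2"
    by (rule rat_square_imp_int_square)
  have qr: "coprime q ?r"
  proof -
    have "coprime q (q * (5 * q - 2 * p) + p ^ 2)"
      by (rule coprime_mult_add_int) (use pq(3) in \<open>simp add: coprime_commute\<close>)
    then show ?thesis by (simp add: algebra_simps power2_eq_square)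
  qed
  then have "coprime q (p * ?r)" using pq(3) by (simp add: coprime_commute)
  moreover have "q * (p * ?r) = m ^ 2" using m by (simp only: mult_ac)
  ultimately obtain b where b: "\<bar>q\<bar> = b ^ 2" using coprime_mult_square_int by metis
  show ?thesis
  proof (cases "5 dvd p")
    case False
    have "prime (5::int)" by simp
    then have "coprime 5 p" using False by (simp add: prime_imp_coprime)
    then have "coprime p (5 * q ^ 2)"
      using pq(3) by (simp add: coprime_commute)
    then have "coprime p (p * (p - 2 * q) + 5 * q ^ 2)"
      by (rule coprime_mult_add_int)
    then have "coprime p ?r" by (simp add: algebra_simps power2_eq_square)
    then have "coprime p (q * ?r)" using pq(3) by simp
    moreover have "p * (q * ?r) = m ^ 2" using m by simp
    ultimately obtain a where "\<bar>p\<bar> = a ^ 2" by (rule coprime_mult_square_int)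
    then show ?thesis
      using rat_square_divideI [OF _ b] \<open>z > 0\<close> pq(1) by (metis abs_of_pos)
  next
    case True
    then obtain p' where p': "p = 5 * p'" by (rule dvdE)
    let ?r' = "5 * p' ^ 2 - 2 * p' * q + q ^ 2"
    have cop: "coprime p' q" using pq(3) p' by simp
    have "25 * (p' * (q * ?r')) = m ^ 2"
      unfolding m [symmetric] p' by algebra
    moreover from this have "m ^ 2 = 5 * (5 * (p' * (q * ?r')))" by simp
    then have "5 dvd m ^ 2" by (rule dvdI)
    then have "5 dvd m" using prime_dvd_power [of "5::int"] by simp
    then obtain m' where "m = 5 * m'" by (rule dvdE)
    ultimately have m': "p' * (q * ?r') = m' ^ 2" by (simp add: power_mult_distrib)
    have "coprime p' (p' * (5 * p' - 2 * q) + q ^ 2)"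
      by (rule coprime_mult_add_int) (use cop in simp)
    then have "coprime p' ?r'" by (simp add: algebra_simps power2_eq_square)
    then have "coprime p' (q * ?r')" using cop by simp
    then obtain a where "\<bar>p'\<bar> = a ^ 2" using m' by (rule coprime_mult_square_int)
    moreover have "\<bar>5 / z\<bar> = \<bar>of_int q / of_int p'\<bar>"
      using pq p p' by simp
    ultimately show ?thesis
      using rat_square_divideI [OF b] \<open>z > 0\<close> by (metis abs_of_pos zero_less_divide_iff zero_less_numeral)
  qed
qed

lemma ec_half_up_to_sign:
  assumes Q: "Q \<in> ec_points A B" and P: "Affine x y \<in> ec_points A B"
    and QQ: "ec_add A Q Q = Affine x y'"
  shows "\<exists>Q' \<in> ec_points A B. ec_add A Q' Q' = Affine x y"
proof -
  have "Affine x y' \<in> ec_points A B"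
    using ec_add_closed [OF Q Q] QQ by simp
  then have "y' ^ 2 = y ^ 2" using P by simp
  then consider "y' = y" | "y' = - y" by (auto simp: power2_eq_iff)
  then show ?thesis
  proof cases
    case 1
    then show ?thesis using Q QQ by auto
  next
    case 2
    have "ec_add A (ec_neg Q) (ec_neg Q) = Affine x y"
      using ec_neg_add [OF Q Q] QQ 2 by simp
    then show ?thesis using Q by (intro bexI [of _ "ec_neg Q"]) auto
  qed
qed

text \<open>
  With \<open>X = w\<^sup>2\<close> on \<open>Y\<^sup>2 = X\<^sup>3 + X\<^sup>2 - X\<close>, the values \<open>z\<close> and \<open>5 / z\<close> below are the abscissae of the points
  above \<open>(X, Y)\<close> on the 2-isogenous curve \<open>Y\<^sup>2 = X\<^sup>3 - 2 X\<^sup>2 + 5 X\<close>, and a point with abscissa \<open>k\<^sup>2\<close> there is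
  the image of a rational point. The short equation is obtained by \<open>x = 9 X + 3\<close>, \<open>y = 27 Y\<close>.
\<close>

lemma curve20_halving:
  fixes w Y :: rat
  assumes c: "Y ^ 2 = w ^ 2 * (w ^ 4 + w ^ 2 - 1)" and w: "w \<noteq> 0"
    and P: "Affine (9 * w ^ 2 + 3) y \<in> ec_points (- 108) 297"
  shows "\<exists>Q \<in> ec_points (- 108) 297. ec_add (- 108) Q Q = Affine (9 * w ^ 2 + 3) y"
proof -
  define v where "v = Y / w"
  have v: "v ^ 2 = w ^ 4 + w ^ 2 - 1"
    unfolding v_def power_divide c using w by simp
  define z where "z = 2 * w ^ 2 + 1 + 2 * v"
  have zz: "z * (2 * w ^ 2 + 1 - 2 * v) = 5"
    unfolding z_def using v by algebra
  then have z0: "z \<noteq> 0" by auto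
  then have z': "5 / z = 2 * w ^ 2 + 1 - 2 * v" using zz by (simp add: field_simps)
  have "(2 * w * z) ^ 2 = z * (z ^ 2 - 2 * z + 5)"
    unfolding zz [symmetric] unfolding z_def by algebra
  then obtain k where "z = k ^ 2 \<or> 5 / z = k ^ 2"
    using curve20_dual_x_square z0 by blast
  then have "k ^ 2 = 2 * w ^ 2 + 1 + 2 * 1 * v \<or> k ^ 2 = 2 * w ^ 2 + 1 + 2 * - 1 * v"
    unfolding z' by (auto simp: z_def)
  then obtain e :: rat where e: "e = 1 \<or> e = - 1" and k: "k ^ 2 = 2 * w ^ 2 + 1 + 2 * e * v"
    by blast
  have "e ^ 2 = 1" using e by auto
  have "(k ^ 2 - 2 * w ^ 2 - 1) ^ 2 = 4 * (w ^ 4 + w ^ 2 - 1)"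
    unfolding k v [symmetric] using \<open>e ^ 2 = 1\<close> by algebra
  then have k4: "(2 * w * k) ^ 2 = (k ^ 2 - 1) ^ 2 + 4" by algebra
  \<comment> \<open>The half is sought on the line Y = k X, so its abscissa satisfies X^2 + X - 1 =
    k^2 X. The discriminant (k^2 - 1)^2 + 4 of this quadratic is the square (2 w k)^2, so the roots
    are rational.\<close>
  define X where "X = (k ^ 2 - 1 + 2 * w * k) / 2"
  have X2: "2 * X = k ^ 2 - 1 + 2 * w * k" by (simp add: X_def)
  have quad: "X ^ 2 = (k ^ 2 - 1) * X + 1"
    using X2 k4 by algebra
  have "X \<noteq> 0" using quad by auto
  have "k \<noteq> 0"
  proof
    assume "k = 0"
    then have "X ^ 2 + X = 1" using quad by simp
    moreover have "X = - 1 / 2" using X2 \<open>k = 0\<close> by simp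
    ultimately show False by (simp add: power2_eq_square)
  qed
  have Q: "Affine (9 * X + 3) (27 * k * X) \<in> ec_points (- 108) 297"
    unfolding Affine_in_ec_points using quad by algebra
  have "line_rel (- 108) (3 * (k + w)) (9 * X + 3) (27 * k * X) (9 * X + 3) (27 * k * X)"
    unfolding line_rel_def using quad X2 by algebra
  from ec_add_line [OF this]
  obtain y' where "ec_add (- 108) (Affine (9 * X + 3) (27 * k * X)) (Affine (9 * X + 3) (27 * k * X))
      = Affine ((3 * (k + w)) ^ 2 - (9 * X + 3) - (9 * X + 3)) y'"
    using \<open>X \<noteq> 0\<close> \<open>k \<noteq> 0\<close> by auto
  moreover have "(3 * (k + w)) ^ 2 - (9 * X + 3) - (9 * X + 3) = 9 * w ^ 2 + 3"
    using X2 by algebra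
  ultimately show ?thesis
    using ec_half_up_to_sign [OF Q P] by simp
qed

lemma curve20_all_torsion:
  assumes P: "P \<in> ec_points (- 108) (297 :: rat)"
  shows "torsion (ec_group (- 108) 297) P"
proof -
  let ?T = "Affine 3 0 :: rat ec_point"
  have ns: "ec_nonsingular (- 108) (297 :: rat)"
    by (simp add: ec_nonsingular_def)
  have T: "?T \<in> ec_points (- 108) 297" by simp
  have square: "\<exists>Q \<in> ec_points (- 108) 297. ec_add (- 108) Q Q = Affine x y"
    if P: "Affine x y \<in> ec_points (- 108) 297" and x: "x > 3" for x y :: rat
  proof -
    define X where "X = (x - 3) / 9"
    define Y where "Y = y / 27"
    have xy: "x = 9 * X + 3" "y = 27 * Y" by (simp_all add: X_def Y_def field_simps)
    have "(27 * Y) ^ 2 = (9 * X + 3) ^ 3 - 108 * (9 * X + 3) + 297"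
      using P unfolding xy by simp
    then have c: "Y ^ 2 = X * (X ^ 2 + X - 1)" by algebra
    have "X > 0" using x by (simp add: X_def)
    obtain w where "\<bar>X\<bar> = w ^ 2" using curve20_x_square [OF c] .
    then have w: "X = w ^ 2" "w \<noteq> 0" using \<open>X > 0\<close> by auto
    have "Y ^ 2 = w ^ 2 * (w ^ 4 + w ^ 2 - 1)"
      unfolding c w(1) by algebra
    then show ?thesis
      using curve20_halving [of Y w y] w P xy by simp
  qed
  have "torsion (ec_group (of_int (- 108)) (of_int 297)) P"
  proof (rule ec_all_torsion_if_halving [where c = 93])
    fix P :: "rat ec_point"
    assume P: "P \<in> ec_points (of_int (- 108)) (of_int 297)" and "P \<noteq> Infinity"
    then obtain x y where xy: "P = Affine x y" by (cases P) auto
    have P': "Affine x y \<in> ec_points (- 108) 297" using P xy by simp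
    consider "x > 3" | "x = 3" | "x < 3" by linarith
    then show "\<exists>Q \<in> ec_points (of_int (- 108)) (of_int 297).
      \<exists>T \<in> ec_points (of_int (- 108)) (of_int 297). ec_add (of_int (- 108)) T T = Infinity \<and>
        P = ec_add (of_int (- 108)) (ec_add (of_int (- 108)) Q Q) T \<and>
        ec_height (ec_add (of_int (- 108)) Q Q) \<le> 93 * ec_height P"
    proof cases
      case 1
      then obtain Q where "Q \<in> ec_points (- 108) 297" "ec_add (- 108) Q Q = P"
        using square [OF P'] xy by auto
      then show ?thesis
        by (intro bexI [of _ Q] bexI [of _ Infinity]) auto
    next
      case 2
      then have "y = 0" using P' by simp
      then show ?thesis
        using 2 xy T by (intro bexI [of _ Infinity] bexI [of _ "Affine 3 0"]) auto
    next
      case 3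
      \<comment> \<open>Translation by (3, 0) maps (x - 3) / 9 to its negative inverse, which brings
        the point into the range of \<open>square\<close>. From x' = (3 x - 90) / (x - 3) comes the
        height factor 93 = 3 + 90.\<close>
      define m where "m = y / (x - 3)"
      define x' where "x' = m ^ 2 - x - 3"
      define y' where "y' = m * (x - x') - y"
      have m: "m * (x - 3) = y" using 3 by (simp add: m_def)
      have "y ^ 2 = (x ^ 2 + 3 * x - 99) * (x - 3)"
        using P' unfolding Affine_in_ec_points by algebra
      then have "m ^ 2 * (x - 3) ^ 2 = (x ^ 2 + 3 * x - 99) * (x - 3)"
        unfolding m [symmetric] by (simp add: power_mult_distrib)
      then have "(x - 3) * (m ^ 2 * (x - 3) - (x ^ 2 + 3 * x - 99)) = 0"
        by algebra
      then have m2: "m ^ 2 * (x - 3) = x ^ 2 + 3 * x - 99" using 3 by simp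
      have "x' * (x - 3) = 3 * x - 90"
        unfolding x'_def using m2 by algebra
      then have x': "x' = (3 * x - 90) / (x - 3)"
        using 3 by (simp add: eq_divide_eq)
      have "(x' - 3) * (x - 3) = - 81"
        unfolding x' using 3 by (simp add: field_simps)
      then have "x' > 3"
        using 3 mult_nonpos_nonpos [of "x' - 3" "x - 3"] by (cases "x' > 3") auto
      have line: "line_rel (- 108) m x y 3 0"
        unfolding line_rel_def using m2
        by (simp add: m [symmetric] algebra_simps power2_eq_square)
      have PT: "ec_add (- 108) P ?T = Affine x' y'"
        unfolding xy x'_def y'_def by (rule ec_add_line [OF line]) (use 3 in auto)
      have PT': "Affine x' y' \<in> ec_points (- 108) 297"
        using ec_add_closed [of P "- 108" 297 ?T] P' xy T PT by simp
      obtain Q where Q: "Q \<in> ec_points (- 108) 297" "ec_add (- 108) Q Q = Affine x' y'"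
        using square [OF PT' \<open>x' > 3\<close>] by blast
      have "ec_add (- 108) (ec_add (- 108) P ?T) (ec_neg ?T) = P"
        by (rule ec_add_cancel [OF ns _ T]) (use P' xy in simp)
      then have eq: "P = ec_add (- 108) (ec_add (- 108) Q Q) ?T"
        unfolding Q(2) PT by simp
      obtain p q where pq: "x = of_int p / of_int q" "q > 0" "int (rat_height x) = max \<bar>p\<bar> q"
        by (metis quotient_ofE)
      have "x - 3 = of_int (p - 3 * q) / of_int q" "3 * x - 90 = of_int (3 * p - 90 * q) / of_int q"
        using pq by (simp_all add: field_simps)
      then have x'': "x' = of_int (3 * p - 90 * q) / of_int (p - 3 * q)"
        unfolding x' using pq(2) by simp
      have "p - 3 * q \<noteq> 0"
        using \<open>x - 3 = _\<close> 3 by auto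
      then have "int (rat_height x') \<le> max \<bar>3 * p - 90 * q\<bar> \<bar>p - 3 * q\<bar>"
        unfolding x'' by (rule rat_height_divide_le)
      also have "\<dots> \<le> 93 * max \<bar>p\<bar> q"
        using pq(2) by (auto simp: max_def abs_if)
      finally have "rat_height x' \<le> 93 * rat_height x"
        using pq(3) by linarith
      then show ?thesis
        using Q eq xy T by (intro bexI [of _ Q] bexI [of _ ?T]) auto
    qed
  qed (use P ns in auto)
  then show ?thesis by simp
qed

section \<open>The cubic field of discriminant -44\<close>

text \<open>
  \<open>Cub u v w\<close> stands for \<open>u + v \<omega> + w \<omega>\<^sup>2\<close> with \<open>\<omega>\<^sup>3 = 2 \<omega>\<^sup>2 - 2\<close>, in the maximal order of the cubic
  field of discriminant \<open>-44\<close>; \<open>x = 18 \<omega> - 12\<close> is the abscissa of a 2-torsion point of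
  \<open>y\<^sup>2 = x\<^sup>3 - 432 x + 8208\<close>.
\<close>

datatype cubic_int = Cub int int int

instantiation cubic_int :: comm_ring_1
begin

definition "0 = Cub 0 0 0"
definition "1 = Cub 1 0 0"

fun plus_cubic_int where
  "Cub u v w + Cub u' v' w' = Cub (u + u') (v + v') (w + w')"

fun minus_cubic_int where
  "Cub u v w - Cub u' v' w' = Cub (u - u') (v - v') (w - w')"

fun uminus_cubic_int where
  "- Cub u v w = Cub (- u) (- v) (- w)"

text \<open>The terms in w w' come from \<omega>^4 = 4 \<omega>^2 - 2 \<omega> - 4.\<close>

fun times_cubic_int where
  "Cub u v w * Cub u' v' w' = Cub
    (u * u' - 2 * (v * w' + w * v') - 4 * (w * w'))
    (u * v' + v * u' - 2 * (w * w'))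
    (u * w' + v * v' + w * u' + 2 * (v * w' + w * v') + 4 * (w * w'))"

instance
proof
  fix a b c :: cubic_int
  show "a * b * c = a * (b * c)" "a * b = b * a" "(a + b) * c = a * c + b * c"
    "a + b + c = a + (b + c)" "a + b = b + a" "a - b = a + - b"
    by (cases a; cases b; cases c; simp add: algebra_simps)+
  show "1 * a = a" "0 + a = a" "- a + a = 0" "(0 :: cubic_int) \<noteq> 1"
    by (cases a; simp add: zero_cubic_int_def one_cubic_int_def)+
qed

end

lemma of_nat_cubic_int: "of_nat n = Cub (int n) 0 0"
  by (induction n) (simp_all add: zero_cubic_int_def one_cubic_int_def)

lemma of_int_cubic_int: "of_int n = Cub n 0 0"
  by (cases n rule: int_diff_cases) (simp add: of_nat_cubic_int)

lemma of_int_cubic_int_eq_iff [simp]: "of_int m = (of_int n :: cubic_int) \<longleftrightarrow> m = n"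
  by (simp add: of_int_cubic_int)

fun cubic_adj :: "cubic_int \<Rightarrow> cubic_int" where
  "cubic_adj (Cub u v w) = Cub (u ^ 2 + 2 * u * v + 4 * u * w + 2 * v * w + 4 * w ^ 2)
    (- u * v - 2 * v ^ 2 - 4 * v * w - 2 * w ^ 2) (- u * w + v ^ 2 + 2 * v * w)"

fun cubic_norm :: "cubic_int \<Rightarrow> int" where
  "cubic_norm (Cub u v w) = u ^ 3 + 2 * u ^ 2 * v + 4 * u ^ 2 * w + 8 * u * w ^ 2 + 6 * u * v * w
    - 2 * v ^ 3 - 4 * v ^ 2 * w + 4 * w ^ 3"

lemma cubic_mult_adj: "a * cubic_adj a = of_int (cubic_norm a)"
proof (cases a)
  case (Cub u v w)
  show ?thesis
    unfolding Cub cubic_adj.simps times_cubic_int.simps cubic_norm.simps of_int_cubic_int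
      cubic_int.inject
    by (intro conjI; algebra)
qed

lemma cubic_adj_mult: "cubic_adj (a * b) = cubic_adj a * cubic_adj b"
proof (cases a; cases b)
  fix u v w u' v' w' assume ab: "a = Cub u v w" "b = Cub u' v' w'"
  show ?thesis
    unfolding ab cubic_adj.simps times_cubic_int.simps cubic_int.inject
    by (intro conjI; algebra)
qed

lemma cubic_norm_mult: "cubic_norm (a * b) = cubic_norm a * cubic_norm b"
proof -
  have "of_int (cubic_norm (a * b)) = (a * cubic_adj a) * (b * cubic_adj b)"
    by (simp only: cubic_mult_adj [symmetric] cubic_adj_mult mult_ac)
  then have "of_int (cubic_norm (a * b)) = (of_int (cubic_norm a * cubic_norm b) :: cubic_int)"
    by (simp add: cubic_mult_adj)
  then show ?thesis by (simp only: of_int_cubic_int_eq_iff)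
qed

text \<open>Infinite descent at 2: as x^3 - 2 x^2 + 2 is an Eisenstein polynomial, norm 0 forces u,
  v and w to be even in turn, and halving all three preserves norm 0.\<close>

lemma cubic_norm_eq_0:
  assumes "cubic_norm a = 0"
  shows "a = 0"
proof -
  have "u = 0 \<and> v = 0 \<and> w = 0" if "cubic_norm (Cub u v w) = 0" for u v w
    using that
  proof (induction "nat (\<bar>u\<bar> + \<bar>v\<bar> + \<bar>w\<bar>)" arbitrary: u v w rule: less_induct)
    case less
    have "u ^ 3 = 2 * (v ^ 3 + 2 * v ^ 2 * w - 2 * w ^ 3
        - u ^ 2 * v - 2 * u ^ 2 * w - 4 * u * w ^ 2 - 3 * u * v * w)"
      using less.prems by simp
    then have "even (u ^ 3)" by (metis dvd_triv_left)
    then obtain a where a: "u = 2 * a" by auto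
    have "v ^ 3 = 2 * (2 * a ^ 3 + 2 * a ^ 2 * v + 4 * a ^ 2 * w + 4 * a * w ^ 2 + 3 * a * v * w
        - v ^ 2 * w + w ^ 3)"
      using less.prems unfolding a by (simp add: power_mult_distrib)
    then have "even (v ^ 3)" by (metis dvd_triv_left)
    then obtain b where b: "v = 2 * b" by auto
    have "w ^ 3 = 2 * (2 * b ^ 3 + 2 * b ^ 2 * w
        - a ^ 3 - 2 * a ^ 2 * b - 2 * a ^ 2 * w - 2 * a * w ^ 2 - 3 * a * b * w)"
      using less.prems unfolding a b by (simp add: power_mult_distrib)
    then have "even (w ^ 3)" by (metis dvd_triv_left)
    then obtain c where c: "w = 2 * c" by auto
    have norm: "cubic_norm (Cub a b c) = 0"
      using less.prems unfolding a b c by (simp add: power_mult_distrib)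
    show ?case
    proof (cases "u = 0 \<and> v = 0 \<and> w = 0")
      case False
      then have "nat (\<bar>a\<bar> + \<bar>b\<bar> + \<bar>c\<bar>) < nat (\<bar>u\<bar> + \<bar>v\<bar> + \<bar>w\<bar>)"
        unfolding a b c by (auto simp: abs_mult)
      from less.hyps [OF this norm] show ?thesis
        unfolding a b c by simp
    qed
  qed
  note * = this
  obtain u v w where a: "a = Cub u v w" by (cases a)
  show ?thesis
    using * [OF assms [unfolded a]] by (simp add: a zero_cubic_int_def)
qed

text \<open>The only real root of x^3 - 2 x^2 + 2, whose discriminant is negative. The enclosing
  interval is part of the choice because all later numerical estimates rest on it.\<close>

definition cubic_root :: real where
  "cubic_root = (SOME x. - 0.84 < x \<and> x < - 0.839 \<and> x ^ 3 = 2 * x ^ 2 - 2)"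

lemma cubic_root: "- 0.84 < cubic_root" "cubic_root < - 0.839" "cubic_root ^ 3 = 2 * cubic_root ^ 2 - 2"
proof -
  let ?f = "\<lambda>x::real. x ^ 3 - 2 * x ^ 2 + 2"
  have ends: "?f (- 0.84) < 0" "?f (- 0.839) > 0"
    by (simp_all add: power2_eq_square power3_eq_cube)
  have "continuous_on {- 0.84..- 0.839} ?f"
    by (intro continuous_intros)
  then have "\<exists>x \<ge> - 0.84. x \<le> - 0.839 \<and> ?f x = 0"
    using ends by (intro IVT') simp_all
  then obtain x :: real where x: "- 0.84 \<le> x" "x \<le> - 0.839" "?f x = 0" by blast
  have "x \<noteq> - 0.84" "x \<noteq> - 0.839"
    using x(3) ends by (metis less_irrefl)+
  then have "- 0.84 < x \<and> x < - 0.839 \<and> x ^ 3 = 2 * x ^ 2 - 2"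
    using x by auto
  from someI [of "\<lambda>x. - 0.84 < x \<and> x < - 0.839 \<and> x ^ 3 = 2 * x ^ 2 - 2", OF this]
  show "- 0.84 < cubic_root" "cubic_root < - 0.839" "cubic_root ^ 3 = 2 * cubic_root ^ 2 - 2"
    by (auto simp: cubic_root_def)
qed

fun cubic_real :: "cubic_int \<Rightarrow> real" where
  "cubic_real (Cub u v w) = of_int u + of_int v * cubic_root + of_int w * cubic_root ^ 2"

lemma cubic_real_mult: "cubic_real (a * b) = cubic_real a * cubic_real b"
proof (cases a; cases b)
  fix u v w u' v' w' assume ab: "a = Cub u v w" "b = Cub u' v' w'"
  have "cubic_root ^ 4 = 4 * cubic_root ^ 2 - 4 - 2 * cubic_root"
    using cubic_root(3) by algebra
  then show ?thesis
    unfolding ab using cubic_root(3) by simp algebra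
qed

lemma cubic_real_of_int [simp]: "cubic_real (of_int n) = of_int n"
  by (simp add: of_int_cubic_int)

text \<open>
  The adjugate is the product of the two other conjugates, which are complex, so that this is their
  squared modulus.
\<close>

definition cubic_abs2 :: "cubic_int \<Rightarrow> real" where
  "cubic_abs2 a = cubic_real (cubic_adj a)"

lemma cubic_abs2_mult: "cubic_abs2 (a * b) = cubic_abs2 a * cubic_abs2 b"
  by (simp add: cubic_abs2_def cubic_adj_mult cubic_real_mult)

lemma cubic_real_mult_abs2: "cubic_real a * cubic_abs2 a = of_int (cubic_norm a)"
  by (simp add: cubic_abs2_def cubic_mult_adj flip: cubic_real_mult)

text \<open>Squared real part plus squared imaginary part: for the real root t, the complex roots
  have real part (2 - t) / 2 and squared imaginary part (3 t^2 - 4 t - 4) / 4.\<close>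

lemma cubic_abs2_Cub:
  "cubic_abs2 (Cub u v w) =
    (of_int u + (2 - cubic_root) / 2 * of_int v + (4 - cubic_root ^ 2) / 2 * of_int w) ^ 2
    + (3 * cubic_root ^ 2 - 4 * cubic_root - 4) / 4 * (of_int v + (2 - cubic_root) * of_int w) ^ 2"
proof -
  define t where "t = cubic_root"
  have t3: "t ^ 3 = 2 * t ^ 2 - 2" using cubic_root(3) by (simp add: t_def)
  have t4: "t ^ 4 = 4 * t ^ 2 - 4 - 2 * t" using t3 by algebra
  show ?thesis
    unfolding cubic_abs2_def cubic_adj.simps cubic_real.simps t_def [symmetric]
    using t3 t4 by (simp add: field_simps) algebra
qed

lemma cubic_root_square: "0.7039 < cubic_root ^ 2" "cubic_root ^ 2 < 0.7056"
proof -
  have "0.839 ^ 2 < (- cubic_root) ^ 2" "(- cubic_root) ^ 2 < 0.84 ^ 2"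
    using cubic_root(1,2) by (intro power_strict_mono; simp)+
  then show "0.7039 < cubic_root ^ 2" "cubic_root ^ 2 < 0.7056"
    by (simp_all add: power2_eq_square)
qed

lemma cubic_abs2_nonneg: "cubic_abs2 a \<ge> 0"
proof (cases a)
  case (Cub u v w)
  have "(3 * cubic_root ^ 2 - 4 * cubic_root - 4) / 4 \<ge> 0"
    using cubic_root cubic_root_square by simp
  then show ?thesis
    unfolding Cub cubic_abs2_Cub by (intro add_nonneg_nonneg mult_nonneg_nonneg) auto
qed

text \<open>Evaluation over the box of coordinates to which \<open>small_cubic_unit\<close> confines
  its unit.\<close>

lemma small_cubic_norm_1:
  "\<forall>w \<in> set [-2..2]. \<forall>v \<in> set [-9..9]. \<forall>u \<in> set [-13..13]. cubic_norm (Cub u v w) = 1 \<longrightarrow>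
    (u, v, w) \<in> set [(1, 0, 0), (1, 0, -1), (1, -2, 1), (-1, -1, 1), (1, -1, 0),
      (-3, -2, 2), (1, 1, 0), (1, 2, 1), (3, -3, 1), (5, -6, 2)]"
  by code_simp

lemma abs_le_if_square_le:
  fixes x r :: real
  assumes "x ^ 2 \<le> r ^ 2" and "r \<ge> 0"
  shows "\<bar>x\<bar> \<le> r"
  using assms by (metis abs_le_square_iff abs_of_nonneg)

text \<open>Bounds at the real and the complex place confine the coordinates. The units that remain
  are the powers of \<open>Cub (- 1) (- 1) 1\<close> with exponents from -2 to 2.\<close>

lemma small_cubic_unit:
  assumes norm: "cubic_norm a = 1"
    and h: "(18 / 100) < cubic_real a" "cubic_real a \<le> (471 / 100)" and c: "cubic_abs2 a \<le> (555 / 100)"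
  shows "a \<in> {Cub 1 0 0, Cub 1 0 (- 1), Cub 1 (- 2) 1, Cub (- 1) (- 1) 1, Cub 1 (- 1) 0}"
proof -
  obtain u v w where a: "a = Cub u v w" by (cases a)
  define t where "t = cubic_root"
  have t: "- (84 / 100) < t" "t < - (839 / 1000)" "(7039 / 10000) < t ^ 2" "t ^ 2 < (7056 / 10000)"
    using cubic_root cubic_root_square by (auto simp: t_def)
  define U :: real where "U = of_int u"
  define V :: real where "V = of_int v"
  define W :: real where "W = of_int w"
  define g where "g = U + (2 - t) / 2 * V + (4 - t ^ 2) / 2 * W"
  define s where "s = V + (2 - t) * W"
  define k where "k = (3 * t ^ 2 - 4 * t - 4) / 4"
  have heq: "cubic_real a = U + V * t + W * t ^ 2"
    by (simp add: a t_def U_def V_def W_def)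
  have ceq: "cubic_abs2 a = g ^ 2 + k * s ^ 2"
    unfolding a cubic_abs2_Cub g_def s_def k_def t_def U_def V_def W_def ..
  have "366 \<le> 1000 * k" using t by (simp add: k_def)
  then have "366 * s ^ 2 \<le> (1000 * k) * s ^ 2" by (intro mult_right_mono) auto
  then have ks: "366 * s ^ 2 \<le> 1000 * (k * s ^ 2)" by (simp only: mult.assoc)
  have c': "100 * g ^ 2 + 100 * (k * s ^ 2) \<le> 555"
    using c unfolding ceq by simp
  have "100 * g ^ 2 \<le> 555" using c' ks zero_le_power2 [of s] by linarith
  then have "g ^ 2 \<le> (236 / 100) ^ 2" by (simp add: power2_eq_square)
  then have g: "\<bar>g\<bar> \<le> 236 / 100" by (rule abs_le_if_square_le) simp
  have "366 * s ^ 2 \<le> 5550" using c' ks zero_le_power2 [of g] by linarith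
  then have "s ^ 2 \<le> (39 / 10) ^ 2" by (simp add: power2_eq_square)
  then have s: "\<bar>s\<bar> \<le> 39 / 10" by (rule abs_le_if_square_le) simp
  \<comment> \<open>The difference of the two embeddings eliminates \<open>U\<close>, and
    \<open>s\<close> absorbs \<open>V\<close>. So w is bounded here, then v through
    \<open>s\<close>, then u through the real embedding.\<close>
  have eq: "g - cubic_real a = (1 - 3 * t / 2) * s - (3 * t ^ 2 - 4 * t) * W"
    unfolding heq g_def s_def by (simp add: field_simps power2_eq_square)
  have "\<bar>g - cubic_real a\<bar> \<le> (707 / 100)" using g h by linarith
  moreover have "\<bar>(1 - 3 * t / 2) * s\<bar> \<le> (226 / 100) * (39 / 10)"
    unfolding abs_mult using s t by (intro mult_mono) auto
  ultimately have "\<bar>(3 * t ^ 2 - 4 * t) * W\<bar> \<le> (15884 / 1000)"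
    using eq by linarith
  moreover have "(546 / 100) * \<bar>W\<bar> \<le> (3 * t ^ 2 - 4 * t) * \<bar>W\<bar>"
    using t by (intro mult_right_mono) auto
  moreover have "\<bar>(3 * t ^ 2 - 4 * t) * W\<bar> = (3 * t ^ 2 - 4 * t) * \<bar>W\<bar>"
    using t by (simp add: abs_mult)
  ultimately have "\<bar>W\<bar> < 3" by linarith
  then have "\<bar>w\<bar> < 3" unfolding W_def by linarith
  then have w: "- 2 \<le> w" "w \<le> 2" "\<bar>W\<bar> \<le> 2" unfolding W_def by linarith+
  have "\<bar>(2 - t) * W\<bar> \<le> (284 / 100) * 2"
    unfolding abs_mult using t w by (intro mult_mono) auto
  then have "\<bar>V\<bar> < 10" using s unfolding s_def by linarith
  then have "\<bar>v\<bar> < 10" unfolding V_def by linarith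
  then have v: "- 9 \<le> v" "v \<le> 9" "\<bar>V\<bar> \<le> 9" unfolding V_def by linarith+
  have "\<bar>V * t\<bar> \<le> 9 * (84 / 100)" "\<bar>W * t ^ 2\<bar> \<le> 2 * (7056 / 10000)"
    unfolding abs_mult using v w t by (intro mult_mono; auto)+
  then have "\<bar>U\<bar> < 14" using h unfolding heq by linarith
  then have "\<bar>u\<bar> < 14" unfolding U_def by linarith
  then have u: "- 13 \<le> u" "u \<le> 13" by linarith+
  have "(u, v, w) \<in> set [(1, 0, 0), (1, 0, -1), (1, -2, 1), (-1, -1, 1), (1, -1, 0),
      (-3, -2, 2), (1, 1, 0), (1, 2, 1), (3, -3, 1), (5, -6, 2)]"
    using u v w norm unfolding a
    by (intro small_cubic_norm_1 [rule_format]) (simp_all only: set_upto atLeastAtMost_iff)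
  \<comment> \<open>The other five norm-1 elements have real embeddings below 0.18 or above
    4.71.\<close>
  moreover have "(u, v, w) \<notin> set [(-3, -2, 2), (1, 1, 0), (1, 2, 1), (3, -3, 1), (5, -6, 2)]"
    using h t unfolding heq U_def V_def W_def by auto
  ultimately show ?thesis
    unfolding a by auto
qed

text \<open>
  The lattice of all \<open>\<gamma>\<close> that vanish modulo \<open>n\<close> under \<open>\<omega> \<mapsto> r\<close> has index \<open>n\<close>, and \<open>\<gamma>\<^sup>2\<close> is divisible by
  \<open>\<beta>\<close>. On it the form \<open>|\<eta>| + 2|\<eta>'|\<close>, where \<open>\<eta> = \<gamma>\<^sup>2 / \<beta>\<close> and \<open>\<eta>'\<close> is a complex conjugate, has determinant
  44, so Hermite's bound and the inequality of means give some \<open>\<gamma>\<close> for which the norm of \<open>\<eta>\<close>, a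
  square, is less than 4.
\<close>

lemma ex_square_eq_mult_unit:
  assumes n: "n > 0" and norm: "cubic_norm \<beta> = n ^ 2" and r: "\<beta> dvd Cub 0 1 0 - of_int r"
  obtains \<gamma> \<eta> where "\<gamma> ^ 2 = \<beta> * \<eta>"
    "\<eta> \<in> {Cub 1 0 0, Cub 1 0 (- 1), Cub 1 (- 2) 1, Cub (- 1) (- 1) 1, Cub 1 (- 1) 0}"
proof -
  define t where "t = cubic_root"
  have t: "- (84 / 100) < t" "t < - (839 / 1000)" "(7039 / 10000) < t ^ 2" "t ^ 2 < (7056 / 10000)"
    and t3: "t ^ 3 = 2 * t ^ 2 - 2"
    using cubic_root cubic_root_square by (auto simp: t_def)
  \<comment> \<open>The element n x + (\<omega> - r) y + (\<omega>^2 - r^2) z of the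
    lattice.\<close>
  define \<gamma> where "\<gamma> = (\<lambda>x y z. Cub (n * x - r * y - r ^ 2 * z) y z)"
  define b where "b = cubic_real \<beta>"
  define N where "N = real_of_int n"
  define R where "R = real_of_int r"
  have N: "N > 0" using n by (simp add: N_def)
  have bc: "b * cubic_abs2 \<beta> = N ^ 2"
    using cubic_real_mult_abs2 [of \<beta>] norm by (simp add: b_def N_def)
  have b: "b > 0"
  proof (rule ccontr)
    assume "\<not> b > 0"
    then have "b * cubic_abs2 \<beta> \<le> 0"
      using cubic_abs2_nonneg [of \<beta>] by (simp add: mult_nonpos_nonneg)
    then show False using bc N by simp
  qed
  \<comment> \<open>The weights that turn the embeddings of \<gamma> into the absolute values of
    \<eta> = \<gamma>^2 / \<beta> at the real place (\<open>p\<close>) and at the complex place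
    (\<open>q\<close>).\<close>
  define p where "p = 1 / b"
  define q where "q = sqrt b / N"
  have p: "p > 0" and q: "q > 0" and q2: "q ^ 2 = b / N ^ 2"
    using b N by (simp_all add: p_def q_def power_divide)
  have pq: "p * q ^ 2 * N ^ 2 = 1" using b N by (simp add: p_def q2)
  \<comment> \<open>\<open>A\<close> to \<open>F\<close> are the Gram entries of the weighted form
    in the basis 1, \<omega>, \<omega>^2; \<open>a'\<close> to \<open>f'\<close> those in the
    lattice basis n, \<omega> - r, \<omega>^2 - r^2.\<close>
  define A where "A = p + 2 * q"
  define B where "B = p * t ^ 2 + 2 * q * (t ^ 2 - 2 * t)"
  define C where "C = p * t ^ 4 + 2 * q * (4 - 2 * t)"
  define D where "D = p * t ^ 3 + q * (2 * t ^ 2 - 4 * t + 2)"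
  define E where "E = p * t ^ 2 + q * (4 - t ^ 2)"
  define F where "F = p * t + q * (2 - t)"
  define a' where "a' = N ^ 2 * A"
  define b' where "b' = R ^ 2 * A - 2 * R * F + B"
  define c' where "c' = R ^ 4 * A - 2 * R ^ 2 * E + C"
  define d' where "d' = R ^ 3 * A - R * E - R ^ 2 * F + D"
  define e' where "e' = N * (E - R ^ 2 * A)"
  define f' where "f' = N * (F - R * A)"
  have tern: "ternary a' b' c' d' e' f' x y z
    = p * cubic_real (\<gamma> x y z) ^ 2 + 2 * q * cubic_abs2 (\<gamma> x y z)" for x y z
    unfolding ternary_def a'_def b'_def c'_def d'_def e'_def f'_def A_def B_def C_def D_def E_def F_def
      \<gamma>_def cubic_abs2_def cubic_adj.simps cubic_real.simps N_def [symmetric] R_def [symmetric]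
      t_def [symmetric]
    unfolding of_int_add of_int_diff of_int_mult of_int_power of_int_minus of_int_numeral
      N_def [symmetric] R_def [symmetric]
    by algebra
  have "A > 0" using p q by (simp add: A_def)
  then have a': "a' > 0" using N by (simp add: a'_def)
  have "A * B - F ^ 2 = p * q * (6 * t ^ 2 - 8 * t) + q ^ 2 * (3 * t ^ 2 - 4 * t - 4)"
    unfolding A_def B_def F_def by algebra
  also have "\<dots> > 0" using p q t by (intro add_pos_pos mult_pos_pos) auto
  finally have "N ^ 2 * (A * B - F ^ 2) > 0" using N by simp
  also have "N ^ 2 * (A * B - F ^ 2) = a' * b' - f' ^ 2"
    unfolding a'_def b'_def f'_def by algebra
  finally have minor: "a' * b' - f' ^ 2 > 0" .
  have "ternary_det A B C D E F
    = p * q ^ 2 * (44 + (t ^ 3 - 2 * t ^ 2 + 2) * (8 * t ^ 3 - 16 * t ^ 2 - 16 * t - 24))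
      + q ^ 3 * ((t ^ 3 - 2 * t ^ 2 + 2) * (- 2 * t ^ 3 + 4 * t ^ 2 - 4))"
    unfolding ternary_det_def A_def B_def C_def D_def E_def F_def by algebra
  then have "ternary_det A B C D E F = 44 * (p * q ^ 2)"
    using t3 by simp
  moreover have "ternary_det a' b' c' d' e' f' = N ^ 2 * ternary_det A B C D E F"
    unfolding ternary_det_def a'_def b'_def c'_def d'_def e'_def f'_def by algebra
  ultimately have det: "ternary_det a' b' c' d' e' f' = 44"
    using pq by (simp add: mult_ac)
  obtain x y z where xyz: "(x, y, z) \<noteq> (0, 0, 0)"
    and le: "27 * ternary a' b' c' d' e' f' x y z ^ 3 \<le> 64 * 44"
    using hermite_ternary [OF a' minor, of c' d' e'] unfolding det by auto
  define g where "g = \<gamma> x y z"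
  have "g \<noteq> 0"
    using xyz n unfolding g_def \<gamma>_def zero_cubic_int_def by auto
  then have gn: "cubic_norm g \<noteq> 0" using cubic_norm_eq_0 by blast
  obtain \<kappa> where \<kappa>: "Cub 0 1 0 - of_int r = \<beta> * \<kappa>" using r by (rule dvdE)
  \<comment> \<open>A lattice element is a multiple of n plus a multiple of \<beta>. As \<beta>
    divides n^2, the norm of \<beta>, it divides every term of the expanded square.\<close>
  have g: "g = of_int (n * x) + \<beta> * (\<kappa> * (of_int y + of_int z * (Cub 0 1 0 + of_int r)))"
    (is "_ = _ + \<beta> * ?l")
  proof -
    have "g = of_int (n * x) + (Cub 0 1 0 - of_int r) * (of_int y + of_int z * (Cub 0 1 0 + of_int r))"
      unfolding g_def \<gamma>_def of_int_cubic_int by (simp add: algebra_simps power2_eq_square)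
    then show ?thesis unfolding \<kappa> by (simp add: mult.assoc)
  qed
  have "of_int (n ^ 2) = \<beta> * cubic_adj \<beta>" using cubic_mult_adj [of \<beta>] norm by simp
  then have n2: "(of_int n :: cubic_int) ^ 2 = \<beta> * cubic_adj \<beta>" by simp
  have "g ^ 2 = (of_int n) ^ 2 * of_int x ^ 2 + \<beta> * (2 * of_int (n * x) * ?l + \<beta> * ?l ^ 2)"
    unfolding g by (simp add: power2_eq_square algebra_simps)
  also have "\<dots> = \<beta> * (cubic_adj \<beta> * of_int x ^ 2 + (2 * of_int (n * x) * ?l + \<beta> * ?l ^ 2))"
    unfolding n2 by (simp only: distrib_left mult.assoc)
  finally obtain \<eta> where \<eta>: "g ^ 2 = \<beta> * \<eta>" by blast
  define h where "h = cubic_real \<eta>"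
  define s where "s = q * cubic_abs2 g"
  have "cubic_real g ^ 2 = b * h"
    using \<eta> unfolding h_def b_def power2_eq_square by (simp flip: cubic_real_mult)
  then have h: "p * cubic_real g ^ 2 = h" using b by (simp add: p_def)
  have "cubic_abs2 g ^ 2 = cubic_abs2 \<beta> * cubic_abs2 \<eta>"
    using \<eta> unfolding power2_eq_square by (simp flip: cubic_abs2_mult)
  then have "s ^ 2 = q ^ 2 * (cubic_abs2 \<beta> * cubic_abs2 \<eta>)"
    by (simp add: s_def power_mult_distrib)
  also have "\<dots> = (b * cubic_abs2 \<beta>) / N ^ 2 * cubic_abs2 \<eta>"
    by (simp add: q2)
  also have "\<dots> = cubic_abs2 \<eta>" using N by (simp add: bc)
  finally have s2: "s ^ 2 = cubic_abs2 \<eta>" .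
  have s0: "s \<ge> 0" using q cubic_abs2_nonneg [of g] by (simp add: s_def)
  have h0: "h \<ge> 0" using h p zero_le_power2 [of "cubic_real g"] by (metis mult_nonneg_nonneg less_imp_le)
  have hs: "h * s ^ 2 = of_int (cubic_norm \<eta>)"
    unfolding s2 h_def by (rule cubic_real_mult_abs2)
  have "27 * (h + 2 * s) ^ 3 \<le> 64 * 44"
    using le unfolding tern g_def [symmetric] h s_def by (simp add: mult.assoc)
  then have bound: "(h + 2 * s) ^ 3 \<le> 64 * 44 / 27" by simp
  have "(h + 2 * s) ^ 3 - 27 * (h * s ^ 2) = (h - s) ^ 2 * (h + 8 * s)"
    by algebra
  also have "\<dots> \<ge> 0" using h0 s0 by simp
  finally have "27 * (h * s ^ 2) \<le> 64 * 44 / 27" using bound by linarith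
  then have N4: "cubic_norm \<eta> < 4" unfolding hs by linarith
  have "cubic_norm g ^ 2 = n ^ 2 * cubic_norm \<eta>"
    using \<eta> norm unfolding power2_eq_square by (metis cubic_norm_mult)
  moreover from this have "n dvd cubic_norm g"
    by (metis dvd_triv_left pow_divides_pow_iff zero_less_numeral)
  then obtain m where m: "cubic_norm g = n * m" by (rule dvdE)
  ultimately have "n ^ 2 * cubic_norm \<eta> = (n * m) ^ 2" by metis
  then have "n ^ 2 * cubic_norm \<eta> = n ^ 2 * m ^ 2" by (simp only: power_mult_distrib)
  then have N\<eta>: "cubic_norm \<eta> = m ^ 2" using n by auto
  have "m \<noteq> 0" using m gn by auto
  have "\<bar>m\<bar> < 2"
  proof (rule ccontr)
    assume "\<not> \<bar>m\<bar> < 2"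
    then have "2 ^ 2 \<le> \<bar>m\<bar> ^ 2" by (intro power_mono) auto
    then show False using N4 N\<eta> by simp
  qed
  then have "m = 1 \<or> m = - 1" using \<open>m \<noteq> 0\<close> by linarith
  then have norm1: "cubic_norm \<eta> = 1" using N\<eta> by auto
  \<comment> \<open>The number 4.71 lies just above the cube root of 64 * 44 / 27. Its half bounds
    \<open>s\<close>, 5.55 exceeds the square of that half, and h s^2 = 1 then gives h >
    0.18.\<close>
  have "h + 2 * s \<le> (471 / 100)"
  proof (rule ccontr)
    assume "\<not> h + 2 * s \<le> (471 / 100)"
    then have "(471 / 100) ^ 3 < (h + 2 * s) ^ 3" by (intro power_strict_mono) auto
    then show False using bound by (simp add: power3_eq_cube)
  qed
  then have h': "h \<le> (471 / 100)" and s': "s \<le> (2355 / 1000)" using h0 s0 by auto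
  have "s ^ 2 \<le> (2355 / 1000) ^ 2" using s0 s' by (intro power_mono)
  then have c: "cubic_abs2 \<eta> \<le> (555 / 100)" unfolding s2 [symmetric] by (simp add: power2_eq_square)
  have "h * s ^ 2 \<le> h * (555 / 100)" using c h0 s2 by (intro mult_left_mono) auto
  then have "h > (18 / 100)" using hs norm1 by simp
  then have "\<eta> \<in> {Cub 1 0 0, Cub 1 0 (- 1), Cub 1 (- 2) 1, Cub (- 1) (- 1) 1, Cub 1 (- 1) 0}"
    using small_cubic_unit [OF norm1] h' c unfolding h_def by blast
  with \<eta> show ?thesis by (rule that)
qed

lemma dvd_if_coprime_mult_dvd:
  fixes b z :: "'a::comm_ring_1" and m k :: int
  assumes "b dvd of_int m * z" and "b dvd of_int k * z" and "coprime m k"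
  shows "b dvd z"
proof -
  obtain i j where "i * m + j * k = 1"
    using assms(3) by (metis bezout_int coprime_imp_gcd_eq_1)
  have "of_int i * (of_int m * z) + of_int j * (of_int k * z) = of_int (i * m + j * k) * z"
    by (simp add: algebra_simps)
  also have "\<dots> = z" using \<open>i * m + j * k = 1\<close> by simp
  finally show ?thesis
    using dvd_add [OF dvd_mult dvd_mult, OF assms(1,2)] by metis
qed

text \<open>Since (2 \<omega> - \<omega>^2)^2 = 4 - 2 \<omega>, multiplying the given element by s^2
  + r (2 \<omega> - \<omega>^2) shows that 2 r^2 \<omega> is congruent to 4 r^2 - s^4 modulo
  \<beta>. The integer 2 r^2 is invertible modulo n^2, hence modulo \<beta>.\<close>

lemma cubic_residue:
  assumes cop: "coprime r n" "odd n" and norm: "cubic_norm \<beta> = n ^ 2"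
    and dvd: "\<beta> dvd of_int (s ^ 2) - of_int r * Cub 0 2 (- 1)"
  obtains m where "\<beta> dvd Cub 0 1 0 - of_int m"
proof -
  have "coprime (2 * r ^ 2) (n ^ 2)" using cop by (simp add: coprime_commute)
  then obtain i j where ij: "i * (2 * r ^ 2) + j * n ^ 2 = 1"
    by (metis bezout_int coprime_imp_gcd_eq_1)
  define m where "m = i * (4 * r ^ 2 - s ^ 4)"
  have n2: "\<beta> dvd of_int (n ^ 2)"
    using cubic_mult_adj [of \<beta>] norm by (metis dvd_triv_left)
  have m: "2 * r ^ 2 * m = (4 * r ^ 2 - s ^ 4) - n ^ 2 * (j * (4 * r ^ 2 - s ^ 4))"
  proof -
    have "2 * r ^ 2 * m = (i * (2 * r ^ 2)) * (4 * r ^ 2 - s ^ 4)"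
      by (simp add: m_def)
    also have "i * (2 * r ^ 2) = 1 - j * n ^ 2" using ij by simp
    finally show ?thesis by (simp add: algebra_simps)
  qed
  have "of_int (2 * r ^ 2) * (Cub 0 1 0 - of_int m)
    = (of_int (s ^ 2) - of_int r * Cub 0 2 (- 1)) * (of_int (s ^ 2) + of_int r * Cub 0 2 (- 1))
      + of_int (n ^ 2) * of_int (j * (4 * r ^ 2 - s ^ 4))"
  proof -
    have "of_int (2 * r ^ 2) * (Cub 0 1 0 - of_int m)
        = of_int (2 * r ^ 2) * Cub 0 1 0 - of_int (2 * r ^ 2 * m)"
      by (simp add: right_diff_distrib)
    then show ?thesis
      unfolding \<open>_ = _ - of_int (2 * r ^ 2 * m)\<close> m
      by (simp add: of_int_cubic_int algebra_simps eval_nat_numeral)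
  qed
  then have "\<beta> dvd of_int (2 * r ^ 2) * (Cub 0 1 0 - of_int m)"
    using dvd n2 by (simp only: dvd_add dvd_mult2)
  moreover have "\<beta> dvd of_int (n ^ 2) * (Cub 0 1 0 - of_int m)"
    using n2 by (rule dvd_mult2)
  ultimately have "\<beta> dvd Cub 0 1 0 - of_int m"
    using \<open>coprime (2 * r ^ 2) (n ^ 2)\<close> by (rule dvd_if_coprime_mult_dvd)
  then show ?thesis by (rule that)
qed

text \<open>
  \<open>Cub (- 1) (- 1) 1\<close> generates the units modulo squares and sign. The obstruction is 2-adic.
\<close>

lemma not_fundamental_unit_mult_square:
  assumes "coprime r s" and eq: "Cub (s ^ 2) (- 2 * r) r = Cub (- 1) (- 1) 1 * g ^ 2"
  shows False
proof -
  obtain u v w where g: "g = Cub u v w" by (cases g)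
  define a where "a = u ^ 2 - 4 * v * w - 4 * w ^ 2"
  define b where "b = 2 * u * v - 2 * w ^ 2"
  define c where "c = v ^ 2 + 2 * u * w + 4 * v * w + 4 * w ^ 2"
  have "g ^ 2 = Cub a b c"
    by (simp add: g a_def b_def c_def power2_eq_square algebra_simps)
  then have "s ^ 2 = - a - 2 * b - 2 * c" "- 2 * r = - a - b - 2 * c" "r = a + b + c"
    using eq by simp_all
  then have ab: "b = - a" and rc: "r = c" and sa: "s ^ 2 = a - 2 * c" by simp_all
  have "u ^ 2 = 2 * (w ^ 2 - u * v + 2 * v * w + 2 * w ^ 2)"
    using ab unfolding a_def b_def by simp
  then have "even (u ^ 2)" by (metis dvd_triv_left)
  then obtain u' where u: "u = 2 * u'" by auto
  have "w ^ 2 = 2 * (u' ^ 2 + u' * v - v * w - w ^ 2)"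
    using ab unfolding a_def b_def u by (simp add: power_mult_distrib)
  then have "even (w ^ 2)" by (metis dvd_triv_left)
  then obtain w' where w: "w = 2 * w'" by auto
  have "s ^ 2 = 2 * (2 * u' ^ 2 - 4 * v * w' - 8 * w' ^ 2 - v ^ 2 - 8 * u' * w' - 8 * v * w' - 16 * w' ^ 2)"
    using sa unfolding a_def c_def u w by (simp add: power_mult_distrib)
  then have "even (s ^ 2)" by (metis dvd_triv_left)
  then obtain s' where s: "s = 2 * s'" by auto
  have "v ^ 2 = 2 * (u' ^ 2 - 2 * v * w' - 4 * w' ^ 2 - 4 * u' * w' - 4 * v * w' - 8 * w' ^ 2 - s' ^ 2)"
    using sa unfolding a_def c_def u w s by (simp add: power_mult_distrib)
  then have "even (v ^ 2)" by (metis dvd_triv_left)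
  then have "even c" unfolding c_def by auto
  then have "even r" using rc by simp
  then show False using assms(1) s by (meson coprime_common_divisor dvd_triv_left odd_one)
qed

section \<open>The curve of conductor 11\<close>

text \<open>The element \<open>?B\<close> equals s^2 - 2 r / \<omega>, because \<omega> (2 \<omega>
  - \<omega>^2) = 2; for X = r / s^2 it is X - \<omega> / 2 up to the factor -2 s^2 / \<omega>, and
  \<omega> / 2 is the abscissa of a 2-torsion point. Its norm is t^2.\<close>

lemma cubic_square_times_unit:
  assumes cop: "coprime r s" and t: "t ^ 2 = 4 * r ^ 3 - 4 * r ^ 2 * s ^ 2 + s ^ 6"
  obtains \<gamma> \<eta> where "\<gamma> ^ 2 = Cub (s ^ 2) (- 2 * r) r * \<eta>"
    "\<eta> \<in> {Cub 1 0 0, Cub 1 0 (- 1), Cub 1 (- 2) 1, Cub (- 1) (- 1) 1, Cub 1 (- 1) 0}"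
proof -
  let ?B = "Cub (s ^ 2) (- 2 * r) r"
  have B: "of_int (s ^ 2) - of_int r * Cub 0 2 (- 1) = ?B"
    by (simp add: of_int_cubic_int)
  have "coprime r (r * (4 * r ^ 2 - 4 * r * s ^ 2) + s ^ 6)"
    by (rule coprime_mult_add_int) (use cop in simp)
  also have "r * (4 * r ^ 2 - 4 * r * s ^ 2) + s ^ 6 = t ^ 2"
    unfolding t by algebra
  finally have rt: "coprime r t" by simp
  show ?thesis
  proof (cases "even s")
    case False
    then have "odd (t ^ 2)" unfolding t by simp
    then have "odd \<bar>t\<bar>" by simp
    then have "\<bar>t\<bar> > 0" by (metis abs_ge_zero dvd_0_right order_le_less)
    have norm: "cubic_norm ?B = \<bar>t\<bar> ^ 2"
      unfolding power2_abs t by simp algebra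
    have dvd: "?B dvd of_int (s ^ 2) - of_int r * Cub 0 2 (- 1)"
      unfolding B by (rule dvd_refl)
    have "coprime r \<bar>t\<bar>" using rt by simp
    then obtain m where m: "?B dvd Cub 0 1 0 - of_int m"
      using cubic_residue [OF _ \<open>odd \<bar>t\<bar>\<close> norm dvd] by blast
    show ?thesis
      by (rule ex_square_eq_mult_unit [OF \<open>\<bar>t\<bar> > 0\<close> norm m]) (rule that)
  next
    case True
    then obtain s' where s: "s = 2 * s'" by auto
    have "odd r" using cop True by (metis coprime_common_divisor odd_one)
    have t4: "t ^ 2 = 4 * (r ^ 3 - 4 * r ^ 2 * s' ^ 2 + 16 * s' ^ 6)"
      unfolding t s by algebra
    then have "even (t ^ 2)" by simp
    then obtain t' where t': "t = 2 * t'" by auto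
    have t'2: "t' ^ 2 = r ^ 3 - 4 * r ^ 2 * s' ^ 2 + 16 * s' ^ 6"
      using t4 unfolding t' by (simp add: power_mult_distrib)
    then have "odd (t' ^ 2)" using \<open>odd r\<close> by simp
    then have "odd \<bar>t'\<bar>" by simp
    then have "\<bar>t'\<bar> > 0" by (metis abs_ge_zero dvd_0_right order_le_less)
    \<comment> \<open>For even \<open>s\<close> the norm of \<open>?B\<close> is even. Dividing by
      \<omega>^2, which has norm 4, leaves an element of odd norm, as \<open>cubic_residue\<close>
      requires.\<close>
    define \<beta> where "\<beta> = Cub (4 * s' ^ 2 + r) (- 2 * s' ^ 2 - 2 * r) r"
    have norm: "cubic_norm \<beta> = \<bar>t'\<bar> ^ 2"
      unfolding power2_abs t'2 \<beta>_def by simp algebra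
    have \<beta>: "Cub 0 1 0 ^ 2 * \<beta> = ?B"
      unfolding \<beta>_def s by (simp add: power2_eq_square)
    then have dvd: "\<beta> dvd of_int (s ^ 2) - of_int r * Cub 0 2 (- 1)"
      unfolding B by (metis dvd_triv_right)
    have "coprime r \<bar>t'\<bar>" using rt t' by simp
    then obtain m where m: "\<beta> dvd Cub 0 1 0 - of_int m"
      using cubic_residue [OF _ \<open>odd \<bar>t'\<bar>\<close> norm dvd] by blast
    obtain \<gamma> \<eta> where g: "\<gamma> ^ 2 = \<beta> * \<eta>"
      "\<eta> \<in> {Cub 1 0 0, Cub 1 0 (- 1), Cub 1 (- 2) 1, Cub (- 1) (- 1) 1, Cub 1 (- 1) 0}"
      by (rule ex_square_eq_mult_unit [OF \<open>\<bar>t'\<bar> > 0\<close> norm m])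
    have "(Cub 0 1 0 * \<gamma>) ^ 2 = ?B * \<eta>"
      unfolding power_mult_distrib g(1) \<beta> [symmetric] by (simp only: mult.assoc)
    then show ?thesis using g(2) by (rule that)
  qed
qed

lemma cubic_square:
  assumes cop: "coprime r s" and t: "t ^ 2 = 4 * r ^ 3 - 4 * r ^ 2 * s ^ 2 + s ^ 6"
  obtains g where "Cub (s ^ 2) (- 2 * r) r = g ^ 2"
proof -
  let ?B = "Cub (s ^ 2) (- 2 * r) r" and ?k = "Cub (- 1) (- 1) 1" and ?l = "Cub 1 (- 1) 0"
  obtain \<gamma> \<eta> where g: "\<gamma> ^ 2 = ?B * \<eta>"
    and \<eta>: "\<eta> \<in> {Cub 1 0 0, Cub 1 0 (- 1), Cub 1 (- 2) 1, ?k, ?l}"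
    by (rule cubic_square_times_unit [OF assms])
  have kl: "?k * ?l = 1" by (simp add: one_cubic_int_def)
  have k2: "Cub 1 0 (- 1) = ?k ^ 2" and l2: "Cub 1 (- 2) 1 = ?l ^ 2"
    by (simp_all add: power2_eq_square)
  have B: "?B = \<gamma> ^ 2 * z" if "\<eta> * z = 1" for z
    unfolding g using that by (simp add: mult.assoc)
  consider "\<eta> = 1" | "\<eta> = ?k ^ 2" | "\<eta> = ?l ^ 2" | "\<eta> = ?k" | "\<eta> = ?l"
    using \<eta> unfolding one_cubic_int_def k2 l2 by blast
  then show ?thesis
  proof cases
    case 1
    then show ?thesis using B [of 1] that [of \<gamma>] by simp
  next
    case 2
    have "?B = (\<gamma> * ?l) ^ 2"
      unfolding power_mult_distrib by (rule B) (simp only: 2 kl power_one flip: power_mult_distrib)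
    then show ?thesis by (rule that)
  next
    case 3
    have "?B = (\<gamma> * ?k) ^ 2"
      unfolding power_mult_distrib
      by (rule B) (simp only: 3 kl power_one mult.commute [of ?l] flip: power_mult_distrib)
    then show ?thesis by (rule that)
  next
    case 4
    have "?B = \<gamma> ^ 2 * ?l" by (rule B) (simp only: 4 kl)
    also have "?l = ?k * ?l ^ 2" by (simp add: power2_eq_square)
    finally have "?B = ?k * (\<gamma> * ?l) ^ 2" by (simp only: power_mult_distrib mult_ac)
    then show ?thesis using not_fundamental_unit_mult_square [OF cop] by blast
  next
    case 5
    have "?B = \<gamma> ^ 2 * ?k" by (rule B) (simp only: 5 kl mult.commute [of ?l])
    then have "?B = ?k * \<gamma> ^ 2" by (simp only: mult.commute)
    then show ?thesis using not_fundamental_unit_mult_square [OF cop] by blast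
  qed
qed

text \<open>The leading coefficient 4 hides that denominators are squares. With Y = 2 y + 1 the
  equation becomes y^2 + y = X^3 - X^2, and \<open>z\<close> is q^2 y; the gcd of z and q proves to
  be the square root of q.\<close>

lemma curve11_parametrize:
  fixes X Y :: rat
  assumes c: "Y ^ 2 = 4 * X ^ 3 - 4 * X ^ 2 + 1"
  obtains r s t where "X = of_int r / of_int s ^ 2" "s > 0" "coprime r s"
    "t ^ 2 = 4 * r ^ 3 - 4 * r ^ 2 * s ^ 2 + s ^ 6"
proof -
  obtain p q where pq: "X = of_int p / of_int q" "q > 0" "coprime p q"
    by (metis quotient_ofE)
  have "of_int (q ^ 4 + 4 * (q * p ^ 2 * (p - q))) = (Y * of_int q ^ 2) ^ 2"
    unfolding power_mult_distrib c pq(1) using pq(2) by (simp add: field_simps eval_nat_numeral)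
  then obtain T where T: "q ^ 4 + 4 * (q * p ^ 2 * (p - q)) = T ^ 2"
    by (rule rat_square_imp_int_square)
  have "even (T ^ 2 - q ^ 4)" unfolding T [symmetric] by simp
  then have "even (T - q ^ 2)" by simp
  then obtain z where "T - q ^ 2 = 2 * z" by (rule dvdE)
  then have Tz: "T = 2 * z + q ^ 2" by simp
  have z: "z * (z + q ^ 2) = q * p ^ 2 * (p - q)"
    using T unfolding Tz by algebra
  define g where "g = gcd z q"
  have g: "g > 0" using pq(2) by (simp add: g_def)
  obtain z' q' where z': "z = g * z'" and q': "q = g * q'" and cop: "coprime z' q'"
    unfolding g_def using gcd_coprime_exists [of z q] pq(2) by (auto simp: mult.commute)
  have "g * (g * (z' * (z' + q' * (g * q')))) = g * (q' * (p ^ 2 * (p - q)))"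
    using z unfolding z' q' by algebra
  then have eq: "g * (z' * (z' + q' * (g * q'))) = q' * (p ^ 2 * (p - q))"
    using g by simp
  have "coprime q' (q' * (g * q') + z')"
    by (rule coprime_mult_add_int) (use cop in \<open>simp add: coprime_commute\<close>)
  then have "coprime q' (z' * (z' + q' * (g * q')))"
    using cop by (simp add: coprime_commute add.commute)
  moreover have "q' dvd g * (z' * (z' + q' * (g * q')))" unfolding eq by simp
  ultimately have "q' dvd g" by (simp add: coprime_dvd_mult_left_iff)
  have "coprime q (q * (- 1) + p)"
    by (rule coprime_mult_add_int) (use pq(3) in \<open>simp add: coprime_commute\<close>)
  then have "coprime q (p ^ 2 * (p - q))"
    using pq(3) by (simp add: coprime_commute)
  then have "coprime g (p ^ 2 * (p - q))"
    unfolding q' by simp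
  moreover have "g dvd q' * (p ^ 2 * (p - q))" unfolding eq [symmetric] by simp
  ultimately have "g dvd q'" by (simp add: coprime_dvd_mult_left_iff)
  have "q' > 0" using g pq(2) q' by (simp add: zero_less_mult_iff)
  then have "q' = g"
    using \<open>q' dvd g\<close> \<open>g dvd q'\<close> g by (simp add: zdvd_antisym_nonneg)
  then have qg: "q = g ^ 2" using q' by (simp add: power2_eq_square)
  show ?thesis
  proof (rule that [of p g "2 * z' + g ^ 3"])
    show "X = of_int p / of_int g ^ 2" using pq(1) qg by simp
    show "g > 0" by (rule g)
    show "coprime p g" using pq(3) qg by simp
    have "g ^ 2 * (2 * z' + g ^ 3) ^ 2 = T ^ 2"
      unfolding Tz z' qg by algebra
    also have "\<dots> = g ^ 2 * (4 * p ^ 3 - 4 * p ^ 2 * g ^ 2 + g ^ 6)"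
      unfolding T [symmetric] qg by algebra
    finally show "(2 * z' + g ^ 3) ^ 2 = 4 * p ^ 3 - 4 * p ^ 2 * g ^ 2 + g ^ 6"
      using g by simp
  qed
qed

lemma curve11_halving:
  fixes x y :: rat
  assumes P: "Affine x y \<in> ec_points (- 432) 8208"
  shows "\<exists>Q \<in> ec_points (- 432) 8208. ec_add (- 432) Q Q = Affine x y"
proof -
  define X where "X = (x + 12) / 36"
  define Y where "Y = y / 108"
  have xy: "x = 36 * X - 12" "y = 108 * Y" by (simp_all add: X_def Y_def field_simps)
  have "Y ^ 2 = 4 * X ^ 3 - 4 * X ^ 2 + 1"
    using P unfolding Affine_in_ec_points xy by algebra
  then obtain r s t where X: "X = of_int r / of_int s ^ 2" and "s > 0" and cop: "coprime r s"
    and t: "t ^ 2 = 4 * r ^ 3 - 4 * r ^ 2 * s ^ 2 + s ^ 6"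
    by (rule curve11_parametrize)
  obtain g where g: "Cub (s ^ 2) (- 2 * r) r = g ^ 2"
    by (rule cubic_square [OF cop t])
  \<comment> \<open>As (2 - \<omega>^2)^2 = -2 \<omega>, this factor turns the square
    \<open>g ^ 2\<close> into 4 r - 2 s^2 \<omega> = 4 s^2 (X - \<omega> / 2), the usual descent
    value, which has no \<omega>^2 term.\<close>
  obtain h0 h1 h2 where h: "g * Cub 2 0 (- 1) = Cub h0 h1 h2"
    by (cases "g * Cub 2 0 (- 1)")
  have "Cub h0 h1 h2 ^ 2 = Cub (s ^ 2) (- 2 * r) r * Cub 2 0 (- 1) ^ 2"
    unfolding h [symmetric] g power_mult_distrib ..
  then have eqs: "h0 ^ 2 - 4 * h1 * h2 - 4 * h2 ^ 2 = 4 * r" "h0 * h1 - h2 ^ 2 = - (s ^ 2)"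
    "h1 ^ 2 + 2 * h0 * h2 + 4 * h1 * h2 + 4 * h2 ^ 2 = 0"
    by (simp_all add: power2_eq_square algebra_simps)
  have "h2 \<noteq> 0"
    using eqs(2,3) \<open>s > 0\<close> by auto
  define H0 H1 H2 S R :: rat where "H0 = of_int h0" and "H1 = of_int h1" and "H2 = of_int h2"
    and "S = of_int s" and "R = of_int r"
  have H: "H0 ^ 2 - 4 * H1 * H2 - 4 * H2 ^ 2 = 4 * R" "H0 * H1 - H2 ^ 2 = - (S ^ 2)"
    "H1 ^ 2 + 2 * H0 * H2 + 4 * H1 * H2 + 4 * H2 ^ 2 = 0" "H2 \<noteq> 0" "S \<noteq> 0"
    using eqs [THEN arg_cong [of _ _ rat_of_int]] \<open>h2 \<noteq> 0\<close> \<open>s > 0\<close>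
    by (simp_all add: H0_def H1_def H2_def S_def R_def)
  \<comment> \<open>Divided by \<open>H2\<close>, the square root becomes -d^2 / 2 + (d - 2)
    \<omega> + \<omega>^2, the constant term being forced by the vanishing \<omega>^2 coefficient of
    the square. The half of the point is, up to sign, (18 d - 12, 108 \<sigma>).\<close>
  define d where "d = (H1 + 2 * H2) / H2"
  define \<sigma> where "\<sigma> = S / H2"
  define \<rho> where "\<rho> = R / H2 ^ 2"
  have H1: "H1 = (d - 2) * H2" and SH: "S = \<sigma> * H2" and RH: "R = \<rho> * H2 ^ 2"
    using H(4) by (simp_all add: d_def \<sigma>_def \<rho>_def field_simps)
  have "H2 * (2 * H0 + d ^ 2 * H2) = 0"
    using H(3) unfolding H1 by algebra
  then have "2 * H0 + d ^ 2 * H2 = 0" using H(4) by (metis mult_eq_0_iff)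
  then have H0: "H0 = - (d ^ 2 / 2) * H2" by (simp add: field_simps add_eq_0_iff2)
  have "H2 ^ 2 * (2 * \<sigma> ^ 2 - (d ^ 3 - 2 * d ^ 2 + 2)) = 0"
    using H(2) unfolding SH H0 H1 by (simp add: field_simps power2_eq_square power3_eq_cube)
  then have \<sigma>: "2 * \<sigma> ^ 2 = d ^ 3 - 2 * d ^ 2 + 2" using H(4) by simp
  have "H2 ^ 2 * (16 * \<rho> - (d ^ 4 - 16 * d + 16)) = 0"
    using H(1) unfolding RH H0 H1 by (simp add: field_simps power2_eq_square power4_eq_xxxx)
  then have \<rho>: "16 * \<rho> = d ^ 4 - 16 * d + 16" using H(4) by simp
  have \<sigma>0: "\<sigma> \<noteq> 0" using H(4,5) by (simp add: \<sigma>_def)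
  define m where "m = 3 * (3 * d ^ 2 / 2 - 2 * d) / \<sigma>"
  have m: "m * \<sigma> = 9 * d ^ 2 / 2 - 6 * d" using \<sigma>0 by (simp add: m_def)
  have Q: "Affine (18 * d - 12) (108 * \<sigma>) \<in> ec_points (- 432) 8208"
    unfolding Affine_in_ec_points using \<sigma> by algebra
  have "line_rel (- 432) m (18 * d - 12) (108 * \<sigma>) (18 * d - 12) (108 * \<sigma>)"
    unfolding line_rel_def using m by (simp add: algebra_simps power2_eq_square)
  from ec_add_line [OF this]
  obtain y' where QQ: "ec_add (- 432) (Affine (18 * d - 12) (108 * \<sigma>)) (Affine (18 * d - 12) (108 * \<sigma>))
      = Affine (m ^ 2 - (18 * d - 12) - (18 * d - 12)) y'"
    using \<sigma>0 by auto
  have "X = \<rho> / \<sigma> ^ 2"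
    unfolding X R_def [symmetric] S_def [symmetric] SH RH using H(4) by (simp add: power_mult_distrib)
  then have X\<sigma>: "X * \<sigma> ^ 2 = \<rho>" using \<sigma>0 by simp
  have "\<sigma> ^ 2 * (m ^ 2 - (18 * d - 12) - (18 * d - 12) - x)
    = (m * \<sigma>) ^ 2 - 18 * (d - 1) * (2 * \<sigma> ^ 2) - 9 / 4 * (16 * (X * \<sigma> ^ 2))"
    unfolding xy(1) by (simp add: algebra_simps power2_eq_square)
  also have "\<dots> = 0"
    unfolding m X\<sigma> \<sigma> \<rho> by (simp add: field_simps eval_nat_numeral)
  finally have "\<sigma> ^ 2 * (m ^ 2 - (18 * d - 12) - (18 * d - 12) - x) = 0" .
  then have "m ^ 2 - (18 * d - 12) - (18 * d - 12) = x" using \<sigma>0 by simp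
  then show ?thesis
    using ec_half_up_to_sign [OF Q P] QQ by simp
qed

lemma curve11_all_torsion:
  assumes P: "P \<in> ec_points (- 432) (8208 :: rat)"
  shows "torsion (ec_group (- 432) 8208) P"
proof -
  have "torsion (ec_group (of_int (- 432)) (of_int 8208)) P"
  proof (rule ec_all_torsion_if_halving [where c = 1])
    fix P :: "rat ec_point"
    assume P: "P \<in> ec_points (of_int (- 432)) (of_int 8208)" and "P \<noteq> Infinity"
    then obtain x y where xy: "P = Affine x y" by (cases P) auto
    then obtain Q where "Q \<in> ec_points (- 432) 8208" "ec_add (- 432) Q Q = P"
      using curve11_halving P by auto
    then show "\<exists>Q \<in> ec_points (of_int (- 432)) (of_int 8208).
      \<exists>T \<in> ec_points (of_int (- 432)) (of_int 8208). ec_add (of_int (- 432)) T T = Infinity \<and>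
        P = ec_add (of_int (- 432)) (ec_add (of_int (- 432)) Q Q) T \<and>
        ec_height (ec_add (of_int (- 432)) Q Q) \<le> 1 * ec_height P"
      by (intro bexI [of _ Q] bexI [of _ Infinity]) auto
  qed (use P in \<open>auto simp: ec_nonsingular_def\<close>)
  then show ?thesis by simp
qed

text \<open>The factor 3/4 relates the members of the family at 27/8 and 27/4 to the integral models
  used in the descents.\<close>

lemma E3_rank_zero:
  assumes abc: "a * b * c \<noteq> 0" and b2: "b ^ 2 = k * a * c" and ns: "ec_nonsingular A B"
    and k: "- 3 * k ^ 2 = A * (3 / 4) ^ 4" "k ^ 3 * (k - 2) = B * (3 / 4) ^ 6"
    and tors: "\<And>P. P \<in> ec_points A B \<Longrightarrow> torsion (ec_group A B) P"
  shows "abelian_group_rank (E3 a b c) = 0"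
proof -
  define u where "u = a * c ^ 2 / b"
  have u: "3 / 4 * u \<noteq> 0" using abc by (auto simp: u_def)
  have "k = b ^ 2 / (a * c)" using abc b2 by (auto simp: field_simps)
  from E3_eq_scaled [OF abc this u_def]
  have "E3 a b c = ec_group (A * (3 / 4 * u) ^ 4) (B * (3 / 4 * u) ^ 6)"
    unfolding k power_mult_distrib by (simp only: mult.assoc)
  then show ?thesis
    using ec_rank_zero_scaled [OF ns u tors] by simp
qed

theorem theorem2p6:
  fixes a b c :: rat
  assumes "a * b * c \<noteq> 0"
    and "4 * a * c - b ^ 2 \<noteq> 0"
  shows "((\<forall>k \<in> {27 / 8, 27 / 4}. b ^ 2 \<noteq> k * a * c) \<longrightarrow> abelian_group_rank (E3 a b c) > 0) \<and>
         ((\<exists>k \<in> {27 / 8, 27 / 4}. b ^ 2 = k * a * c) \<longrightarrow> abelian_group_rank (E3 a b c) = 0)"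
proof (intro conjI impI)
  assume "\<forall>k \<in> {27 / 8, 27 / 4}. b ^ 2 \<noteq> k * a * c"
  then show "abelian_group_rank (E3 a b c) > 0"
    using E3_rank_pos [OF assms] by simp
next
  assume "\<exists>k \<in> {27 / 8, 27 / 4}. b ^ 2 = k * a * c"
  then consider "b ^ 2 = 27 / 8 * a * c" | "b ^ 2 = 27 / 4 * a * c" by blast
  then show "abelian_group_rank (E3 a b c) = 0"
  proof cases
    case 1
    show ?thesis
      by (rule E3_rank_zero [OF assms(1) 1 _ _ _ curve20_all_torsion])
        (simp_all add: ec_nonsingular_def eval_nat_numeral)
  next
    case 2
    show ?thesis
      by (rule E3_rank_zero [OF assms(1) 2 _ _ _ curve11_all_torsion])
        (simp_all add: ec_nonsingular_def eval_nat_numeral)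
  qed
qed

end
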